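(* Let $\mathbb{F}$ be a field of characteristic not two, and let $X:V\to V$ be a $1$-fold cross product on the finite-dimensional, even-dimensional $\mathbb{F}$-vector space $V$, relative to a nondegenerate symmetric bilinear form $b$. Let $\mathbb{K}=\mathbb{F}\,\mathrm{id}\oplus\mathbb{F}X\subseteq \mathrm{End}_{\mathbb{F}}(V)$. Then, as affine group schemes over $\mathbb{F}$: (1) $\mathbf{Aut}(V,X)=\mathbf{Cent}_{\mathbf{GL}(V)}(X)$. (2) $\mathbf{Aut}(V,X,b)=\mathbf{U}(V,h)$, where $h$ is the nondegenerate hermitian form $h:V\times V\to\mathbb{K}$ given by $h(u,v)=b(u,v)\,\mathrm{id}-b(X(u),v)X$ for any $u,v\in V$.
   Context: A $1$-fold cross product on $V$ relative to a nondegenerate symmetric bilinear form $b$ is a linear map $X:V\to V$ with $b(X(v),v)=0$ and $b(X(v),X(v))=b(v,v)$ for all $v\in V$. Such an $X$ satisfies $X^2=-\mathrm{id}$, so $\mathbb{K}=\mathbb{F}\,\mathrm{id}\oplus\mathbb{F}X$ is a quadratic étale $\mathbb{F}$-algebra (isomorphic to $\mathbb{F}\times\mathbb{F}$ if $-1\in\mathbb{F}^2$, a quadratic field extension otherwise), with canonical involution determined by $X\mapsto -X$. Hermitian means: $h$ is $\mathbb{F}$-bilinear, $h(X(u),v)=Xh(u,v)$ and $h(u,v)=\overline{h(v,u)}$ for all $u,v\in V$, where the bar is the canonical involution of $\mathbb{K}$. Affine group schemes are viewed as functors on unital commutative associative $\mathbb{F}$-algebras $R$; $V_R=V\otimes_{\mathbb{F}}R$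 and a subscript $R$ denotes scalar extension. $\mathbf{Aut}(V,X)(R)=\{\varphi\in\mathrm{GL}_R(V_R):\varphi X_R=X_R\varphi\}$; $\mathbf{Aut}(V,X,b)(R)=\mathbf{Aut}(V,X)(R)\cap\mathbf{O}(V,b)(R)$, where $\mathbf{O}(V,b)$ is the orthogonal group scheme; $\mathbf{Cent}_{\mathbf{GL}(V)}(X)$ is the group scheme of elements of $\mathbf{GL}(V)$ commuting with $X$; $\mathbf{U}(V,h)(R)$ is the set of $\varphi\in\mathrm{End}_{\mathbb{K}\otimes_{\mathbb{F}}R}(V_R)$ such that $h_R(\varphi(u),\varphi(v))=h_R(u,v)$ for all $u,v\in V_R$. *)

theory Defs
  imports
    "HOL-Algebra.Free_Abelian_Groups"
    "HOL-Algebra.Generated_Groups"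
    "Jordan_Normal_Form.Missing_VectorSpace"
begin

section \<open>Linear algebra over a commutative ring\<close>

text \<open>
  Linear maps are made extensional (undefined off the carrier), so that equality of the
  HOL functions is equality of the maps.
\<close>

definition End_alg ::
  "('a, 'c) ring_scheme \<Rightarrow> ('a, 'v, 'd) module_scheme \<Rightarrow> ('a, 'v \<Rightarrow> 'v) module" where
  "End_alg A M =
    \<lparr> carrier = module_hom A M M \<inter> extensional (carrier M),
      mult = compose (carrier M),
      one = (\<lambda>v\<in>carrier M. v),
      zero = (\<lambda>v\<in>carrier M. \<zero>\<^bsub>M\<^esub>),
      add = (\<lambda>f g. \<lambda>v\<in>carrier M. f v \<oplus>\<^bsub>M\<^esub> g v),
      smult = (\<lambda>a f. \<lambda>v\<in>carrier M. a \<odot>\<^bsub>M\<^esub> f v) \<rparr>"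

definition regular_module :: "('a, 'c) ring_scheme \<Rightarrow> ('a, 'a) module" where
  "regular_module A =
    \<lparr> carrier = carrier A, mult = mult A, one = \<one>\<^bsub>A\<^esub>, zero = \<zero>\<^bsub>A\<^esub>, add = add A, smult = mult A \<rparr>"

definition bilinear_map ::
  "('a, 'c) ring_scheme \<Rightarrow> ('a, 'v, 'd) module_scheme \<Rightarrow> ('a, 'w, 'e) module_scheme
    \<Rightarrow> ('v \<Rightarrow> 'v \<Rightarrow> 'w) \<Rightarrow> bool" where
  "bilinear_map A M W \<beta> \<longleftrightarrow>
    (\<forall>u\<in>carrier M. (\<lambda>v. \<beta> u v) \<in> module_hom A M W) \<and>
    (\<forall>v\<in>carrier M. (\<lambda>u. \<beta> u v) \<in> module_hom A M W)"

definition symmetric_bilinear_form ::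
  "('f, 'c) ring_scheme \<Rightarrow> ('f, 'v, 'd) module_scheme \<Rightarrow> ('v \<Rightarrow> 'v \<Rightarrow> 'f) \<Rightarrow> bool" where
  "symmetric_bilinear_form F V b \<longleftrightarrow>
    bilinear_map F V (regular_module F) b \<and>
    (\<forall>u\<in>carrier V. \<forall>v\<in>carrier V. b u v = b v u)"

text \<open>For symmetric and for hermitian forms the left and the right radical coincide.\<close>

definition nondegenerate ::
  "('f, 'v, 'd) module_scheme \<Rightarrow> ('g, 'w, 'e) module_scheme \<Rightarrow> ('v \<Rightarrow> 'v \<Rightarrow> 'w) \<Rightarrow> bool" where
  "nondegenerate V W \<beta> \<longleftrightarrow>
    (\<forall>u\<in>carrier V. (\<forall>v\<in>carrier V. \<beta> u v = \<zero>\<^bsub>W\<^esub>) \<longrightarrow> u = \<zero>\<^bsub>V\<^esub>)"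

definition one_fold_cross_product ::
  "('f, 'c) ring_scheme \<Rightarrow> ('f, 'v, 'd) module_scheme \<Rightarrow> ('v \<Rightarrow> 'v \<Rightarrow> 'f) \<Rightarrow> ('v \<Rightarrow> 'v) \<Rightarrow> bool" where
  "one_fold_cross_product F V b X \<longleftrightarrow>
    X \<in> carrier (End_alg F V) \<and>
    (\<forall>v\<in>carrier V. b (X v) v = \<zero>\<^bsub>F\<^esub> \<and> b (X v) (X v) = b v v)"


section \<open>Tensor products\<close>

definition tensor_relators ::
  "('f, 'c) ring_scheme \<Rightarrow> ('f, 'm, 'd) module_scheme \<Rightarrow> ('f, 'n, 'e) module_scheme
    \<Rightarrow> ('m \<times> 'n \<Rightarrow>\<^sub>0 int) set" where
  "tensor_relators F M N =
    {frag_of (m \<oplus>\<^bsub>M\<^esub> m', n) - frag_of (m, n) - frag_of (m', n) | m m' n.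
       m \<in> carrier M \<and> m' \<in> carrier M \<and> n \<in> carrier N} \<union>
    {frag_of (m, n \<oplus>\<^bsub>N\<^esub> n') - frag_of (m, n) - frag_of (m, n') | m n n'.
       m \<in> carrier M \<and> n \<in> carrier N \<and> n' \<in> carrier N} \<union>
    {frag_of (a \<odot>\<^bsub>M\<^esub> m, n) - frag_of (m, a \<odot>\<^bsub>N\<^esub> n) | a m n.
       a \<in> carrier F \<and> m \<in> carrier M \<and> n \<in> carrier N}"

definition tensor_subgroup ::
  "('f, 'c) ring_scheme \<Rightarrow> ('f, 'm, 'd) module_scheme \<Rightarrow> ('f, 'n, 'e) module_scheme
    \<Rightarrow> ('m \<times> 'n \<Rightarrow>\<^sub>0 int) set" where
  "tensor_subgroup F M N =
    generate (free_Abelian_group (carrier M \<times> carrier N)) (tensor_relators F M N)"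

definition tensor_group ::
  "('f, 'c) ring_scheme \<Rightarrow> ('f, 'm, 'd) module_scheme \<Rightarrow> ('f, 'n, 'e) module_scheme
    \<Rightarrow> ('m \<times> 'n \<Rightarrow>\<^sub>0 int) set monoid" where
  "tensor_group F M N = free_Abelian_group (carrier M \<times> carrier N) Mod tensor_subgroup F M N"

definition pure_tensor ::
  "('f, 'c) ring_scheme \<Rightarrow> ('f, 'm, 'd) module_scheme \<Rightarrow> ('f, 'n, 'e) module_scheme
    \<Rightarrow> 'm \<Rightarrow> 'n \<Rightarrow> ('m \<times> 'n \<Rightarrow>\<^sub>0 int) set" where
  "pure_tensor F M N m n =
    tensor_subgroup F M N #>\<^bsub>free_Abelian_group (carrier M \<times> carrier N)\<^esub> frag_of (m, n)"

text \<open>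
  The homomorphism from the tensor product to the abelian group \<open>G\<close> that sends the pure tensor of
  \<open>m\<close> and \<open>n\<close> to \<open>t m n\<close>. It exists and is unique when \<open>t\<close> is additive in each variable and
  balanced over \<open>F\<close>; it is only used for such \<open>t\<close>.
\<close>

definition tensor_lift ::
  "('f, 'c) ring_scheme \<Rightarrow> ('f, 'm, 'd) module_scheme \<Rightarrow> ('f, 'n, 'e) module_scheme
    \<Rightarrow> ('g, 'h) monoid_scheme \<Rightarrow> ('m \<Rightarrow> 'n \<Rightarrow> 'g) \<Rightarrow> ('m \<times> 'n \<Rightarrow>\<^sub>0 int) set \<Rightarrow> 'g" where
  "tensor_lift F M N G t =
    (THE g. g \<in> hom (tensor_group F M N) G \<inter> extensional (carrier (tensor_group F M N)) \<and>
       (\<forall>m\<in>carrier M. \<forall>n\<in>carrier N. g (pure_tensor F M N m n) = t m n))"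

text \<open>
  By currying, the biadditive map on a pair of tensor products whose value at the pure tensors
  of \<open>m, n\<close> and of \<open>m', n'\<close> is \<open>t m n m' n'\<close>.
\<close>

definition tensor_lift2 ::
  "('f, 'c) ring_scheme \<Rightarrow> ('f, 'm, 'd) module_scheme \<Rightarrow> ('f, 'n, 'e) module_scheme
    \<Rightarrow> ('f, 'p, 'i) module_scheme \<Rightarrow> ('f, 'q, 'j) module_scheme \<Rightarrow> ('g, 'h) monoid_scheme
    \<Rightarrow> ('m \<Rightarrow> 'n \<Rightarrow> 'p \<Rightarrow> 'q \<Rightarrow> 'g)
    \<Rightarrow> ('m \<times> 'n \<Rightarrow>\<^sub>0 int) set \<Rightarrow> ('p \<times> 'q \<Rightarrow>\<^sub>0 int) set \<Rightarrow> 'g" where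
  "tensor_lift2 F M N P Q G t \<xi> \<eta> =
    tensor_lift F M N G (\<lambda>m n. tensor_lift F P Q G (\<lambda>p q. t m n p q) \<eta>) \<xi>"


section \<open>Extension of scalars\<close>

text \<open>
  For an \<open>F\<close>-module \<open>V\<close> and an \<open>F\<close>-algebra \<open>R\<close>, the \<open>R\<close>-module \<open>V\<^sub>R\<close>. The record type
  forces a multiplication and a one, which carry no information here.
\<close>

definition scalar_ext ::
  "('f, 'c) ring_scheme \<Rightarrow> ('f, 'v, 'd) module_scheme \<Rightarrow> ('f, 'r, 'e) module_scheme
    \<Rightarrow> ('r, ('v \<times> 'r \<Rightarrow>\<^sub>0 int) set) module" where
  "scalar_ext F V R =
    \<lparr> carrier = carrier (tensor_group F V R),
      mult = (\<lambda>_ _. \<one>\<^bsub>tensor_group F V R\<^esub>),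
      one = \<one>\<^bsub>tensor_group F V R\<^esub>,
      zero = \<one>\<^bsub>tensor_group F V R\<^esub>,
      add = mult (tensor_group F V R),
      smult = (\<lambda>r. tensor_lift F V R (tensor_group F V R)
                     (\<lambda>v s. pure_tensor F V R v (r \<otimes>\<^bsub>R\<^esub> s))) \<rparr>"

definition algebra_ext ::
  "('f, 'c) ring_scheme \<Rightarrow> ('f, 'k, 'd) module_scheme \<Rightarrow> ('f, 'r, 'e) module_scheme
    \<Rightarrow> ('r, ('k \<times> 'r \<Rightarrow>\<^sub>0 int) set) module" where
  "algebra_ext F K R = (scalar_ext F K R)
    \<lparr> mult := tensor_lift2 F K R K R (tensor_group F K R)
                (\<lambda>k r l s. pure_tensor F K R (k \<otimes>\<^bsub>K\<^esub> l) (r \<otimes>\<^bsub>R\<^esub> s)),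
      one := pure_tensor F K R \<one>\<^bsub>K\<^esub> \<one>\<^bsub>R\<^esub> \<rparr>"

definition linear_ext ::
  "('f, 'c) ring_scheme \<Rightarrow> ('f, 'v, 'd) module_scheme \<Rightarrow> ('f, 'r, 'e) module_scheme
    \<Rightarrow> ('v \<Rightarrow> 'v) \<Rightarrow> ('v \<times> 'r \<Rightarrow>\<^sub>0 int) set \<Rightarrow> ('v \<times> 'r \<Rightarrow>\<^sub>0 int) set" where
  "linear_ext F V R X =
    tensor_lift F V R (tensor_group F V R) (\<lambda>v r. pure_tensor F V R (X v) r)"

text \<open>The \<open>R\<close>-valued extension of an \<open>F\<close>-valued form (identifying \<open>F\<^sub>R\<close> with \<open>R\<close>).\<close>

definition form_ext ::
  "('f, 'c) ring_scheme \<Rightarrow> ('f, 'v, 'd) module_scheme \<Rightarrow> ('f, 'r, 'e) module_scheme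
    \<Rightarrow> ('v \<Rightarrow> 'v \<Rightarrow> 'f) \<Rightarrow> ('v \<times> 'r \<Rightarrow>\<^sub>0 int) set \<Rightarrow> ('v \<times> 'r \<Rightarrow>\<^sub>0 int) set \<Rightarrow> 'r" where
  "form_ext F V R b =
    tensor_lift2 F V R V R (add_monoid R) (\<lambda>u r v s. b u v \<odot>\<^bsub>R\<^esub> (r \<otimes>\<^bsub>R\<^esub> s))"

definition bilinear_ext ::
  "('f, 'c) ring_scheme \<Rightarrow> ('f, 'v, 'd) module_scheme \<Rightarrow> ('f, 'k, 'i) module_scheme
    \<Rightarrow> ('f, 'r, 'e) module_scheme \<Rightarrow> ('v \<Rightarrow> 'v \<Rightarrow> 'k)
    \<Rightarrow> ('v \<times> 'r \<Rightarrow>\<^sub>0 int) set \<Rightarrow> ('v \<times> 'r \<Rightarrow>\<^sub>0 int) set \<Rightarrow> ('k \<times> 'r \<Rightarrow>\<^sub>0 int) set" where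
  "bilinear_ext F V K R h =
    tensor_lift2 F V R V R (tensor_group F K R) (\<lambda>u r v s. pure_tensor F K R (h u v) (r \<otimes>\<^bsub>R\<^esub> s))"


section \<open>The algebra \<open>K\<close> and hermitian forms\<close>

definition cross_algebra ::
  "('f, 'c) ring_scheme \<Rightarrow> ('f, 'v, 'd) module_scheme \<Rightarrow> ('v \<Rightarrow> 'v) \<Rightarrow> ('f, 'v \<Rightarrow> 'v) module" where
  "cross_algebra F V X = (End_alg F V)
    \<lparr> carrier := {a \<odot>\<^bsub>End_alg F V\<^esub> \<one>\<^bsub>End_alg F V\<^esub> \<oplus>\<^bsub>End_alg F V\<^esub> c \<odot>\<^bsub>End_alg F V\<^esub> X | a c.
                    a \<in> carrier F \<and> c \<in> carrier F} \<rparr>"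

text \<open>
  The canonical involution of \<open>K\<close>. It is well defined: for a cross product \<open>X\<close> on
  \<open>V \<noteq> 0\<close> the maps \<open>id\<close> and \<open>X\<close> are linearly independent, and \<open>K = 0\<close> if \<open>V = 0\<close>.
\<close>

definition cross_conj ::
  "('f, 'c) ring_scheme \<Rightarrow> ('f, 'v, 'd) module_scheme \<Rightarrow> ('v \<Rightarrow> 'v) \<Rightarrow> ('v \<Rightarrow> 'v) \<Rightarrow> ('v \<Rightarrow> 'v)" where
  "cross_conj F V X k = (THE k'. \<exists>a\<in>carrier F. \<exists>c\<in>carrier F.
     k = a \<odot>\<^bsub>End_alg F V\<^esub> \<one>\<^bsub>End_alg F V\<^esub> \<oplus>\<^bsub>End_alg F V\<^esub> c \<odot>\<^bsub>End_alg F V\<^esub> X \<and>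
     k' = a \<odot>\<^bsub>End_alg F V\<^esub> \<one>\<^bsub>End_alg F V\<^esub> \<ominus>\<^bsub>End_alg F V\<^esub> c \<odot>\<^bsub>End_alg F V\<^esub> X)"

definition hermitian_form ::
  "('f, 'c) ring_scheme \<Rightarrow> ('f, 'v, 'd) module_scheme \<Rightarrow> ('v \<Rightarrow> 'v)
    \<Rightarrow> ('v \<Rightarrow> 'v \<Rightarrow> 'v \<Rightarrow> 'v) \<Rightarrow> bool" where
  "hermitian_form F V X h \<longleftrightarrow>
    bilinear_map F V (cross_algebra F V X) h \<and>
    (\<forall>u\<in>carrier V. \<forall>v\<in>carrier V.
       h (X u) v = X \<otimes>\<^bsub>cross_algebra F V X\<^esub> h u v \<and> h u v = cross_conj F V X (h v u))"

definition cross_hermitian ::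
  "('f, 'c) ring_scheme \<Rightarrow> ('f, 'v, 'd) module_scheme \<Rightarrow> ('v \<Rightarrow> 'v \<Rightarrow> 'f) \<Rightarrow> ('v \<Rightarrow> 'v)
    \<Rightarrow> 'v \<Rightarrow> 'v \<Rightarrow> ('v \<Rightarrow> 'v)" where
  "cross_hermitian F V b X u v =
    b u v \<odot>\<^bsub>End_alg F V\<^esub> \<one>\<^bsub>End_alg F V\<^esub> \<ominus>\<^bsub>End_alg F V\<^esub> b (X u) v \<odot>\<^bsub>End_alg F V\<^esub> X"

text \<open>\<open>V\<^sub>R\<close> as a module over the algebra \<open>K\<^sub>R\<close>, where \<open>K\<close> acts on \<open>V\<close> by evaluation.\<close>

definition cross_scalar_ext ::
  "('f, 'c) ring_scheme \<Rightarrow> ('f, 'v, 'd) module_scheme \<Rightarrow> ('v \<Rightarrow> 'v) \<Rightarrow> ('f, 'r, 'e) module_scheme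
    \<Rightarrow> ((('v \<Rightarrow> 'v) \<times> 'r \<Rightarrow>\<^sub>0 int) set, ('v \<times> 'r \<Rightarrow>\<^sub>0 int) set) module" where
  "cross_scalar_ext F V X R =
    \<lparr> carrier = carrier (scalar_ext F V R),
      mult = mult (scalar_ext F V R),
      one = \<one>\<^bsub>scalar_ext F V R\<^esub>,
      zero = \<zero>\<^bsub>scalar_ext F V R\<^esub>,
      add = add (scalar_ext F V R),
      smult = tensor_lift2 F (cross_algebra F V X) R V R (tensor_group F V R)
                (\<lambda>k r v s. pure_tensor F V R (k v) (r \<otimes>\<^bsub>R\<^esub> s)) \<rparr>"


section \<open>The group functors\<close>

text \<open>
  A group functor assigns a group to every commutative \<open>F\<close>-algebra \<open>R\<close> (HOL-Algebra carriers, so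
  the zero algebra is included). The groups below all consist of endomorphisms of
  \<open>V\<^sub>R\<close> under composition, and all the functors have the same effect on morphisms, namely
  \<open>base_change\<close> below.
\<close>

definition GL_fun ::
  "('f, 'c) ring_scheme \<Rightarrow> ('f, 'v, 'd) module_scheme \<Rightarrow> ('f, 'r, 'e) module_scheme
    \<Rightarrow> (('v \<times> 'r \<Rightarrow>\<^sub>0 int) set \<Rightarrow> ('v \<times> 'r \<Rightarrow>\<^sub>0 int) set) monoid" where
  "GL_fun F V R = units_of (End_alg R (scalar_ext F V R))"

definition Aut_X_fun ::
  "('f, 'c) ring_scheme \<Rightarrow> ('f, 'v, 'd) module_scheme \<Rightarrow> ('v \<Rightarrow> 'v) \<Rightarrow> ('f, 'r, 'e) module_scheme
    \<Rightarrow> (('v \<times> 'r \<Rightarrow>\<^sub>0 int) set \<Rightarrow> ('v \<times> 'r \<Rightarrow>\<^sub>0 int) set) monoid" where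
  "Aut_X_fun F V X R = (GL_fun F V R)
    \<lparr> carrier := {\<phi> \<in> carrier (GL_fun F V R).
        \<forall>\<xi>\<in>carrier (scalar_ext F V R). \<phi> (linear_ext F V R X \<xi>) = linear_ext F V R X (\<phi> \<xi>)} \<rparr>"

definition Cent_GL_fun ::
  "('f, 'c) ring_scheme \<Rightarrow> ('f, 'v, 'd) module_scheme \<Rightarrow> ('v \<Rightarrow> 'v) \<Rightarrow> ('f, 'r, 'e) module_scheme
    \<Rightarrow> (('v \<times> 'r \<Rightarrow>\<^sub>0 int) set \<Rightarrow> ('v \<times> 'r \<Rightarrow>\<^sub>0 int) set) monoid" where
  "Cent_GL_fun F V X R = (GL_fun F V R)
    \<lparr> carrier := {\<phi> \<in> carrier (GL_fun F V R).
        \<phi> \<otimes>\<^bsub>End_alg R (scalar_ext F V R)\<^esub> linear_ext F V R X =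
        linear_ext F V R X \<otimes>\<^bsub>End_alg R (scalar_ext F V R)\<^esub> \<phi>} \<rparr>"

definition O_fun ::
  "('f, 'c) ring_scheme \<Rightarrow> ('f, 'v, 'd) module_scheme \<Rightarrow> ('v \<Rightarrow> 'v \<Rightarrow> 'f)
    \<Rightarrow> ('f, 'r, 'e) module_scheme
    \<Rightarrow> (('v \<times> 'r \<Rightarrow>\<^sub>0 int) set \<Rightarrow> ('v \<times> 'r \<Rightarrow>\<^sub>0 int) set) monoid" where
  "O_fun F V b R = (GL_fun F V R)
    \<lparr> carrier := {\<phi> \<in> carrier (GL_fun F V R).
        \<forall>\<xi>\<in>carrier (scalar_ext F V R). \<forall>\<eta>\<in>carrier (scalar_ext F V R).
          form_ext F V R b (\<phi> \<xi>) (\<phi> \<eta>) = form_ext F V R b \<xi> \<eta>} \<rparr>"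

definition Aut_Xb_fun ::
  "('f, 'c) ring_scheme \<Rightarrow> ('f, 'v, 'd) module_scheme \<Rightarrow> ('v \<Rightarrow> 'v) \<Rightarrow> ('v \<Rightarrow> 'v \<Rightarrow> 'f)
    \<Rightarrow> ('f, 'r, 'e) module_scheme
    \<Rightarrow> (('v \<times> 'r \<Rightarrow>\<^sub>0 int) set \<Rightarrow> ('v \<times> 'r \<Rightarrow>\<^sub>0 int) set) monoid" where
  "Aut_Xb_fun F V X b R = (GL_fun F V R)
    \<lparr> carrier := carrier (Aut_X_fun F V X R) \<inter> carrier (O_fun F V b R) \<rparr>"

text \<open>Invertibility is not part of the definition of the unitary group.\<close>

definition U_fun ::
  "('f, 'c) ring_scheme \<Rightarrow> ('f, 'v, 'd) module_scheme \<Rightarrow> ('v \<Rightarrow> 'v)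
    \<Rightarrow> ('v \<Rightarrow> 'v \<Rightarrow> 'v \<Rightarrow> 'v) \<Rightarrow> ('f, 'r, 'e) module_scheme
    \<Rightarrow> (('v \<times> 'r \<Rightarrow>\<^sub>0 int) set \<Rightarrow> ('v \<times> 'r \<Rightarrow>\<^sub>0 int) set) monoid" where
  "U_fun F V X h R =
    (let E = End_alg (algebra_ext F (cross_algebra F V X) R) (cross_scalar_ext F V X R);
         hR = bilinear_ext F V (cross_algebra F V X) R h
     in \<lparr> carrier = {\<phi> \<in> carrier E.
            \<forall>\<xi>\<in>carrier (scalar_ext F V R). \<forall>\<eta>\<in>carrier (scalar_ext F V R).
              hR (\<phi> \<xi>) (\<phi> \<eta>) = hR \<xi> \<eta>},
          mult = mult E, one = \<one>\<^bsub>E\<^esub> \<rparr>)"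

definition algebra_hom ::
  "('f, 'c) ring_scheme \<Rightarrow> ('f, 'r, 'd) module_scheme \<Rightarrow> ('f, 's, 'e) module_scheme
    \<Rightarrow> ('r \<Rightarrow> 's) set" where
  "algebra_hom F R S = ring_hom R S \<inter> module_hom F R S"

definition change_of_ring ::
  "('f, 'c) ring_scheme \<Rightarrow> ('f, 'v, 'd) module_scheme \<Rightarrow> ('f, 'r, 'e) module_scheme
    \<Rightarrow> ('f, 's, 'i) module_scheme \<Rightarrow> ('r \<Rightarrow> 's)
    \<Rightarrow> ('v \<times> 'r \<Rightarrow>\<^sub>0 int) set \<Rightarrow> ('v \<times> 's \<Rightarrow>\<^sub>0 int) set" where
  "change_of_ring F V R S f =
    tensor_lift F V R (tensor_group F V S) (\<lambda>v r. pure_tensor F V S v (f r))"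

text \<open>
  For \<open>f : R \<rightarrow> S\<close> the base change of an \<open>R\<close>-endomorphism of \<open>V\<^sub>R\<close> is the unique
  \<open>S\<close>-endomorphism of \<open>V\<^sub>S\<close> compatible with it along the canonical map \<open>V\<^sub>R \<rightarrow> V\<^sub>S\<close>.
\<close>

definition base_change ::
  "('f, 'c) ring_scheme \<Rightarrow> ('f, 'v, 'd) module_scheme \<Rightarrow> ('f, 'r, 'e) module_scheme
    \<Rightarrow> ('f, 's, 'i) module_scheme \<Rightarrow> ('r \<Rightarrow> 's)
    \<Rightarrow> (('v \<times> 'r \<Rightarrow>\<^sub>0 int) set \<Rightarrow> ('v \<times> 'r \<Rightarrow>\<^sub>0 int) set)
    \<Rightarrow> ('v \<times> 's \<Rightarrow>\<^sub>0 int) set \<Rightarrow> ('v \<times> 's \<Rightarrow>\<^sub>0 int) set" where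
  "base_change F V R S f \<phi> =
    (THE \<psi>. \<psi> \<in> carrier (End_alg S (scalar_ext F V S)) \<and>
       (\<forall>\<xi>\<in>carrier (scalar_ext F V R).
          \<psi> (change_of_ring F V R S f \<xi>) = change_of_ring F V R S f (\<phi> \<xi>)))"

end

theory Submission
  imports Defs
begin

text \<open>
  Over \<open>R\<close> one has \<open>h\<^sub>R(\<xi>, \<eta>) = id \<otimes> b\<^sub>R(\<xi>, \<eta>) - X \<otimes> b\<^sub>R(X\<^sub>R \<xi>, \<eta>)\<close>, so an automorphism that commutes with
  \<open>X\<^sub>R\<close> and preserves \<open>b\<^sub>R\<close> preserves \<open>h\<^sub>R\<close>. Conversely \<open>b = p \<circ> h\<close> for an \<open>F\<close>-linear map \<open>p : K \<rightarrow> F\<close>,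
  and \<open>K\<^sub>R\<close>-linearity is \<open>R\<close>-linearity together with commutation with \<open>X\<^sub>R\<close>. It remains to see that
  an \<open>R\<close>-endomorphism \<open>\<phi>\<close> of \<open>V\<^sub>R\<close> that preserves \<open>b\<^sub>R\<close> is invertible: if \<open>v = \<Sum> b(v, e) g(e)\<close> on \<open>V\<close>,
  the adjoint \<open>\<eta> \<mapsto> \<Sum> b\<^sub>R(\<eta>, \<phi>(e \<otimes> 1)) (g(e) \<otimes> 1)\<close> is a left inverse of \<open>\<phi>\<close>, hence a surjective
  endomorphism of a finitely generated module, hence injective by Nakayama's argument.
\<close>

section \<open>Universal property of the tensor product\<close>

text \<open>\<open>tensor_lift\<close>, \<open>base_change\<close> and \<open>cross_conj\<close> are
  definite descriptions, so each must first be shown to exist and be unique. After that, identities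
  between additive maps on a tensor product are checked on pure tensors alone. The algebra R is
  arbitrary, possibly zero, so the proof invokes neither a basis of V_R nor linear independence of 1
  and X in K_R. What it takes from the field are two identities over F that survive tensoring: the
  expansion of v in a dual family, and a linear map recovering b from h. The latter divides by b(u,
  u) for an anisotropic u, which exists for V \<noteq> 0 because the characteristic is not two; V =
  0 is treated apart. The expansion also exhibits finitely many generators of V_R, which is what
  Nakayama's argument requires. All functors act on morphisms by \<open>base_change\<close>, so
  their equality reduces to equality of the groups over each R.\<close>

definition balanced_map ::
  "('f, 'c) ring_scheme \<Rightarrow> ('f, 'm, 'd) module_scheme \<Rightarrow> ('f, 'n, 'e) module_scheme
    \<Rightarrow> ('g, 'h) ring_scheme \<Rightarrow> ('m \<Rightarrow> 'n \<Rightarrow> 'g) \<Rightarrow> bool" where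
  "balanced_map F M N A t \<longleftrightarrow>
    (\<forall>m\<in>carrier M. \<forall>n\<in>carrier N. t m n \<in> carrier A) \<and>
    (\<forall>m\<in>carrier M. \<forall>m'\<in>carrier M. \<forall>n\<in>carrier N. t (m \<oplus>\<^bsub>M\<^esub> m') n = t m n \<oplus>\<^bsub>A\<^esub> t m' n) \<and>
    (\<forall>m\<in>carrier M. \<forall>n\<in>carrier N. \<forall>n'\<in>carrier N. t m (n \<oplus>\<^bsub>N\<^esub> n') = t m n \<oplus>\<^bsub>A\<^esub> t m n') \<and>
    (\<forall>a\<in>carrier F. \<forall>m\<in>carrier M. \<forall>n\<in>carrier N. t (a \<odot>\<^bsub>M\<^esub> m) n = t m (a \<odot>\<^bsub>N\<^esub> n))"

lemma balanced_mapI: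
  assumes "\<And>m n. m \<in> carrier M \<Longrightarrow> n \<in> carrier N \<Longrightarrow> t m n \<in> carrier A"
    and "\<And>m m' n. m \<in> carrier M \<Longrightarrow> m' \<in> carrier M \<Longrightarrow> n \<in> carrier N \<Longrightarrow>
      t (m \<oplus>\<^bsub>M\<^esub> m') n = t m n \<oplus>\<^bsub>A\<^esub> t m' n"
    and "\<And>m n n'. m \<in> carrier M \<Longrightarrow> n \<in> carrier N \<Longrightarrow> n' \<in> carrier N \<Longrightarrow>
      t m (n \<oplus>\<^bsub>N\<^esub> n') = t m n \<oplus>\<^bsub>A\<^esub> t m n'"
    and "\<And>a m n. a \<in> carrier F \<Longrightarrow> m \<in> carrier M \<Longrightarrow> n \<in> carrier N \<Longrightarrow>
      t (a \<odot>\<^bsub>M\<^esub> m) n = t m (a \<odot>\<^bsub>N\<^esub> n)"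
  shows "balanced_map F M N A t"
  using assms by (simp add: balanced_map_def)

lemma balanced_mapD:
  assumes "balanced_map F M N A t"
  shows "\<And>m n. m \<in> carrier M \<Longrightarrow> n \<in> carrier N \<Longrightarrow> t m n \<in> carrier A"
    and "\<And>m m' n. m \<in> carrier M \<Longrightarrow> m' \<in> carrier M \<Longrightarrow> n \<in> carrier N \<Longrightarrow>
      t (m \<oplus>\<^bsub>M\<^esub> m') n = t m n \<oplus>\<^bsub>A\<^esub> t m' n"
    and "\<And>m n n'. m \<in> carrier M \<Longrightarrow> n \<in> carrier N \<Longrightarrow> n' \<in> carrier N \<Longrightarrow>
      t m (n \<oplus>\<^bsub>N\<^esub> n') = t m n \<oplus>\<^bsub>A\<^esub> t m n'"
    and "\<And>a m n. a \<in> carrier F \<Longrightarrow> m \<in> carrier M \<Longrightarrow> n \<in> carrier N \<Longrightarrow>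
      t (a \<odot>\<^bsub>M\<^esub> m) n = t m (a \<odot>\<^bsub>N\<^esub> n)"
  using assms by (simp_all add: balanced_map_def)

definition additive_map :: "('g, 'c) ring_scheme \<Rightarrow> ('h, 'd) ring_scheme \<Rightarrow> ('g \<Rightarrow> 'h) \<Rightarrow> bool" where
  "additive_map A B g \<longleftrightarrow>
    g \<in> carrier A \<rightarrow> carrier B \<and>
    (\<forall>x\<in>carrier A. \<forall>y\<in>carrier A. g (x \<oplus>\<^bsub>A\<^esub> y) = g x \<oplus>\<^bsub>B\<^esub> g y)"

lemma additive_mapI:
  assumes "\<And>x. x \<in> carrier A \<Longrightarrow> g x \<in> carrier B"
    and "\<And>x y. x \<in> carrier A \<Longrightarrow> y \<in> carrier A \<Longrightarrow> g (x \<oplus>\<^bsub>A\<^esub> y) = g x \<oplus>\<^bsub>B\<^esub> g y"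
  shows "additive_map A B g"
  using assms by (simp add: additive_map_def)

lemma additive_map_closed: "additive_map A B g \<Longrightarrow> x \<in> carrier A \<Longrightarrow> g x \<in> carrier B"
  by (auto simp: additive_map_def)

lemma additive_map_add:
  "additive_map A B g \<Longrightarrow> x \<in> carrier A \<Longrightarrow> y \<in> carrier A \<Longrightarrow> g (x \<oplus>\<^bsub>A\<^esub> y) = g x \<oplus>\<^bsub>B\<^esub> g y"
  by (auto simp: additive_map_def)

lemma additive_map_zero:
  assumes "abelian_group A" "abelian_group B" "additive_map A B g"
  shows "g \<zero>\<^bsub>A\<^esub> = \<zero>\<^bsub>B\<^esub>"
proof -
  interpret A: abelian_group A by fact
  interpret B: abelian_group B by fact
  have "g \<zero>\<^bsub>A\<^esub> \<oplus>\<^bsub>B\<^esub> g \<zero>\<^bsub>A\<^esub> = g \<zero>\<^bsub>A\<^esub>"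
    using additive_map_add[OF assms(3), of "\<zero>\<^bsub>A\<^esub>" "\<zero>\<^bsub>A\<^esub>"] by simp
  then show ?thesis
    using additive_map_closed[OF assms(3)] B.add.l_cancel_one by auto
qed

lemma additive_map_finsum:
  assumes "abelian_group A" "abelian_group B" "additive_map A B g" "finite I"
    "x \<in> I \<rightarrow> carrier A"
  shows "g (finsum A x I) = finsum B (\<lambda>i. g (x i)) I"
  using assms(4,5)
proof (induction I)
  interpret A: abelian_group A by fact
  interpret B: abelian_group B by fact
  case empty
  then show ?case by (simp add: additive_map_zero[OF assms(1-3)])
next
  interpret A: abelian_group A by fact
  interpret B: abelian_group B by fact
  case (insert i I)
  have "(\<lambda>i. g (x i)) \<in> I \<rightarrow> carrier B" "g (x i) \<in> carrier B"
    using insert.prems additive_map_closed[OF assms(3)] by auto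
  then show ?case
    using insert by (simp add: additive_map_add[OF assms(3)] Pi_def)
qed

text \<open>Bridge between two encodings of one abelian group: \<open>tensor_lift\<close> expects
  its target as a multiplicative monoid, whereas the arguments here are additive. The instances that
  occur are \<open>tensor_group\<close> for an extended module and \<open>add_monoid R\<close> for
  an R-valued form.\<close>

definition additive_group :: "('g, 'c) ring_scheme \<Rightarrow> ('g, 'd) monoid_scheme \<Rightarrow> bool" where
  "additive_group A G \<longleftrightarrow>
    carrier G = carrier A \<and> mult G = add A \<and> \<one>\<^bsub>G\<^esub> = \<zero>\<^bsub>A\<^esub>"

lemma additive_group_add_monoid [simp]: "additive_group A (add_monoid A)"
  by (simp add: additive_group_def)

lemma hom_additive_group:
  "additive_group A G \<Longrightarrow> additive_group B H \<Longrightarrow> g \<in> hom G H \<longleftrightarrow> additive_map A B g"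
  by (auto simp: hom_def additive_map_def additive_group_def)

text \<open>The left side has the shape of the two additivity relators, so the vanishing of their
  classes can be read as an additivity law. \<open>add_minus_minus\<close> serves the converse
  purpose: a balanced map kills these relators.\<close>

lemma (in abelian_group) minus_minus_eq_zero:
  assumes "x \<in> carrier G" "y \<in> carrier G" "z \<in> carrier G"
  shows "x \<ominus> y \<ominus> z = \<zero> \<longleftrightarrow> x = y \<oplus> z"
proof -
  have "x \<ominus> y \<ominus> z = x \<ominus> (y \<oplus> z)"
    using assms by (simp add: minus_eq minus_add a_assoc)
  then show ?thesis using assms by simp
qed

lemma (in abelian_group) add_minus_minus:
  assumes "x \<in> carrier G" "y \<in> carrier G"
  shows "x \<oplus> y \<ominus> x \<ominus> y = \<zero>"
  by (subst minus_minus_eq_zero) (use assms in simp_all)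

section \<open>The tensor product as a quotient of a free abelian group\<close>

locale tensor_product = M: module F M + N: module F N for F (structure) and M and N
begin

abbreviation "\<T> \<equiv> scalar_ext F M N"
abbreviation "pure \<equiv> pure_tensor F M N"
abbreviation "Fr \<equiv> free_Abelian_group (carrier M \<times> carrier N)"

lemma additive_group_scalar_ext: "additive_group \<T> (tensor_group F M N)"
  by (simp add: additive_group_def scalar_ext_def)

lemma tensor_relators_subset: "tensor_relators F M N \<subseteq> carrier Fr"
proof -
  have k: "\<And>x y z. Poly_Mapping.keys (frag_of x - frag_of y - frag_of z) \<subseteq> {x, y, z}"
     "\<And>x y. Poly_Mapping.keys (frag_of x - frag_of y) \<subseteq> {x, y}"
    using keys_diff[of "frag_of _ - frag_of _" "frag_of _"] keys_diff[of "frag_of _" "frag_of _"]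
    by fastforce+
  show ?thesis
    unfolding tensor_relators_def
    by (safe; simp; rule subset_trans[OF k(1)] subset_trans[OF k(2)]; auto)
qed

lemma tensor_subgroup_normal: "tensor_subgroup F M N \<lhd> Fr"
proof -
  interpret Fr: comm_group Fr by (rule abelian_free_Abelian_group)
  show ?thesis
    unfolding tensor_subgroup_def
    by (intro Fr.subgroup_imp_normal Fr.generate_is_subgroup tensor_relators_subset)
qed

lemma tensor_group_comm_group: "comm_group (tensor_group F M N)"
proof -
  interpret Fr: comm_group Fr by (rule abelian_free_Abelian_group)
  show ?thesis
    unfolding tensor_group_def
    using Fr.abelian_FactGroup tensor_subgroup_normal normal_imp_subgroup by blast
qed

lemma abelian_group_scalar_ext: "abelian_group \<T>"
proof -
  interpret T: comm_group "tensor_group F M N" by (rule tensor_group_comm_group)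
  show ?thesis
    using T.m_assoc T.m_comm T.l_inv_ex T.m_closed T.one_closed T.l_one
    by (intro abelian_groupI) (simp_all add: scalar_ext_def)
qed

sublocale T: abelian_group \<T> by (rule abelian_group_scalar_ext)

definition "cls x = tensor_subgroup F M N #>\<^bsub>Fr\<^esub> x"

lemma cls_hom: "cls \<in> hom Fr (tensor_group F M N)"
  unfolding cls_def tensor_group_def
  using normal.r_coset_hom_Mod[OF tensor_subgroup_normal] by simp

lemma carrier_scalar_ext: "carrier \<T> = cls ` carrier Fr"
  by (auto simp: scalar_ext_def tensor_group_def FactGroup_def RCOSETS_def cls_def)

lemma pure_cls: "pure m n = cls (frag_of (m, n))"
  by (simp add: pure_tensor_def cls_def)

lemma cls_add:
  "x \<in> carrier Fr \<Longrightarrow> y \<in> carrier Fr \<Longrightarrow> cls (x + y) = cls x \<oplus>\<^bsub>\<T>\<^esub> cls y"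
  using hom_mult[OF cls_hom, of x y] by (simp add: scalar_ext_def)

lemma cls_closed: "x \<in> carrier Fr \<Longrightarrow> cls x \<in> carrier \<T>"
  using carrier_scalar_ext by blast

lemma cls_zero: "cls 0 = \<zero>\<^bsub>\<T>\<^esub>"
proof -
  have "cls 0 \<oplus>\<^bsub>\<T>\<^esub> cls 0 = cls 0" using cls_add[of 0 0] by simp
  then show ?thesis using cls_closed[of 0] by (simp add: T.add.l_cancel_one)
qed

lemma cls_minus: "x \<in> carrier Fr \<Longrightarrow> cls (- x) = \<ominus>\<^bsub>\<T>\<^esub> cls x"
proof -
  assume x: "x \<in> carrier Fr"
  then have x': "- x \<in> carrier Fr" by simp
  have "cls (- x) \<oplus>\<^bsub>\<T>\<^esub> cls x = \<zero>\<^bsub>\<T>\<^esub>" using cls_add[OF x' x] by (simp add: cls_zero)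
  then show ?thesis using cls_closed[OF x] cls_closed[OF x'] by (simp add: T.minus_equality)
qed

lemma cls_diff:
  "x \<in> carrier Fr \<Longrightarrow> y \<in> carrier Fr \<Longrightarrow> cls (x - y) = cls x \<ominus>\<^bsub>\<T>\<^esub> cls y"
  using cls_add[of x "- y"] cls_minus[of y] by (simp add: T.minus_eq)

text \<open>Applied to the three families of relators, this yields the laws of pure tensors:
  additivity on each side and the transfer of scalars.\<close>

lemma cls_relator: "x \<in> tensor_relators F M N \<Longrightarrow> cls x = \<zero>\<^bsub>\<T>\<^esub>"
proof -
  assume "x \<in> tensor_relators F M N"
  then have x: "x \<in> tensor_subgroup F M N" by (simp add: tensor_subgroup_def generate.incl)
  have s: "subgroup (tensor_subgroup F M N) Fr"
    using tensor_subgroup_normal by (rule normal_imp_subgroup)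
  have "cls x = tensor_subgroup F M N"
    unfolding cls_def using subgroup.rcos_const[OF s group_free_Abelian_group x] .
  also have "\<dots> = cls 0"
    unfolding cls_def using group.coset_mult_one[OF group_free_Abelian_group subgroup.subset[OF s]]
    by simp
  finally show ?thesis by (simp add: cls_zero)
qed

lemma frag_closed: "m \<in> carrier M \<Longrightarrow> n \<in> carrier N \<Longrightarrow> frag_of (m, n) \<in> carrier Fr"
  by simp

lemma frag_diff_closed: "x \<in> carrier Fr \<Longrightarrow> y \<in> carrier Fr \<Longrightarrow> x - y \<in> carrier Fr"
  using keys_diff[of x y] by auto

lemma pure_closed [simp, intro]:
  "m \<in> carrier M \<Longrightarrow> n \<in> carrier N \<Longrightarrow> pure m n \<in> carrier \<T>"
  unfolding pure_cls by (intro cls_closed frag_closed)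

lemma pure_add_left:
  assumes "m \<in> carrier M" "m' \<in> carrier M" "n \<in> carrier N"
  shows "pure (m \<oplus>\<^bsub>M\<^esub> m') n = pure m n \<oplus>\<^bsub>\<T>\<^esub> pure m' n"
proof -
  have "frag_of (m \<oplus>\<^bsub>M\<^esub> m', n) - frag_of (m, n) - frag_of (m', n) \<in> tensor_relators F M N"
    unfolding tensor_relators_def using assms by blast
  from cls_relator[OF this]
  have "pure (m \<oplus>\<^bsub>M\<^esub> m') n \<ominus>\<^bsub>\<T>\<^esub> pure m n \<ominus>\<^bsub>\<T>\<^esub> pure m' n = \<zero>\<^bsub>\<T>\<^esub>"
    using assms by (simp add: pure_cls cls_diff frag_closed frag_diff_closed del: carrier_free_Abelian_group_iff)
  then show ?thesis
    by (subst (asm) T.minus_minus_eq_zero) (use assms in simp_all)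
qed

lemma pure_add_right:
  assumes "m \<in> carrier M" "n \<in> carrier N" "n' \<in> carrier N"
  shows "pure m (n \<oplus>\<^bsub>N\<^esub> n') = pure m n \<oplus>\<^bsub>\<T>\<^esub> pure m n'"
proof -
  have "frag_of (m, n \<oplus>\<^bsub>N\<^esub> n') - frag_of (m, n) - frag_of (m, n') \<in> tensor_relators F M N"
    unfolding tensor_relators_def using assms by blast
  from cls_relator[OF this]
  have "pure m (n \<oplus>\<^bsub>N\<^esub> n') \<ominus>\<^bsub>\<T>\<^esub> pure m n \<ominus>\<^bsub>\<T>\<^esub> pure m n' = \<zero>\<^bsub>\<T>\<^esub>"
    using assms by (simp add: pure_cls cls_diff frag_closed frag_diff_closed del: carrier_free_Abelian_group_iff)
  then show ?thesis
    by (subst (asm) T.minus_minus_eq_zero) (use assms in simp_all)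
qed

lemma pure_smult:
  assumes "a \<in> carrier F" "m \<in> carrier M" "n \<in> carrier N"
  shows "pure (a \<odot>\<^bsub>M\<^esub> m) n = pure m (a \<odot>\<^bsub>N\<^esub> n)"
proof -
  have "frag_of (a \<odot>\<^bsub>M\<^esub> m, n) - frag_of (m, a \<odot>\<^bsub>N\<^esub> n) \<in> tensor_relators F M N"
    unfolding tensor_relators_def using assms by blast
  from cls_relator[OF this]
  have "pure (a \<odot>\<^bsub>M\<^esub> m) n \<ominus>\<^bsub>\<T>\<^esub> pure m (a \<odot>\<^bsub>N\<^esub> n) = \<zero>\<^bsub>\<T>\<^esub>"
    using assms by (simp add: pure_cls cls_diff frag_closed frag_diff_closed del: carrier_free_Abelian_group_iff)
  then show ?thesis
    using assms by simp
qed

text \<open>Negatives of pure tensors are pure again. This is what spares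
  \<open>tensor_induct\<close> a case for negation.\<close>

lemma pure_minus:
  assumes "m \<in> carrier M" "n \<in> carrier N"
  shows "pure (\<ominus>\<^bsub>M\<^esub> m) n = \<ominus>\<^bsub>\<T>\<^esub> pure m n"
proof -
  have "pure \<zero>\<^bsub>M\<^esub> n \<oplus>\<^bsub>\<T>\<^esub> pure \<zero>\<^bsub>M\<^esub> n = pure \<zero>\<^bsub>M\<^esub> n"
    using pure_add_left[of "\<zero>\<^bsub>M\<^esub>" "\<zero>\<^bsub>M\<^esub>" n] assms by simp
  then have "pure \<zero>\<^bsub>M\<^esub> n = \<zero>\<^bsub>\<T>\<^esub>"
    using assms by (simp add: T.add.l_cancel_one)
  then have "pure (\<ominus>\<^bsub>M\<^esub> m) n \<oplus>\<^bsub>\<T>\<^esub> pure m n = \<zero>\<^bsub>\<T>\<^esub>"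
    using pure_add_left[of "\<ominus>\<^bsub>M\<^esub> m" m n] assms by (simp add: M.M.l_neg)
  then show ?thesis using assms by (simp add: T.minus_equality)
qed

lemma tensor_induct [consumes 1, case_names pure add]:
  assumes "\<xi> \<in> carrier \<T>"
    and pure: "\<And>m n. m \<in> carrier M \<Longrightarrow> n \<in> carrier N \<Longrightarrow> P (pure m n)"
    and add: "\<And>\<xi> \<eta>. \<xi> \<in> carrier \<T> \<Longrightarrow> \<eta> \<in> carrier \<T> \<Longrightarrow> P \<xi> \<Longrightarrow> P \<eta> \<Longrightarrow> P (\<xi> \<oplus>\<^bsub>\<T>\<^esub> \<eta>)"
  shows "P \<xi>"
proof -
  have neg: "P (\<ominus>\<^bsub>\<T>\<^esub> pure m n)" if "m \<in> carrier M" "n \<in> carrier N" for m n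
    using pure[of "\<ominus>\<^bsub>M\<^esub> m" n] that by (simp add: pure_minus)
  have minus_zero: "\<ominus>\<^bsub>\<T>\<^esub> \<zero>\<^bsub>\<T>\<^esub> = \<zero>\<^bsub>\<T>\<^esub>"
    using T.minus_equality[of "\<zero>\<^bsub>\<T>\<^esub>" "\<zero>\<^bsub>\<T>\<^esub>"] by simp
  \<comment> \<open>Zero is a sum of a pure tensor and its negative, both already covered, so it
    needs no case of its own.\<close>
  have P_zero: "P \<zero>\<^bsub>\<T>\<^esub>"
    using add[OF _ _ pure neg, of "\<zero>\<^bsub>M\<^esub>" "\<zero>\<^bsub>N\<^esub>" "\<zero>\<^bsub>M\<^esub>" "\<zero>\<^bsub>N\<^esub>"]
    by (metis M.M.zero_closed N.M.zero_closed T.a_inv_closed T.r_neg pure_closed)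
  obtain x where x: "x \<in> carrier Fr" "\<xi> = cls x"
    using assms(1) carrier_scalar_ext by auto
  from x(1) have "Poly_Mapping.keys x \<subseteq> carrier M \<times> carrier N" by simp
  \<comment> \<open>\<open>frag_induction\<close> builds elements by differences, while
    \<open>add\<close> handles only sums. Hence the strengthening: carrying P for the class and for
    its negative makes the property pass to x - y and to its negative.\<close>
  then have "x \<in> carrier Fr \<and> P (cls x) \<and> P (\<ominus>\<^bsub>\<T>\<^esub> cls x)"
  proof (induction x rule: frag_induction)
    case zero
    show ?case using P_zero unfolding cls_zero minus_zero by simp
  next
    case (one y)
    then show ?case using pure neg by (auto simp: pure_cls)
  next
    case (diff x y)
    then have c: "cls x \<in> carrier \<T>" "cls y \<in> carrier \<T>" by (simp_all add: cls_closed)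
    have "cls (x - y) = cls x \<oplus>\<^bsub>\<T>\<^esub> \<ominus>\<^bsub>\<T>\<^esub> cls y"
      using diff by (simp add: cls_diff T.minus_eq)
    moreover have "\<ominus>\<^bsub>\<T>\<^esub> cls (x - y) = \<ominus>\<^bsub>\<T>\<^esub> cls x \<oplus>\<^bsub>\<T>\<^esub> cls y"
      using c calculation by (simp add: T.minus_add)
    ultimately show ?case using diff c add frag_diff_closed by auto
  qed
  then show ?thesis using x by simp
qed

lemma additive_map_eqI:
  assumes "additive_map \<T> A g" "additive_map \<T> A h"
    and "\<And>m n. m \<in> carrier M \<Longrightarrow> n \<in> carrier N \<Longrightarrow> g (pure m n) = h (pure m n)"
    and "\<xi> \<in> carrier \<T>"
  shows "g \<xi> = h \<xi>"
  using assms(4)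
  by (induction rule: tensor_induct) (simp_all add: assms(3) additive_map_add[OF assms(1)] additive_map_add[OF assms(2)])

text \<open>Existence alone, with no condition off the carrier. Arguments that need just some
  extension of t use this form instead of the definite description
  \<open>tensor_lift\<close>.\<close>

lemma tensor_lift_exists:
  assumes A: "abelian_group A" and t: "balanced_map F M N A t"
  obtains g where "additive_map \<T> A g" "\<And>m n. m \<in> carrier M \<Longrightarrow> n \<in> carrier N \<Longrightarrow> g (pure m n) = t m n"
proof -
  interpret A: abelian_group A by fact
  let ?G = "add_monoid A"
  note tD = balanced_mapD[OF t]
  have "(\<lambda>(m, n). t m n) ` (carrier M \<times> carrier N) \<subseteq> carrier ?G" using tD(1) by auto
  then obtain h where h: "h \<in> hom Fr ?G"
      "\<And>x. x \<in> carrier M \<times> carrier N \<Longrightarrow> h (frag_of x) = (case x of (m, n) \<Rightarrow> t m n)"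
    using comm_group.free_Abelian_group_universal[OF A.a_comm_group] by metis
  interpret h: group_hom Fr ?G h
    using h(1) by (simp add: group_hom_def group_hom_axioms_def comm_group.axioms(2)[OF A.a_comm_group])
  have hp: "h (frag_of (m, n)) = t m n" if "m \<in> carrier M" "n \<in> carrier N" for m n
    using h(2) that by simp
  have hd: "h (x - y) = h x \<ominus>\<^bsub>A\<^esub> h y" if "x \<in> carrier Fr" "y \<in> carrier Fr" for x y
    using h.hom_mult[of x "- y"] h.hom_inv[of y] that by (simp add: a_minus_def a_inv_def)
  \<comment> \<open>The clauses of \<open>balanced_map\<close> say that h vanishes on each kind of
    relator, hence on the subgroup they generate, so that h factors through the quotient.\<close>
  have "tensor_relators F M N \<subseteq> kernel Fr ?G h"
  proof
    fix x assume x: "x \<in> tensor_relators F M N"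
    then have xc: "x \<in> carrier Fr" using tensor_relators_subset by blast
    have "h x = \<zero>\<^bsub>A\<^esub>"
      using x unfolding tensor_relators_def
      by (safe; simp add: hd hp frag_closed frag_diff_closed tD A.add_minus_minus
            del: carrier_free_Abelian_group_iff frag_of_in_free_Abelian_group)
    then show "x \<in> kernel Fr ?G h" using xc by (simp add: kernel_def)
  qed
  then have "tensor_subgroup F M N \<subseteq> kernel Fr ?G h"
    unfolding tensor_subgroup_def
    using h.G.generate_subgroup_incl h.subgroup_kernel by blast
  then obtain g where g: "g \<in> hom (tensor_group F M N) ?G" "\<And>x. x \<in> carrier Fr \<Longrightarrow> g (cls x) = h x"
    using h.FactGroup_universal_kernel[OF tensor_subgroup_normal]
    unfolding tensor_group_def cls_def by metis
  show thesis
  proof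
    show "additive_map \<T> A g"
      by (rule iffD1[OF hom_additive_group[OF additive_group_scalar_ext additive_group_add_monoid] g(1)])
    show "g (pure m n) = t m n" if "m \<in> carrier M" "n \<in> carrier N" for m n
      unfolding pure_cls using g(2)[OF frag_closed[OF that]] hp[OF that] by simp
  qed
qed

lemma tensor_lift:
  assumes A: "abelian_group A" and G: "additive_group A G" and t: "balanced_map F M N A t"
  shows tensor_lift_additive: "additive_map \<T> A (tensor_lift F M N G t)"
    and tensor_lift_extensional: "tensor_lift F M N G t \<in> extensional (carrier \<T>)"
    and tensor_lift_pure: "\<And>m n. m \<in> carrier M \<Longrightarrow> n \<in> carrier N \<Longrightarrow>
      tensor_lift F M N G t (pure m n) = t m n"
proof -
  let ?P = "\<lambda>g. g \<in> hom (tensor_group F M N) G \<inter> extensional (carrier (tensor_group F M N)) \<and>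
       (\<forall>m\<in>carrier M. \<forall>n\<in>carrier N. g (pure_tensor F M N m n) = t m n)"
  let ?Q = "\<lambda>g. additive_map \<T> A g \<and> g \<in> extensional (carrier \<T>) \<and>
       (\<forall>m\<in>carrier M. \<forall>n\<in>carrier N. g (pure m n) = t m n)"
  have PQ: "?P g \<longleftrightarrow> ?Q g" for g
    using hom_additive_group[OF additive_group_scalar_ext G] by (simp add: scalar_ext_def)
  obtain g where g: "additive_map \<T> A g" "\<And>m n. m \<in> carrier M \<Longrightarrow> n \<in> carrier N \<Longrightarrow> g (pure m n) = t m n"
    using tensor_lift_exists[OF A t] by blast
  have "\<exists>!g. ?Q g"
  proof (rule ex1I)
    \<comment> \<open>The description asks for an extensional map, so a lift is cut down to the
      carrier. Uniqueness on the carrier holds because the pure tensors generate.\<close>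
    show "?Q (restrict g (carrier \<T>))"
      using g by (auto simp: additive_map_def Pi_def)
    show "k = restrict g (carrier \<T>)" if "?Q k" for k
    proof
      fix \<xi>
      show "k \<xi> = restrict g (carrier \<T>) \<xi>"
        using that g additive_map_eqI[of A k g \<xi>] by (cases "\<xi> \<in> carrier \<T>") (auto simp: extensional_def)
    qed
  qed
  then have "?P (tensor_lift F M N G t)"
    unfolding tensor_lift_def PQ by (rule theI')
  then have "?Q (tensor_lift F M N G t)" unfolding PQ .
  then show "additive_map \<T> A (tensor_lift F M N G t)"
    "tensor_lift F M N G t \<in> extensional (carrier \<T>)"
    "\<And>m n. m \<in> carrier M \<Longrightarrow> n \<in> carrier N \<Longrightarrow> tensor_lift F M N G t (pure m n) = t m n"
    by auto
qed

end

text \<open>The curried definition treats the two arguments asymmetrically: additivity on the left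
  comes from the outer lift, while additivity on the right must be proved by induction on the left
  argument.\<close>

lemma tensor_lift2:
  assumes MN: "tensor_product F M N" and PQ: "tensor_product F P Q" and A: "abelian_group A" and G: "additive_group A G"
    and t1: "\<And>m n. m \<in> carrier M \<Longrightarrow> n \<in> carrier N \<Longrightarrow> balanced_map F P Q A (t m n)"
    and t2: "\<And>p q. p \<in> carrier P \<Longrightarrow> q \<in> carrier Q \<Longrightarrow> balanced_map F M N A (\<lambda>m n. t m n p q)"
  shows tensor_lift2_additive_left: "\<And>\<eta>. \<eta> \<in> carrier (scalar_ext F P Q) \<Longrightarrow>
      additive_map (scalar_ext F M N) A (\<lambda>\<xi>. tensor_lift2 F M N P Q G t \<xi> \<eta>)"
    and tensor_lift2_additive_right: "\<And>\<xi>. \<xi> \<in> carrier (scalar_ext F M N) \<Longrightarrow>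
      additive_map (scalar_ext F P Q) A (tensor_lift2 F M N P Q G t \<xi>)"
    and tensor_lift2_pure: "\<And>m n p q. m \<in> carrier M \<Longrightarrow> n \<in> carrier N \<Longrightarrow> p \<in> carrier P \<Longrightarrow> q \<in> carrier Q \<Longrightarrow>
      tensor_lift2 F M N P Q G t (pure_tensor F M N m n) (pure_tensor F P Q p q) = t m n p q"
proof -
  interpret MN: tensor_product F M N by fact
  interpret PQ: tensor_product F P Q by fact
  interpret A: abelian_group A by fact
  let ?f = "\<lambda>m n. tensor_lift F P Q G (t m n)"
  have f1: "additive_map PQ.\<T> A (?f m n)" if "m \<in> carrier M" "n \<in> carrier N" for m n
    using PQ.tensor_lift_additive[OF A G t1[OF that]] .
  have fp: "?f m n (PQ.pure p q) = t m n p q"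
    if "m \<in> carrier M" "n \<in> carrier N" "p \<in> carrier P" "q \<in> carrier Q" for m n p q
    using PQ.tensor_lift_pure[OF A G t1] that by simp
  \<comment> \<open>The outer lift requires the inner one to be balanced in m and n for every
    \<eta>, not only for pure \<eta>. Both sides of each law are additive in \<eta>, so
    \<open>t2\<close> on pure tensors suffices.\<close>
  have bal: "balanced_map F M N A (\<lambda>m n. ?f m n \<eta>)" if \<eta>: "\<eta> \<in> carrier PQ.\<T>" for \<eta>
  proof -
    have f2: "additive_map PQ.\<T> A (\<lambda>\<eta>. ?f m n \<eta> \<oplus>\<^bsub>A\<^esub> ?f m' n' \<eta>)"
      if "m \<in> carrier M" "n \<in> carrier N" "m' \<in> carrier M" "n' \<in> carrier N" for m n m' n'
      using additive_map_closed[OF f1[OF that(1,2)]] additive_map_closed[OF f1[OF that(3,4)]]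
        additive_map_add[OF f1[OF that(1,2)]] additive_map_add[OF f1[OF that(3,4)]]
      by (intro additive_mapI) (simp_all add: A.a_ac)
    show ?thesis
    proof (rule balanced_mapI)
      show "?f m n \<eta> \<in> carrier A" if "m \<in> carrier M" "n \<in> carrier N" for m n
        using additive_map_closed[OF f1[OF that] \<eta>] .
      show "?f (m \<oplus>\<^bsub>M\<^esub> m') n \<eta> = ?f m n \<eta> \<oplus>\<^bsub>A\<^esub> ?f m' n \<eta>"
        if "m \<in> carrier M" "m' \<in> carrier M" "n \<in> carrier N" for m m' n
        using that \<eta> by (intro PQ.additive_map_eqI[OF f1 f2 _ \<eta>]) (simp_all add: fp balanced_mapD(2)[OF t2])
      show "?f m (n \<oplus>\<^bsub>N\<^esub> n') \<eta> = ?f m n \<eta> \<oplus>\<^bsub>A\<^esub> ?f m n' \<eta>"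
        if "m \<in> carrier M" "n \<in> carrier N" "n' \<in> carrier N" for m n n'
        using that \<eta> by (intro PQ.additive_map_eqI[OF f1 f2 _ \<eta>]) (simp_all add: fp balanced_mapD(3)[OF t2])
      show "?f (a \<odot>\<^bsub>M\<^esub> m) n \<eta> = ?f m (a \<odot>\<^bsub>N\<^esub> n) \<eta>"
        if "a \<in> carrier F" "m \<in> carrier M" "n \<in> carrier N" for a m n
        using that \<eta> by (intro PQ.additive_map_eqI[OF f1 f1 _ \<eta>]) (simp_all add: fp balanced_mapD(4)[OF t2])
    qed
  qed
  have lr: "tensor_lift2 F M N P Q G t = (\<lambda>\<xi> \<eta>. tensor_lift F M N G (\<lambda>m n. ?f m n \<eta>) \<xi>)"
    by (simp add: tensor_lift2_def fun_eq_iff)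
  have l: "additive_map MN.\<T> A (\<lambda>\<xi>. tensor_lift2 F M N P Q G t \<xi> \<eta>)" if "\<eta> \<in> carrier PQ.\<T>" for \<eta>
    unfolding lr using MN.tensor_lift_additive[OF A G bal[OF that]] by simp
  have lp: "tensor_lift2 F M N P Q G t (MN.pure m n) \<eta> = ?f m n \<eta>"
    if "\<eta> \<in> carrier PQ.\<T>" "m \<in> carrier M" "n \<in> carrier N" for m n \<eta>
    unfolding lr using MN.tensor_lift_pure[OF A G bal[OF that(1)]] that by simp
  have r: "additive_map PQ.\<T> A (tensor_lift2 F M N P Q G t \<xi>)" if "\<xi> \<in> carrier MN.\<T>" for \<xi>
  proof (rule additive_mapI)
    show "tensor_lift2 F M N P Q G t \<xi> \<eta> \<in> carrier A" if "\<eta> \<in> carrier PQ.\<T>" for \<eta>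
      using additive_map_closed[OF l[OF that] \<open>\<xi> \<in> _\<close>] .
    fix \<eta> \<eta>' assume e: "\<eta> \<in> carrier PQ.\<T>" "\<eta>' \<in> carrier PQ.\<T>"
    then have e': "\<eta> \<oplus>\<^bsub>PQ.\<T>\<^esub> \<eta>' \<in> carrier PQ.\<T>" by simp
    from that show "tensor_lift2 F M N P Q G t \<xi> (\<eta> \<oplus>\<^bsub>PQ.\<T>\<^esub> \<eta>') =
      tensor_lift2 F M N P Q G t \<xi> \<eta> \<oplus>\<^bsub>A\<^esub> tensor_lift2 F M N P Q G t \<xi> \<eta>'"
    proof (induction rule: MN.tensor_induct)
      case (pure m n)
      then show ?case by (simp add: lp e e' additive_map_add[OF f1])
    next
      case (add \<xi> \<xi>')
      then show ?case
        using additive_map_closed[OF l[OF e(1)]] additive_map_closed[OF l[OF e(2)]]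
        by (simp add: additive_map_add[OF l[OF e(1)]] additive_map_add[OF l[OF e(2)]]
            additive_map_add[OF l[OF e']] A.a_ac)
    qed
  qed
  show "\<And>\<eta>. \<eta> \<in> carrier (scalar_ext F P Q) \<Longrightarrow>
      additive_map (scalar_ext F M N) A (\<lambda>\<xi>. tensor_lift2 F M N P Q G t \<xi> \<eta>)" by (rule l)
  show "\<And>\<xi>. \<xi> \<in> carrier (scalar_ext F M N) \<Longrightarrow>
      additive_map (scalar_ext F P Q) A (tensor_lift2 F M N P Q G t \<xi>)" by (rule r)
  show "\<And>m n p q. m \<in> carrier M \<Longrightarrow> n \<in> carrier N \<Longrightarrow> p \<in> carrier P \<Longrightarrow> q \<in> carrier Q \<Longrightarrow>
      tensor_lift2 F M N P Q G t (pure_tensor F M N m n) (pure_tensor F P Q p q) = t m n p q"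
    by (simp add: lp fp)
qed

section \<open>Modules and extension of scalars\<close>

lemma module_homI:
  assumes "\<And>x. x \<in> carrier M \<Longrightarrow> h x \<in> carrier N"
    and "\<And>x y. x \<in> carrier M \<Longrightarrow> y \<in> carrier M \<Longrightarrow> h (x \<oplus>\<^bsub>M\<^esub> y) = h x \<oplus>\<^bsub>N\<^esub> h y"
    and "\<And>r x. r \<in> carrier R \<Longrightarrow> x \<in> carrier M \<Longrightarrow> h (r \<odot>\<^bsub>M\<^esub> x) = r \<odot>\<^bsub>N\<^esub> h x"
  shows "h \<in> module_hom R M N"
  using assms by (auto simp: module_hom_def)

lemma module_hom_mem: "h \<in> module_hom R M N \<Longrightarrow> x \<in> carrier M \<Longrightarrow> h x \<in> carrier N"
  by (auto simp: module_hom_def)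

lemma module_hom_additive: "h \<in> module_hom R M N \<Longrightarrow> additive_map M N h"
  by (auto simp: module_hom_def additive_map_def)

lemma module_hom_minus:
  assumes "module R M" "module R N" "h \<in> module_hom R M N" "x \<in> carrier M"
  shows "h (\<ominus>\<^bsub>M\<^esub> x) = \<ominus>\<^bsub>N\<^esub> h x"
  using mod_hom.f_neg[of R M N h x] assms by (simp add: mod_hom_def mod_hom_axioms_def)

lemma module_hom_zero:
  assumes "module R M" "module R N" "h \<in> module_hom R M N"
  shows "h \<zero>\<^bsub>M\<^esub> = \<zero>\<^bsub>N\<^esub>"
  using mod_hom.f0_is_0[of R M N h] assms by (simp add: mod_hom_def mod_hom_axioms_def)

section \<open>The endomorphism algebra of a module\<close>

lemma carrier_End_alg [simp]:
  "carrier (End_alg R M) = module_hom R M M \<inter> extensional (carrier M)"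
  by (simp add: End_alg_def)

lemma mult_End_alg [simp]: "mult (End_alg R M) = compose (carrier M)"
  by (simp add: End_alg_def)

lemma one_End_alg [simp]: "\<one>\<^bsub>End_alg R M\<^esub> = (\<lambda>v\<in>carrier M. v)"
  by (simp add: End_alg_def)

lemma zero_End_alg [simp]: "\<zero>\<^bsub>End_alg R M\<^esub> = (\<lambda>v\<in>carrier M. \<zero>\<^bsub>M\<^esub>)"
  by (simp add: End_alg_def)

lemma add_End_alg [simp]: "f \<oplus>\<^bsub>End_alg R M\<^esub> g = (\<lambda>v\<in>carrier M. f v \<oplus>\<^bsub>M\<^esub> g v)"
  by (simp add: End_alg_def)

lemma smult_End_alg [simp]: "a \<odot>\<^bsub>End_alg R M\<^esub> f = (\<lambda>v\<in>carrier M. a \<odot>\<^bsub>M\<^esub> f v)"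
  by (simp add: End_alg_def)

lemma End_algI:
  assumes "\<And>x. x \<in> carrier M \<Longrightarrow> h x \<in> carrier M"
    and "\<And>x y. x \<in> carrier M \<Longrightarrow> y \<in> carrier M \<Longrightarrow> h (x \<oplus>\<^bsub>M\<^esub> y) = h x \<oplus>\<^bsub>M\<^esub> h y"
    and "\<And>r x. r \<in> carrier R \<Longrightarrow> x \<in> carrier M \<Longrightarrow> h (r \<odot>\<^bsub>M\<^esub> x) = r \<odot>\<^bsub>M\<^esub> h x"
    and "h \<in> extensional (carrier M)"
  shows "h \<in> carrier (End_alg R M)"
  using assms by (simp add: module_homI)

lemma End_alg_apply_closed:
  "\<phi> \<in> carrier (End_alg A N) \<Longrightarrow> x \<in> carrier N \<Longrightarrow> \<phi> x \<in> carrier N"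
  using module_hom_mem[of \<phi> A N N] by simp

lemma compose_End_alg:
  assumes "module R M" "f \<in> carrier (End_alg R M)" "g \<in> carrier (End_alg R M)"
  shows "compose (carrier M) f g \<in> carrier (End_alg R M)"
proof -
  interpret module R M by fact
  have "f \<in> module_hom R M M" "g \<in> module_hom R M M" using assms by simp_all
  then show ?thesis
    by (intro End_algI compose_extensional)
       (simp_all add: compose_eq module_hom_mem module_hom_add module_hom_smult)
qed

lemma one_End_alg_closed:
  assumes "module R M"
  shows "(\<lambda>v\<in>carrier M. v) \<in> carrier (End_alg R M)"
proof -
  interpret module R M by fact
  show ?thesis by (intro End_algI) simp_all
qed

lemma monoid_End_alg:
  assumes "module R M"
  shows "monoid (End_alg R M)"
proof (rule monoidI)
  fix f g assume "f \<in> carrier (End_alg R M)" "g \<in> carrier (End_alg R M)"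
  then show "f \<otimes>\<^bsub>End_alg R M\<^esub> g \<in> carrier (End_alg R M)"
    using compose_End_alg[OF assms] by simp
next
  show "\<one>\<^bsub>End_alg R M\<^esub> \<in> carrier (End_alg R M)"
    using one_End_alg_closed[OF assms] by simp
next
  fix f g h
  assume "f \<in> carrier (End_alg R M)" "g \<in> carrier (End_alg R M)" "h \<in> carrier (End_alg R M)"
  then show "f \<otimes>\<^bsub>End_alg R M\<^esub> g \<otimes>\<^bsub>End_alg R M\<^esub> h = f \<otimes>\<^bsub>End_alg R M\<^esub> (g \<otimes>\<^bsub>End_alg R M\<^esub> h)"
    using module_hom_mem[of h R M M] by (auto simp: compose_def fun_eq_iff)
next
  fix f assume f: "f \<in> carrier (End_alg R M)"
  then show "\<one>\<^bsub>End_alg R M\<^esub> \<otimes>\<^bsub>End_alg R M\<^esub> f = f" "f \<otimes>\<^bsub>End_alg R M\<^esub> \<one>\<^bsub>End_alg R M\<^esub> = f"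
    using module_hom_mem[of f R M M] by (auto simp: compose_def extensional_def fun_eq_iff)
qed

lemma (in module) smult_left_commute:
  "a \<in> carrier R \<Longrightarrow> c \<in> carrier R \<Longrightarrow> x \<in> carrier M \<Longrightarrow>
    a \<odot>\<^bsub>M\<^esub> (c \<odot>\<^bsub>M\<^esub> x) = c \<odot>\<^bsub>M\<^esub> (a \<odot>\<^bsub>M\<^esub> x)"
  by (metis R.m_comm smult_assoc1)

text \<open>Subtraction in a ring record refers to inverses of its additive monoid. The module
  structure gives it the expected meaning, so the minus sign in the definitions of h and of the
  involution can be evaluated.\<close>

lemma module_End_alg:
  assumes "module R M"
  shows "module R (End_alg R M)"
proof -
  interpret module R M by fact
  have mem: "f x \<in> carrier M" if "f \<in> carrier (End_alg R M)" "x \<in> carrier M" for f x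
    using that module_hom_mem[of f R M M] by simp
  have ext: "f = g" if "f \<in> carrier (End_alg R M)" "g \<in> carrier (End_alg R M)"
    "\<And>x. x \<in> carrier M \<Longrightarrow> f x = g x" for f g
    using that by (auto intro: extensionalityI)
  have add: "f (x \<oplus>\<^bsub>M\<^esub> y) = f x \<oplus>\<^bsub>M\<^esub> f y"
    if "f \<in> carrier (End_alg R M)" "x \<in> carrier M" "y \<in> carrier M" for f x y
    using that module_hom_add[of f R M M] by simp
  have scal: "f (r \<odot>\<^bsub>M\<^esub> x) = r \<odot>\<^bsub>M\<^esub> f x"
    if "f \<in> carrier (End_alg R M)" "r \<in> carrier R" "x \<in> carrier M" for f r x
    using that module_hom_smult[of f R M M] by simp
  note simps = mem add scal M.a_ac smult_l_distr smult_r_distr smult_assoc1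
  have plus_c: "(\<lambda>v\<in>carrier M. f v \<oplus>\<^bsub>M\<^esub> g v) \<in> carrier (End_alg R M)"
    if "f \<in> carrier (End_alg R M)" "g \<in> carrier (End_alg R M)" for f g
    by (rule End_algI) (use that in \<open>simp_all add: simps del: carrier_End_alg\<close>)
  have smult_c: "(\<lambda>v\<in>carrier M. a \<odot>\<^bsub>M\<^esub> f v) \<in> carrier (End_alg R M)"
    if "f \<in> carrier (End_alg R M)" "a \<in> carrier R" for f a
    by (rule End_algI)
       (use that in \<open>simp_all add: mem add scal smult_r_distr smult_left_commute[of a] del: carrier_End_alg\<close>)
  have zero_c: "(\<lambda>v\<in>carrier M. \<zero>\<^bsub>M\<^esub>) \<in> carrier (End_alg R M)"
    by (rule End_algI) simp_all
  have ag: "abelian_group (End_alg R M)"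
  proof (rule abelian_groupI)
    fix f assume f: "f \<in> carrier (End_alg R M)"
    have "(\<lambda>v\<in>carrier M. \<ominus>\<^bsub>M\<^esub> f v) \<in> carrier (End_alg R M)"
      by (rule End_algI) (use f in \<open>simp_all add: mem add scal M.minus_add smult_r_minus del: carrier_End_alg\<close>)
    moreover have "(\<lambda>v\<in>carrier M. \<ominus>\<^bsub>M\<^esub> f v) \<oplus>\<^bsub>End_alg R M\<^esub> f = \<zero>\<^bsub>End_alg R M\<^esub>"
      using f by (auto simp: fun_eq_iff mem M.l_neg simp del: carrier_End_alg)
    ultimately show "\<exists>g\<in>carrier (End_alg R M). g \<oplus>\<^bsub>End_alg R M\<^esub> f = \<zero>\<^bsub>End_alg R M\<^esub>" by blast
  next
    fix f assume f: "f \<in> carrier (End_alg R M)"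
    show "\<zero>\<^bsub>End_alg R M\<^esub> \<oplus>\<^bsub>End_alg R M\<^esub> f = f"
      using f plus_c[OF zero_c f] by (intro ext) (simp_all add: simps del: carrier_End_alg)
  qed (simp_all add: plus_c zero_c fun_eq_iff simps del: carrier_End_alg)
  show ?thesis
  proof (rule moduleI[OF R.is_cring ag])
    fix f assume f: "f \<in> carrier (End_alg R M)"
    show "\<one>\<^bsub>R\<^esub> \<odot>\<^bsub>End_alg R M\<^esub> f = f"
      using f smult_c[OF f R.one_closed] by (intro ext) (simp_all add: simps del: carrier_End_alg)
  qed (simp_all add: smult_c fun_eq_iff simps del: carrier_End_alg)
qed

section \<open>V_R as an R-module, with linear maps and forms extended to it\<close>

locale scalar_extension = M: module F M + R: algebra F R for F (structure) and M and R
begin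

sublocale tensor_product F M R ..

lemma smult_r_assoc:
  assumes "a \<in> carrier F" "r \<in> carrier R" "s \<in> carrier R"
  shows "r \<otimes>\<^bsub>R\<^esub> (a \<odot>\<^bsub>R\<^esub> s) = a \<odot>\<^bsub>R\<^esub> (r \<otimes>\<^bsub>R\<^esub> s)"
  using assms by (metis R.m_comm R.smult_assoc2 R.smult_closed)

lemma smult_scalar_ext:
  "r \<odot>\<^bsub>\<T>\<^esub> \<xi> = tensor_lift F M R (tensor_group F M R) (\<lambda>v s. pure v (r \<otimes>\<^bsub>R\<^esub> s)) \<xi>"
  by (simp add: scalar_ext_def)

lemma balanced_smult:
  "r \<in> carrier R \<Longrightarrow> balanced_map F M R \<T> (\<lambda>v s. pure v (r \<otimes>\<^bsub>R\<^esub> s))"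
  by (rule balanced_mapI)
     (simp_all add: pure_add_left pure_add_right R.r_distr pure_smult smult_r_assoc)

lemma smult_additive: "r \<in> carrier R \<Longrightarrow> additive_map \<T> \<T> (\<lambda>\<xi>. r \<odot>\<^bsub>\<T>\<^esub> \<xi>)"
  unfolding smult_scalar_ext
  using tensor_lift_additive[OF abelian_group_scalar_ext additive_group_scalar_ext balanced_smult]
  by simp

lemma smult_pure:
  assumes "r \<in> carrier R" "v \<in> carrier M" "s \<in> carrier R"
  shows "r \<odot>\<^bsub>\<T>\<^esub> pure v s = pure v (r \<otimes>\<^bsub>R\<^esub> s)"
  unfolding smult_scalar_ext
  using tensor_lift_pure[OF abelian_group_scalar_ext additive_group_scalar_ext balanced_smult] assms
  by simp

lemma smult_scalar_ext_closed: "r \<in> carrier R \<Longrightarrow> \<xi> \<in> carrier \<T> \<Longrightarrow> r \<odot>\<^bsub>\<T>\<^esub> \<xi> \<in> carrier \<T>"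
  using additive_map_closed[OF smult_additive] .

lemma smult_scalar_ext_add:
  "r \<in> carrier R \<Longrightarrow> \<xi> \<in> carrier \<T> \<Longrightarrow> \<eta> \<in> carrier \<T> \<Longrightarrow>
    r \<odot>\<^bsub>\<T>\<^esub> (\<xi> \<oplus>\<^bsub>\<T>\<^esub> \<eta>) = r \<odot>\<^bsub>\<T>\<^esub> \<xi> \<oplus>\<^bsub>\<T>\<^esub> r \<odot>\<^bsub>\<T>\<^esub> \<eta>"
  using additive_map_add[OF smult_additive] .

text \<open>Each axiom is additive in the vector, so it may be checked on pure tensors, where it
  becomes an identity in the second factor R.\<close>

lemma module_scalar_ext: "module R \<T>"
proof (rule moduleI[OF R.M_cring abelian_group_scalar_ext])
  fix r \<xi> assume "r \<in> carrier R" "\<xi> \<in> carrier \<T>"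
  then show "r \<odot>\<^bsub>\<T>\<^esub> \<xi> \<in> carrier \<T>" by (rule smult_scalar_ext_closed)
next
  fix r s \<xi> assume rs: "r \<in> carrier R" "s \<in> carrier R" and "\<xi> \<in> carrier \<T>"
  from this(3) show "(r \<oplus>\<^bsub>R\<^esub> s) \<odot>\<^bsub>\<T>\<^esub> \<xi> = r \<odot>\<^bsub>\<T>\<^esub> \<xi> \<oplus>\<^bsub>\<T>\<^esub> s \<odot>\<^bsub>\<T>\<^esub> \<xi>"
    by (induction rule: tensor_induct)
       (simp_all add: rs smult_pure R.l_distr pure_add_right smult_scalar_ext_add
          smult_scalar_ext_closed T.a_ac)
next
  fix r s \<xi> assume rs: "r \<in> carrier R" "s \<in> carrier R" and "\<xi> \<in> carrier \<T>"
  from this(3) show "(r \<otimes>\<^bsub>R\<^esub> s) \<odot>\<^bsub>\<T>\<^esub> \<xi> = r \<odot>\<^bsub>\<T>\<^esub> (s \<odot>\<^bsub>\<T>\<^esub> \<xi>)"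
    by (induction rule: tensor_induct)
       (simp_all add: rs smult_pure R.m_assoc smult_scalar_ext_add smult_scalar_ext_closed)
next
  fix r \<xi> \<eta> assume "r \<in> carrier R" "\<xi> \<in> carrier \<T>" "\<eta> \<in> carrier \<T>"
  then show "r \<odot>\<^bsub>\<T>\<^esub> (\<xi> \<oplus>\<^bsub>\<T>\<^esub> \<eta>) = r \<odot>\<^bsub>\<T>\<^esub> \<xi> \<oplus>\<^bsub>\<T>\<^esub> r \<odot>\<^bsub>\<T>\<^esub> \<eta>"
    by (rule smult_scalar_ext_add)
next
  fix \<xi> assume "\<xi> \<in> carrier \<T>"
  then show "\<one>\<^bsub>R\<^esub> \<odot>\<^bsub>\<T>\<^esub> \<xi> = \<xi>"
    by (induction rule: tensor_induct) (simp_all add: smult_pure smult_scalar_ext_add)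
qed

sublocale T: module R \<T> by (rule module_scalar_ext)

lemma pure_eq_smult_one: "v \<in> carrier M \<Longrightarrow> s \<in> carrier R \<Longrightarrow> pure v s = s \<odot>\<^bsub>\<T>\<^esub> pure v \<one>\<^bsub>R\<^esub>"
  by (simp add: smult_pure)

text \<open>F acts on V_R through its image in R. In this form a scalar from F can be moved through
  an R-linear map.\<close>

lemma pure_smult_left:
  assumes "a \<in> carrier F" "v \<in> carrier M" "s \<in> carrier R"
  shows "pure (a \<odot>\<^bsub>M\<^esub> v) s = (a \<odot>\<^bsub>R\<^esub> \<one>\<^bsub>R\<^esub>) \<odot>\<^bsub>\<T>\<^esub> pure v s"
  using assms by (simp add: pure_smult smult_pure R.smult_assoc2)

lemma linear_ext:
  assumes "X \<in> module_hom F M M"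
  shows linear_ext_pure: "\<And>v s. v \<in> carrier M \<Longrightarrow> s \<in> carrier R \<Longrightarrow> linear_ext F M R X (pure v s) = pure (X v) s"
    and linear_ext_End_alg: "linear_ext F M R X \<in> carrier (End_alg R \<T>)"
proof -
  have bal: "balanced_map F M R \<T> (\<lambda>v s. pure (X v) s)"
    by (rule balanced_mapI)
       (simp_all add: module_hom_mem[OF assms] module_hom_add[OF assms] module_hom_smult[OF assms]
         pure_add_left pure_add_right pure_smult)
  note lift = abelian_group_scalar_ext additive_group_scalar_ext bal
  show p: "\<And>v s. v \<in> carrier M \<Longrightarrow> s \<in> carrier R \<Longrightarrow> linear_ext F M R X (pure v s) = pure (X v) s"
    unfolding linear_ext_def using tensor_lift_pure[OF lift] .
  have a: "additive_map \<T> \<T> (linear_ext F M R X)"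
    unfolding linear_ext_def using tensor_lift_additive[OF lift] .
  have "linear_ext F M R X (r \<odot>\<^bsub>\<T>\<^esub> \<xi>) = r \<odot>\<^bsub>\<T>\<^esub> linear_ext F M R X \<xi>"
    if r: "r \<in> carrier R" and "\<xi> \<in> carrier \<T>" for r \<xi>
    using that(2)
    by (induction rule: tensor_induct)
       (simp_all add: r p smult_pure module_hom_mem[OF assms] T.smult_r_distr
          additive_map_add[OF a] additive_map_closed[OF a])
  then show "linear_ext F M R X \<in> carrier (End_alg R \<T>)"
    using additive_map_closed[OF a] additive_map_add[OF a]
      tensor_lift_extensional[OF lift] by (intro End_algI) (simp_all add: linear_ext_def)
qed

lemma linear_ext_closed:
  "X \<in> module_hom F M M \<Longrightarrow> \<xi> \<in> carrier \<T> \<Longrightarrow> linear_ext F M R X \<xi> \<in> carrier \<T>"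
  using linear_ext_End_alg[of X] module_hom_mem[of "linear_ext F M R X" R \<T> \<T> \<xi>] by simp

lemma linear_ext_add:
  "X \<in> module_hom F M M \<Longrightarrow> \<xi> \<in> carrier \<T> \<Longrightarrow> \<eta> \<in> carrier \<T> \<Longrightarrow>
    linear_ext F M R X (\<xi> \<oplus>\<^bsub>\<T>\<^esub> \<eta>) = linear_ext F M R X \<xi> \<oplus>\<^bsub>\<T>\<^esub> linear_ext F M R X \<eta>"
  using linear_ext_End_alg[of X] module_hom_add[of "linear_ext F M R X" R \<T> \<T> \<xi> \<eta>] by simp

lemma linear_ext_smult:
  "X \<in> module_hom F M M \<Longrightarrow> r \<in> carrier R \<Longrightarrow> \<xi> \<in> carrier \<T> \<Longrightarrow>
    linear_ext F M R X (r \<odot>\<^bsub>\<T>\<^esub> \<xi>) = r \<odot>\<^bsub>\<T>\<^esub> linear_ext F M R X \<xi>"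
  using linear_ext_End_alg[of X] module_hom_smult[of "linear_ext F M R X" R \<T> \<T> r \<xi>] by simp

lemma form_ext:
  assumes b: "bilinear_map F M (regular_module F) b"
  shows form_ext_additive_left: "\<And>\<eta>. \<eta> \<in> carrier \<T> \<Longrightarrow> additive_map \<T> R (\<lambda>\<xi>. form_ext F M R b \<xi> \<eta>)"
    and form_ext_additive_right: "\<And>\<xi>. \<xi> \<in> carrier \<T> \<Longrightarrow> additive_map \<T> R (form_ext F M R b \<xi>)"
    and form_ext_pure: "\<And>u r v s. u \<in> carrier M \<Longrightarrow> r \<in> carrier R \<Longrightarrow> v \<in> carrier M \<Longrightarrow> s \<in> carrier R \<Longrightarrow>
      form_ext F M R b (pure u r) (pure v s) = b u v \<odot>\<^bsub>R\<^esub> (r \<otimes>\<^bsub>R\<^esub> s)"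
proof -
  have A: "abelian_group R" by (rule R.is_abelian_group)
  have b1: "b u \<in> module_hom F M (regular_module F)" if "u \<in> carrier M" for u
    using b that by (simp add: bilinear_map_def)
  have b2: "(\<lambda>u. b u v) \<in> module_hom F M (regular_module F)" if "v \<in> carrier M" for v
    using b that by (simp add: bilinear_map_def)
  have bc: "b u v \<in> carrier F" if "u \<in> carrier M" "v \<in> carrier M" for u v
    using module_hom_mem[OF b1[OF that(1)] that(2)] by (simp add: regular_module_def)
  have b_simps: "b u (v \<oplus>\<^bsub>M\<^esub> v') = b u v \<oplus> b u v'" "b (v \<oplus>\<^bsub>M\<^esub> v') u = b v u \<oplus> b v' u"
    "a \<in> carrier F \<Longrightarrow> b u (a \<odot>\<^bsub>M\<^esub> v) = a \<otimes> b u v" "a \<in> carrier F \<Longrightarrow> b (a \<odot>\<^bsub>M\<^esub> v) u = a \<otimes> b v u"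
    if "u \<in> carrier M" "v \<in> carrier M" "v' \<in> carrier M" for u v v' a
    using module_hom_add[OF b1[OF that(1)]] module_hom_add[OF b2[OF that(1)]]
      module_hom_smult[OF b1[OF that(1)]] module_hom_smult[OF b2[OF that(1)]] that
    by (simp_all add: regular_module_def)
  note simps = b_simps bc R.smult_l_distr R.smult_r_distr R.l_distr R.r_distr R.smult_assoc1
      R.smult_assoc2 smult_r_assoc
  \<comment> \<open>After the scalars are collected, transferring a from one factor to the other
    amounts to exchanging a and b(u, v), which is commutativity of F. The same applies to
    \<open>t2\<close>.\<close>
  have t1: "balanced_map F M R R (\<lambda>v s. b u v \<odot>\<^bsub>R\<^esub> (r \<otimes>\<^bsub>R\<^esub> s))"
    if "u \<in> carrier M" "r \<in> carrier R" for u r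
    by (rule balanced_mapI)
       (use that in \<open>simp_all add: simps\<close>, use that in \<open>simp_all add: R.smult_assoc1[symmetric] bc M.R.m_comm\<close>)
  have t2: "balanced_map F M R R (\<lambda>u r. b u v \<odot>\<^bsub>R\<^esub> (r \<otimes>\<^bsub>R\<^esub> s))"
    if "v \<in> carrier M" "s \<in> carrier R" for v s
    by (rule balanced_mapI)
       (use that in \<open>simp_all add: simps\<close>, use that in \<open>simp_all add: R.smult_assoc1[symmetric] bc M.R.m_comm\<close>)
  note lift2 = tensor_product_axioms tensor_product_axioms A additive_group_add_monoid t1 t2
  show "\<And>\<eta>. \<eta> \<in> carrier \<T> \<Longrightarrow> additive_map \<T> R (\<lambda>\<xi>. form_ext F M R b \<xi> \<eta>)"
    unfolding form_ext_def using tensor_lift2_additive_left[OF lift2] by simp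
  show "\<And>\<xi>. \<xi> \<in> carrier \<T> \<Longrightarrow> additive_map \<T> R (form_ext F M R b \<xi>)"
    unfolding form_ext_def using tensor_lift2_additive_right[OF lift2] by simp
  show "\<And>u r v s. u \<in> carrier M \<Longrightarrow> r \<in> carrier R \<Longrightarrow> v \<in> carrier M \<Longrightarrow> s \<in> carrier R \<Longrightarrow>
      form_ext F M R b (pure u r) (pure v s) = b u v \<odot>\<^bsub>R\<^esub> (r \<otimes>\<^bsub>R\<^esub> s)"
    unfolding form_ext_def using tensor_lift2_pure[OF lift2] by simp
qed

lemma
  assumes b: "bilinear_map F M (regular_module F) b"
  shows form_ext_closed: "\<xi> \<in> carrier \<T> \<Longrightarrow> \<eta> \<in> carrier \<T> \<Longrightarrow> form_ext F M R b \<xi> \<eta> \<in> carrier R"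
    and form_ext_add_left: "\<xi> \<in> carrier \<T> \<Longrightarrow> \<xi>' \<in> carrier \<T> \<Longrightarrow> \<eta> \<in> carrier \<T> \<Longrightarrow>
      form_ext F M R b (\<xi> \<oplus>\<^bsub>\<T>\<^esub> \<xi>') \<eta> = form_ext F M R b \<xi> \<eta> \<oplus>\<^bsub>R\<^esub> form_ext F M R b \<xi>' \<eta>"
    and form_ext_add_right: "\<xi> \<in> carrier \<T> \<Longrightarrow> \<eta> \<in> carrier \<T> \<Longrightarrow> \<eta>' \<in> carrier \<T> \<Longrightarrow>
      form_ext F M R b \<xi> (\<eta> \<oplus>\<^bsub>\<T>\<^esub> \<eta>') = form_ext F M R b \<xi> \<eta> \<oplus>\<^bsub>R\<^esub> form_ext F M R b \<xi> \<eta>'"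
  using additive_map_closed[OF form_ext_additive_right[OF b]]
    additive_map_add[OF form_ext_additive_left[OF b]]
    additive_map_add[OF form_ext_additive_right[OF b]] by simp_all

text \<open>The lift supplies only additivity in each argument. That scalars of R come out is seen
  by induction on both arguments, using commutativity of R.\<close>

lemma form_ext_smult:
  assumes b: "bilinear_map F M (regular_module F) b"
    and r: "r \<in> carrier R" and \<xi>: "\<xi> \<in> carrier \<T>" and \<eta>: "\<eta> \<in> carrier \<T>"
  shows form_ext_smult_left: "form_ext F M R b (r \<odot>\<^bsub>\<T>\<^esub> \<xi>) \<eta> = r \<otimes>\<^bsub>R\<^esub> form_ext F M R b \<xi> \<eta>"
    and form_ext_smult_right: "form_ext F M R b \<xi> (r \<odot>\<^bsub>\<T>\<^esub> \<eta>) = r \<otimes>\<^bsub>R\<^esub> form_ext F M R b \<xi> \<eta>"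
proof -
  have bc: "b u v \<in> carrier F" if "u \<in> carrier M" "v \<in> carrier M" for u v
    using b that module_hom_mem[of "b u" F M "regular_module F" v]
    by (simp add: bilinear_map_def regular_module_def)
  note simps = r form_ext_closed[OF b] form_ext_add_left[OF b] form_ext_add_right[OF b]
    form_ext_pure[OF b] smult_scalar_ext_closed smult_scalar_ext_add R.r_distr
  from \<xi> show "form_ext F M R b (r \<odot>\<^bsub>\<T>\<^esub> \<xi>) \<eta> = r \<otimes>\<^bsub>R\<^esub> form_ext F M R b \<xi> \<eta>"
  proof (induction rule: tensor_induct)
    case (pure u q)
    from \<eta> show ?case
      by (induction rule: tensor_induct)
         (use pure in \<open>simp_all add: simps smult_pure bc smult_r_assoc R.m_assoc\<close>)
  qed (use \<eta> in \<open>simp_all add: simps\<close>)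
  from \<eta> show "form_ext F M R b \<xi> (r \<odot>\<^bsub>\<T>\<^esub> \<eta>) = r \<otimes>\<^bsub>R\<^esub> form_ext F M R b \<xi> \<eta>"
  proof (induction rule: tensor_induct)
    case (pure v s)
    from \<xi> show ?case
      by (induction rule: tensor_induct)
         (use pure in \<open>simp_all add: simps smult_pure bc smult_r_assoc R.m_lcomm\<close>)
  qed (use \<xi> in \<open>simp_all add: simps\<close>)
qed

end

section \<open>Surjective endomorphisms and dual families\<close>

text \<open>
  Nakayama's argument, by induction on the number of generators. The ring generated by \<open>\<psi>\<close> and
  the scalars is replaced by the bicommutant \<open>C\<close> of \<open>\<psi>\<close>, which is commutative as well. The element
  \<open>e\<close> is congruent to the identity modulo \<open>\<psi> C\<close>.
\<close>

lemma surjective_endomorphism_injective: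
  assumes M: "module R M" and \<psi>: "\<psi> \<in> module_hom R M M" and surj: "\<psi> ` carrier M = carrier M"
    and G: "finite G" "G \<subseteq> carrier M"
    and gen: "\<And>N. LinearCombinations.submodule R N M \<Longrightarrow> G \<subseteq> N \<Longrightarrow> N = carrier M"
  shows "inj_on \<psi> (carrier M)"
proof -
  interpret M: module R M by fact
  define D where "D = {d \<in> module_hom R M M. \<forall>x\<in>carrier M. d (\<psi> x) = \<psi> (d x)}"
  define C where "C = {c \<in> module_hom R M M. \<forall>d\<in>D. \<forall>x\<in>carrier M. c (d x) = d (c x)}"
  \<comment> \<open>The C-submodules of M. Since C contains the scalars of R, they are R-submodules,
    and \<open>gen\<close> applies to them.\<close>
  define stable where "stable N \<longleftrightarrow> N \<subseteq> carrier M \<and> \<zero>\<^bsub>M\<^esub> \<in> N \<and>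
    (\<forall>x\<in>N. \<forall>y\<in>N. x \<oplus>\<^bsub>M\<^esub> y \<in> N) \<and> (\<forall>c\<in>C. \<forall>x\<in>N. c x \<in> N)" for N
  have \<psi>D: "\<psi> \<in> D" using \<psi> by (simp add: D_def)
  have Dhom: "d \<in> module_hom R M M" if "d \<in> D" for d using that by (simp add: D_def)
  have Chom: "c \<in> module_hom R M M" if "c \<in> C" for c using that by (simp add: C_def)
  have Cpsi: "c (\<psi> x) = \<psi> (c x)" if "c \<in> C" "x \<in> carrier M" for c x
    using that \<psi>D by (simp add: C_def)
  \<comment> \<open>Members of C commute with all of D and \<psi> lies in D, so C is contained in D.
    Hence any two members of C commute.\<close>
  have CD: "c \<in> D" if "c \<in> C" for c
    using that Chom Cpsi by (simp add: D_def)
  have Ccomm: "c (c' x) = c' (c x)" if "c \<in> C" "c' \<in> C" "x \<in> carrier M" for c c' x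
    using that CD[of c'] by (simp add: C_def)
  have Cmem: "c x \<in> carrier M" if "c \<in> C" "x \<in> carrier M" for c x
    using module_hom_mem[OF Chom] that by blast
  have Cadd: "c (x \<oplus>\<^bsub>M\<^esub> y) = c x \<oplus>\<^bsub>M\<^esub> c y" if "c \<in> C" "x \<in> carrier M" "y \<in> carrier M" for c x y
    using module_hom_add[OF Chom] that by blast
  have Csmult: "c (r \<odot>\<^bsub>M\<^esub> x) = r \<odot>\<^bsub>M\<^esub> c x" if "c \<in> C" "r \<in> carrier R" "x \<in> carrier M" for c r x
    using module_hom_smult[OF Chom] that by blast
  have Czero: "c \<zero>\<^bsub>M\<^esub> = \<zero>\<^bsub>M\<^esub>" if "c \<in> C" for c
    using module_hom_zero[OF M M Chom[OF that]] .
  have psi_simps: "\<psi> x \<in> carrier M" "\<psi> (x \<oplus>\<^bsub>M\<^esub> y) = \<psi> x \<oplus>\<^bsub>M\<^esub> \<psi> y"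
    "r \<in> carrier R \<Longrightarrow> \<psi> (r \<odot>\<^bsub>M\<^esub> x) = r \<odot>\<^bsub>M\<^esub> \<psi> x" if "x \<in> carrier M" "y \<in> carrier M" for x y r
    using module_hom_mem[OF \<psi>] module_hom_add[OF \<psi>] module_hom_smult[OF \<psi>] that by auto
  have D_simps: "d x \<in> carrier M" "d (x \<oplus>\<^bsub>M\<^esub> y) = d x \<oplus>\<^bsub>M\<^esub> d y"
    "r \<in> carrier R \<Longrightarrow> d (r \<odot>\<^bsub>M\<^esub> x) = r \<odot>\<^bsub>M\<^esub> d x" "d (\<ominus>\<^bsub>M\<^esub> x) = \<ominus>\<^bsub>M\<^esub> d x"
    if "d \<in> D" "x \<in> carrier M" "y \<in> carrier M" for d x y r
    using module_hom_mem[OF Dhom[OF that(1)]] module_hom_add[OF Dhom[OF that(1)]]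
      module_hom_smult[OF Dhom[OF that(1)]] module_hom_minus[OF M M Dhom[OF that(1)]] that by auto
  have CDcomm: "c (d x) = d (c x)" if "c \<in> C" "d \<in> D" "x \<in> carrier M" for c d x
    using that by (simp add: C_def)
  have psiC: "\<psi> \<in> C" using \<psi> by (simp add: C_def D_def)
  have C_id: "(\<lambda>x. x) \<in> C"
    unfolding C_def by (auto intro!: module_homI)
  have C_comp: "(\<lambda>x. c (c' x)) \<in> C" if "c \<in> C" "c' \<in> C" for c c'
  proof -
    have "(\<lambda>x. c (c' x)) \<in> module_hom R M M"
      using that by (intro module_homI) (simp_all add: Cmem Cadd Csmult)
    moreover have "c (c' (d x)) = d (c (c' x))" if "d \<in> D" "x \<in> carrier M" for d x
      using CDcomm[OF \<open>c \<in> C\<close> that(1)] CDcomm[OF \<open>c' \<in> C\<close> that(1)] \<open>c' \<in> C\<close> that by (simp add: Cmem)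
    ultimately show ?thesis by (simp add: C_def)
  qed
  have C_psi: "(\<lambda>x. \<psi> (c x)) \<in> C" if "c \<in> C" for c
    using C_comp[OF psiC that] .
  have C_add: "(\<lambda>x. c x \<oplus>\<^bsub>M\<^esub> c' x) \<in> C" if "c \<in> C" "c' \<in> C" for c c'
  proof -
    have "(\<lambda>x. c x \<oplus>\<^bsub>M\<^esub> c' x) \<in> module_hom R M M"
      using that by (intro module_homI) (simp_all add: Cmem Cadd Csmult M.M.a_ac M.smult_r_distr)
    moreover have "c (d x) \<oplus>\<^bsub>M\<^esub> c' (d x) = d (c x \<oplus>\<^bsub>M\<^esub> c' x)" if "d \<in> D" "x \<in> carrier M" for d x
      using CDcomm[OF \<open>c \<in> C\<close> that] CDcomm[OF \<open>c' \<in> C\<close> that] \<open>c \<in> C\<close> \<open>c' \<in> C\<close> that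
      by (simp add: Cmem D_simps)
    ultimately show ?thesis by (simp add: C_def)
  qed
  have C_minus: "(\<lambda>x. \<ominus>\<^bsub>M\<^esub> c x) \<in> C" if "c \<in> C" for c
  proof -
    have "(\<lambda>x. \<ominus>\<^bsub>M\<^esub> c x) \<in> module_hom R M M"
      using that by (intro module_homI) (simp_all add: Cmem Cadd Csmult M.M.minus_add M.smult_r_minus)
    moreover have "\<ominus>\<^bsub>M\<^esub> c (d x) = d (\<ominus>\<^bsub>M\<^esub> c x)" if "d \<in> D" "x \<in> carrier M" for d x
      using CDcomm[OF \<open>c \<in> C\<close> that] \<open>c \<in> C\<close> that by (simp add: Cmem D_simps)
    ultimately show ?thesis by (simp add: C_def)
  qed
  have C_scalar: "(\<lambda>x. r \<odot>\<^bsub>M\<^esub> x) \<in> C" if "r \<in> carrier R" for r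
  proof -
    have "(\<lambda>x. r \<odot>\<^bsub>M\<^esub> x) \<in> module_hom R M M"
      using that by (intro module_homI) (simp_all add: M.smult_r_distr M.smult_left_commute)
    then show ?thesis using that by (simp add: C_def D_simps)
  qed
  have stable_submodule: "LinearCombinations.submodule R N M" if "stable N" for N
  proof (rule LinearCombinations.submodule.intro[OF M])
    show "r \<odot>\<^bsub>M\<^esub> x \<in> N" if "r \<in> carrier R" "x \<in> N" for r x
      using \<open>stable N\<close> C_scalar[OF that(1)] that(2) unfolding stable_def by blast
  qed (use that in \<open>auto simp: stable_def\<close>)
  \<comment> \<open>Generalization of the case N = 0: if G generates M as a C-module modulo N, then
    some e in 1 + \<psi> C maps M into N. Adjoining a generator to N turns the induction on G into
    one that may vary N.\<close>
  have key: "\<exists>e\<in>C. \<exists>q\<in>C. \<forall>x\<in>carrier M. e x = x \<oplus>\<^bsub>M\<^esub> \<psi> (q x) \<and> e x \<in> N"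
    if "finite G" "G \<subseteq> carrier M" "stable N"
      "\<And>N'. stable N' \<Longrightarrow> N \<union> G \<subseteq> N' \<Longrightarrow> N' = carrier M" for G N
    using that
  proof (induction G arbitrary: N)
    case empty
    \<comment> \<open>The zero map, written as a difference because C is already known to be closed
      under sums and negatives. With N = M, the witnesses are e = id and q = 0.\<close>
    have C0: "(\<lambda>x. x \<oplus>\<^bsub>M\<^esub> \<ominus>\<^bsub>M\<^esub> x) \<in> C" using C_add[OF C_id C_minus[OF C_id]] .
    have p0: "\<psi> (x \<oplus>\<^bsub>M\<^esub> \<ominus>\<^bsub>M\<^esub> x) = \<zero>\<^bsub>M\<^esub>" if "x \<in> carrier M" for x
      using that module_hom_zero[OF M M \<psi>] by (simp add: M.M.r_neg)
    have "N = carrier M" using empty by auto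
    then show ?case
      by - (rule bexI[where x = "\<lambda>x. x", OF _ C_id],
        rule bexI[where x = "\<lambda>x. x \<oplus>\<^bsub>M\<^esub> \<ominus>\<^bsub>M\<^esub> x", OF _ C0], simp add: p0)
  next
    case (insert m G)
    have m: "m \<in> carrier M" using insert by simp
    have N: "N \<subseteq> carrier M" "\<zero>\<^bsub>M\<^esub> \<in> N" "\<And>x y. x \<in> N \<Longrightarrow> y \<in> N \<Longrightarrow> x \<oplus>\<^bsub>M\<^esub> y \<in> N"
      "\<And>c x. c \<in> C \<Longrightarrow> x \<in> N \<Longrightarrow> c x \<in> N" using insert.prems(2) by (auto simp: stable_def)
    have NM: "x \<in> carrier M" if "x \<in> N" for x using N(1) that by blast
    \<comment> \<open>The C-submodule N + C m. Over it the remaining set G suffices, so the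
      induction hypothesis provides an e with values in N + C m.\<close>
    let ?N = "{n \<oplus>\<^bsub>M\<^esub> c m | n c. n \<in> N \<and> c \<in> C}"
    have NI: "n \<oplus>\<^bsub>M\<^esub> c m \<in> ?N" if "n \<in> N" "c \<in> C" for n c using that by blast
    have C0: "(\<lambda>x. x \<oplus>\<^bsub>M\<^esub> \<ominus>\<^bsub>M\<^esub> x) \<in> C" using C_add[OF C_id C_minus[OF C_id]] .
    have N_sub: "N \<subseteq> ?N"
    proof
      fix n assume "n \<in> N"
      then show "n \<in> ?N" using NI[OF _ C0, of n] m NM by (simp add: M.M.r_neg)
    qed
    have m_in: "m \<in> ?N" using NI[OF N(2) C_id] m by simp
    have st: "stable ?N"
      unfolding stable_def
    proof (intro conjI ballI)
      show "?N \<subseteq> carrier M" using m by (auto simp: NM Cmem)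
      show "\<zero>\<^bsub>M\<^esub> \<in> ?N" using N_sub N(2) by blast
      fix x assume "x \<in> ?N"
      then obtain n c where x: "x = n \<oplus>\<^bsub>M\<^esub> c m" "n \<in> N" "c \<in> C" by blast
      show "x \<oplus>\<^bsub>M\<^esub> y \<in> ?N" if y_in: "y \<in> ?N" for y
      proof -
        obtain n' c' where y: "y = n' \<oplus>\<^bsub>M\<^esub> c' m" "n' \<in> N" "c' \<in> C" using y_in by blast
        have "x \<oplus>\<^bsub>M\<^esub> y = (n \<oplus>\<^bsub>M\<^esub> n') \<oplus>\<^bsub>M\<^esub> (c m \<oplus>\<^bsub>M\<^esub> c' m)"
          using x y m by (simp add: M.M.a_ac NM Cmem)
        then show ?thesis using NI[OF N(3)[OF x(2) y(2)] C_add[OF x(3) y(3)]] by simp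
      qed
      show "d x \<in> ?N" if "d \<in> C" for d
      proof -
        have "d x = d n \<oplus>\<^bsub>M\<^esub> d (c m)"
          using x m that by (simp add: Cadd NM Cmem)
        then show ?thesis using NI[OF N(4)[OF that x(2)] C_comp[OF that x(3)]] by simp
      qed
    qed
    have "\<exists>e\<in>C. \<exists>q\<in>C. \<forall>x\<in>carrier M. e x = x \<oplus>\<^bsub>M\<^esub> \<psi> (q x) \<and> e x \<in> ?N"
    proof (rule insert.IH[OF _ st])
      show "G \<subseteq> carrier M" using insert.prems(1) by simp
      fix N' assume N': "stable N'" "?N \<union> G \<subseteq> N'"
      show "N' = carrier M"
        by (rule insert.prems(3)[OF N'(1)]) (use N'(2) N_sub m_in in blast)
    qed
    then obtain e q where e: "e \<in> C" and q: "q \<in> C"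
      and eq: "\<And>x. x \<in> carrier M \<Longrightarrow> e x = x \<oplus>\<^bsub>M\<^esub> \<psi> (q x)"
      and eN: "\<And>x. x \<in> carrier M \<Longrightarrow> e x \<in> ?N" by blast
    \<comment> \<open>Surjectivity enters here. Writing e m' = n + p m and applying \<psi> gives e m
      = \<psi> n + \<psi> (p m), which expresses the new generator modulo N with a coefficient in
      \<psi> C.\<close>
    obtain m' where m': "m' \<in> carrier M" "\<psi> m' = m" using surj m by (metis imageE)
    obtain n p where np: "e m' = n \<oplus>\<^bsub>M\<^esub> p m" "n \<in> N" "p \<in> C" using eN[OF m'(1)] by blast
    have em: "e m = \<psi> n \<oplus>\<^bsub>M\<^esub> \<psi> (p m)"
    proof -
      have "e m = \<psi> (e m')" using Cpsi[OF e m'(1)] m'(2) by simp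
      then show ?thesis using np m by (simp add: psi_simps NM Cmem)
    qed
    \<comment> \<open>Subtracting \<psi> p leaves e1 m = \<psi> n, an element of N, while e1 stays
      congruent to the identity modulo \<psi> C.\<close>
    define e1 where "e1 = (\<lambda>x. e x \<oplus>\<^bsub>M\<^esub> \<ominus>\<^bsub>M\<^esub> \<psi> (p x))"
    have e1: "e1 \<in> C" unfolding e1_def by (intro C_add C_minus C_psi e np)
    have e1m: "e1 m \<in> N"
    proof -
      have "e1 m = \<psi> n"
        using np m by (simp add: e1_def em M.M.a_assoc M.M.r_neg psi_simps NM Cmem)
      then show ?thesis using N(4)[OF C_psi[OF C_id] np(2)] by simp
    qed
    define q1 where "q1 = (\<lambda>x. q x \<oplus>\<^bsub>M\<^esub> \<ominus>\<^bsub>M\<^esub> p x)"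
    have q1: "q1 \<in> C" unfolding q1_def by (intro C_add C_minus q np)
    have e1q1: "e1 x = x \<oplus>\<^bsub>M\<^esub> \<psi> (q1 x)" if x: "x \<in> carrier M" for x
      using x q np(3) by (simp add: e1_def eq q1_def psi_simps Cmem M.M.a_assoc module_hom_minus[OF M M \<psi>])
    show ?case
    proof (rule bexI[where x = "\<lambda>x. e1 (e x)"], rule bexI[where x = "\<lambda>x. q x \<oplus>\<^bsub>M\<^esub> q1 (e x)"], intro ballI conjI)
      show "(\<lambda>x. e1 (e x)) \<in> C" by (rule C_comp[OF e1 e])
      show "(\<lambda>x. q x \<oplus>\<^bsub>M\<^esub> q1 (e x)) \<in> C" by (rule C_add[OF q C_comp[OF q1 e]])
      fix x assume x: "x \<in> carrier M"
      have "e1 (e x) = e x \<oplus>\<^bsub>M\<^esub> \<psi> (q1 (e x))" using e1q1 Cmem[OF e x] .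
      also have "\<dots> = x \<oplus>\<^bsub>M\<^esub> (\<psi> (q x) \<oplus>\<^bsub>M\<^esub> \<psi> (q1 (e x)))"
        using x e q q1 Cmem[OF e x] by (subst eq) (simp_all add: psi_simps Cmem M.M.a_assoc)
      finally show "e1 (e x) = x \<oplus>\<^bsub>M\<^esub> \<psi> (q x \<oplus>\<^bsub>M\<^esub> q1 (e x))"
        using x e q q1 Cmem[OF e x] by (simp add: psi_simps Cmem)
      obtain n c where nc: "e x = n \<oplus>\<^bsub>M\<^esub> c m" "n \<in> N" "c \<in> C" using eN[OF x] by blast
      \<comment> \<open>With e x = n + c m, commutativity of C gives e1 (c m) = c (e1 m). Both
        summands lie in N, so e1 composed with e has its values in N as required.\<close>
      have "e1 (e x) = e1 n \<oplus>\<^bsub>M\<^esub> c (e1 m)"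
        using nc e1 m by (simp add: Cadd NM Cmem Ccomm[OF e1 nc(3)])
      then show "e1 (e x) \<in> N" using N nc e1 e1m by simp
    qed
  qed
  have st0: "stable {\<zero>\<^bsub>M\<^esub>}" by (simp add: stable_def Czero)
  \<comment> \<open>For N = 0 the generation hypothesis of \<open>key\<close> is exactly
    \<open>gen\<close>, and e must vanish. What remains is the relation 0 = x + \<psi> (q
    x).\<close>
  have "\<exists>e\<in>C. \<exists>q\<in>C. \<forall>x\<in>carrier M. e x = x \<oplus>\<^bsub>M\<^esub> \<psi> (q x) \<and> e x \<in> {\<zero>\<^bsub>M\<^esub>}"
    by (rule key[OF G st0]) (use gen stable_submodule in auto)
  then obtain q where q: "q \<in> C" and q0: "\<And>x. x \<in> carrier M \<Longrightarrow> x \<oplus>\<^bsub>M\<^esub> \<psi> (q x) = \<zero>\<^bsub>M\<^esub>"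
    by (metis singletonD)
  \<comment> \<open>Since q commutes with \<psi>, the relation says that -q is a left inverse of
    \<psi>.\<close>
  have "x = \<ominus>\<^bsub>M\<^esub> q (\<psi> x)" if "x \<in> carrier M" for x
    using q0[OF that] q that by (metis Cpsi Cmem M.M.minus_equality psi_simps(1) M.M.minus_minus)
  then show ?thesis by (metis inj_onI)
qed

text \<open>An injective endomorphism carries a basis to an independent set of the same finite size,
  which is again a basis. A relation among the images pulls back to a relation with coefficients
  \<open>a \<circ> T\<close>.\<close>

lemma (in vectorspace) injective_endomorphism_surjective:
  assumes fd: "fin_dim" and T: "T \<in> module_hom K V V" and inj: "inj_on T (carrier V)"
  shows "T ` carrier V = carrier V"
proof -
  interpret T: linear_map K V V T
    by (intro linear_map.intro mod_hom.intro mod_hom_axioms.intro vectorspace_axioms module_axioms T)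
  obtain B where B: "finite B" "basis B" using finite_basis_exists[OF fd] by blast
  have BV: "B \<subseteq> carrier V" and li: "lin_indpt B" using B(2) by (auto simp: basis_def)
  have TBV: "T ` B \<subseteq> carrier V" using BV module_hom_mem[OF T] by auto
  have "lin_indpt (T ` B)"
  proof
    assume "lin_dep (T ` B)"
    then obtain a v where a: "a \<in> T ` B \<rightarrow> carrier K" "lincomb a (T ` B) = \<zero>\<^bsub>V\<^esub>"
      "v \<in> T ` B" "a v \<noteq> \<zero>\<^bsub>K\<^esub>"
      using finite_lin_dep[OF _ _ TBV] B(1) by blast
    have aT: "a \<circ> T \<in> B \<rightarrow> carrier K" using a(1) by auto
    have "T (lincomb (a \<circ> T) B) = T \<zero>\<^bsub>V\<^esub>"
      using T.lincomb_linear_image[OF inj BV a(1) B(1)] a(2) module_hom_zero[OF module_axioms module_axioms T]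
      by simp
    then have l0: "lincomb (a \<circ> T) B = \<zero>\<^bsub>V\<^esub>"
      by (rule inj_onD[OF inj]) (use lincomb_closed[OF BV aT] in simp_all)
    have "lin_dep B"
    proof -
      obtain w where w: "w \<in> B" "v = T w" using a(3) by blast
      have "(a \<circ> T) w \<noteq> \<zero>\<^bsub>K\<^esub>" using a(4) w(2) by simp
      then show ?thesis
        unfolding lin_dep_def using B(1) aT w(1) l0 by blast
    qed
    then show False using li by simp
  qed
  moreover have "card (T ` B) = dim"
    using B BV dim_basis[of B] by (simp add: card_image inj_on_subset[OF inj])
  ultimately have "gen_set (T ` B)"
    using dim_li_is_basis[OF fd _ TBV] B(1) by (auto simp: basis_def)
  then have "v \<in> T ` carrier V" if v: "v \<in> carrier V" for v
  proof -
    obtain a where a: "a \<in> T ` B \<rightarrow> carrier K" "v = lincomb a (T ` B)"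
      using finite_in_span[OF finite_imageI[OF B(1)] TBV, of v] v \<open>gen_set (T ` B)\<close> by metis
    then have "v = T (lincomb (a \<circ> T) B)" using T.lincomb_linear_image[OF inj BV a(1) B(1)] by simp
    moreover have "lincomb (a \<circ> T) B \<in> carrier V" using a(1) BV by (intro lincomb_closed) auto
    ultimately show ?thesis by blast
  qed
  then show ?thesis using module_hom_mem[OF T] by auto
qed

lemma (in vectorspace) dual_family_exists:
  assumes fd: "fin_dim" and b: "bilinear_map K V (regular_module K) b"
    and nd: "nondegenerate V (regular_module K) b"
  obtains B g where "finite B" "B \<subseteq> carrier V" "g \<in> B \<rightarrow> carrier V"
    "\<And>v. v \<in> carrier V \<Longrightarrow> v = (\<Oplus>\<^bsub>V\<^esub>e\<in>B. b v e \<odot>\<^bsub>V\<^esub> g e)"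
proof -
  have bl: "(\<lambda>u. b u v) \<in> module_hom K V (regular_module K)" if "v \<in> carrier V" for v
    using b that by (simp add: bilinear_map_def)
  have br: "b u \<in> module_hom K V (regular_module K)" if "u \<in> carrier V" for u
    using b that by (simp add: bilinear_map_def)
  have b_simps: "b u v \<in> carrier K" "b (u \<oplus>\<^bsub>V\<^esub> w) v = b u v \<oplus>\<^bsub>K\<^esub> b w v"
    "a \<in> carrier K \<Longrightarrow> b (a \<odot>\<^bsub>V\<^esub> u) v = a \<otimes>\<^bsub>K\<^esub> b u v"
    "b v (u \<oplus>\<^bsub>V\<^esub> w) = b v u \<oplus>\<^bsub>K\<^esub> b v w" "a \<in> carrier K \<Longrightarrow> b v (a \<odot>\<^bsub>V\<^esub> u) = a \<otimes>\<^bsub>K\<^esub> b v u"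
    if "u \<in> carrier V" "v \<in> carrier V" "w \<in> carrier V" for u v w a
    using module_hom_mem[OF bl] module_hom_add[OF bl] module_hom_smult[OF bl]
      module_hom_add[OF br] module_hom_smult[OF br] that
    by (simp_all add: regular_module_def)
  obtain B where B: "finite B" "basis B" using finite_basis_exists[OF fd] by blast
  have BV: "B \<subseteq> carrier V" and li: "lin_indpt B" and gs: "gen_set B" using B(2) by (auto simp: basis_def)
  have BVm: "e \<in> carrier V" if "e \<in> B" for e using BV that by blast
  \<comment> \<open>If T is invertible with inverse S, applying S to T v gives v as the sum of b(v,
    e) S(e). So the dual family is obtained as g = S, without inverting a Gram matrix.\<close>
  define T where "T v = (\<Oplus>\<^bsub>V\<^esub>e\<in>B. b v e \<odot>\<^bsub>V\<^esub> e)" for v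
  have T: "T \<in> module_hom K V V"
  proof (rule module_homI)
    show "T x \<in> carrier V" if "x \<in> carrier V" for x
      using that by (auto simp: T_def b_simps BVm intro!: M.finsum_closed)
    show "T (x \<oplus>\<^bsub>V\<^esub> y) = T x \<oplus>\<^bsub>V\<^esub> T y" if "x \<in> carrier V" "y \<in> carrier V" for x y
    proof -
      have "T x \<oplus>\<^bsub>V\<^esub> T y = (\<Oplus>\<^bsub>V\<^esub>e\<in>B. b x e \<odot>\<^bsub>V\<^esub> e \<oplus>\<^bsub>V\<^esub> b y e \<odot>\<^bsub>V\<^esub> e)"
        unfolding T_def using that by (subst M.finsum_addf) (auto simp: b_simps BVm)
      also have "\<dots> = T (x \<oplus>\<^bsub>V\<^esub> y)"
        unfolding T_def using that by (intro M.finsum_cong') (auto simp: b_simps BVm smult_l_distr)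
      finally show ?thesis by simp
    qed
    show "T (r \<odot>\<^bsub>V\<^esub> x) = r \<odot>\<^bsub>V\<^esub> T x" if "r \<in> carrier K" "x \<in> carrier V" for r x
    proof -
      have "r \<odot>\<^bsub>V\<^esub> T x = (\<Oplus>\<^bsub>V\<^esub>e\<in>B. r \<odot>\<^bsub>V\<^esub> (b x e \<odot>\<^bsub>V\<^esub> e))"
        unfolding T_def using that B(1) by (intro finsum_smult) (auto simp: b_simps BVm)
      also have "\<dots> = T (r \<odot>\<^bsub>V\<^esub> x)"
        unfolding T_def using that by (intro M.finsum_cong') (auto simp: b_simps BVm smult_assoc1)
      finally show ?thesis by simp
    qed
  qed
  \<comment> \<open>Independence of B turns T v = 0 into b(v, e) = 0 for all e in B. The right
    annihilator of v is a subspace containing B, hence everything, and nondegeneracy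
    concludes.\<close>
  have T0: "v = \<zero>\<^bsub>V\<^esub>" if v: "v \<in> carrier V" "T v = \<zero>\<^bsub>V\<^esub>" for v
  proof -
    have b0: "b v e = \<zero>\<^bsub>K\<^esub>" if "e \<in> B" for e
    proof (rule ccontr)
      assume "b v e \<noteq> \<zero>\<^bsub>K\<^esub>"
      moreover have "lincomb (b v) B = \<zero>\<^bsub>V\<^esub>" using v(2) by (simp add: lincomb_def T_def)
      moreover have "b v \<in> B \<rightarrow> carrier K" using v(1) by (auto simp: b_simps BVm)
      ultimately have "lin_dep B" using B(1) that unfolding lin_dep_def by blast
      then show False using li by simp
    qed
    have "LinearCombinations.submodule K {w \<in> carrier V. b v w = \<zero>\<^bsub>K\<^esub>} V"
    proof (rule LinearCombinations.submodule.intro)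
      show "module K V" by (rule module_axioms)
      have "b v \<zero>\<^bsub>V\<^esub> = \<zero>\<^bsub>K\<^esub>"
        using b_simps(5)[of "\<zero>\<^bsub>V\<^esub>" v "\<zero>\<^bsub>V\<^esub>" "\<zero>\<^bsub>K\<^esub>"] v(1) by (simp add: b_simps(1))
      then show "\<zero>\<^bsub>V\<^esub> \<in> {w \<in> carrier V. b v w = \<zero>\<^bsub>K\<^esub>}" by simp
    qed (use v(1) in \<open>auto simp: b_simps\<close>)
    then have "span B \<subseteq> {w \<in> carrier V. b v w = \<zero>\<^bsub>K\<^esub>}"
      using b0 BV by (intro span_is_subset) auto
    then have "b v w = \<zero>\<^bsub>K\<^esub>" if "w \<in> carrier V" for w using gs that by auto
    then show ?thesis using nd v(1) by (auto simp: nondegenerate_def regular_module_def)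
  qed
  have inj: "inj_on T (carrier V)"
  proof (rule inj_onI)
    fix x y assume xy: "x \<in> carrier V" "y \<in> carrier V" "T x = T y"
    have "T (x \<oplus>\<^bsub>V\<^esub> \<ominus>\<^bsub>V\<^esub> y) = \<zero>\<^bsub>V\<^esub>"
      using xy module_hom_mem[OF T] module_hom_minus[OF module_axioms module_axioms T]
      by (simp add: module_hom_add[OF T] M.r_neg)
    then have "x \<oplus>\<^bsub>V\<^esub> \<ominus>\<^bsub>V\<^esub> y = \<zero>\<^bsub>V\<^esub>" using T0 xy by simp
    then show "x = y" using xy using xy M.minus_equality[of x "\<ominus>\<^bsub>V\<^esub> y"] by simp
  qed
  have surj: "T ` carrier V = carrier V" using injective_endomorphism_surjective[OF fd T inj] .
  define S where "S = inv_into (carrier V) T"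
  have TS: "T (S x) = x" and Sc: "S x \<in> carrier V" if "x \<in> carrier V" for x
    using that surj by (auto simp: S_def f_inv_into_f inv_into_into)
  have ST: "S (T x) = x" if "x \<in> carrier V" for x
    using that inj by (simp add: S_def)
  have S: "S \<in> module_hom K V V"
  proof (rule module_homI)
    show "S (x \<oplus>\<^bsub>V\<^esub> y) = S x \<oplus>\<^bsub>V\<^esub> S y" if "x \<in> carrier V" "y \<in> carrier V" for x y
      using ST[of "S x \<oplus>\<^bsub>V\<^esub> S y"] that by (simp add: Sc TS module_hom_add[OF T])
    show "S (r \<odot>\<^bsub>V\<^esub> x) = r \<odot>\<^bsub>V\<^esub> S x" if "r \<in> carrier K" "x \<in> carrier V" for r x
      using ST[of "r \<odot>\<^bsub>V\<^esub> S x"] that by (simp add: Sc TS module_hom_smult[OF T])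
  qed (rule Sc)
  show thesis
  proof
    show "finite B" "B \<subseteq> carrier V" "S \<in> B \<rightarrow> carrier V" using B(1) BV Sc by auto
    fix v assume v: "v \<in> carrier V"
    have "v = S (T v)" using ST v by simp
    also have "\<dots> = (\<Oplus>\<^bsub>V\<^esub>e\<in>B. S (b v e \<odot>\<^bsub>V\<^esub> e))"
      unfolding T_def
      by (rule additive_map_finsum[OF M.abelian_group_axioms M.abelian_group_axioms module_hom_additive[OF S] B(1)])
         (use v in \<open>auto simp: b_simps BVm\<close>)
    also have "\<dots> = (\<Oplus>\<^bsub>V\<^esub>e\<in>B. b v e \<odot>\<^bsub>V\<^esub> S e)"
      using v by (intro M.finsum_cong') (auto simp: b_simps BVm Sc module_hom_smult[OF S])
    finally show "v = (\<Oplus>\<^bsub>V\<^esub>e\<in>B. b v e \<odot>\<^bsub>V\<^esub> S e)" .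
  qed
qed

section \<open>Base change\<close>

locale algebra_morphism = VR: scalar_extension F M R + VS: scalar_extension F M S
  for F (structure) and M and R and S +
  fixes f
  assumes f: "f \<in> algebra_hom F R S"
begin

lemma f_closed [simp]: "r \<in> carrier R \<Longrightarrow> f r \<in> carrier S"
  using f by (auto simp: algebra_hom_def ring_hom_def)

lemma f_add: "r \<in> carrier R \<Longrightarrow> s \<in> carrier R \<Longrightarrow> f (r \<oplus>\<^bsub>R\<^esub> s) = f r \<oplus>\<^bsub>S\<^esub> f s"
  using f by (auto simp: algebra_hom_def ring_hom_def)

lemma f_mult: "r \<in> carrier R \<Longrightarrow> s \<in> carrier R \<Longrightarrow> f (r \<otimes>\<^bsub>R\<^esub> s) = f r \<otimes>\<^bsub>S\<^esub> f s"
  using f by (auto simp: algebra_hom_def ring_hom_def)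

lemma f_one [simp]: "f \<one>\<^bsub>R\<^esub> = \<one>\<^bsub>S\<^esub>"
  using f by (auto simp: algebra_hom_def ring_hom_def)

lemma f_smult: "a \<in> carrier F \<Longrightarrow> r \<in> carrier R \<Longrightarrow> f (a \<odot>\<^bsub>R\<^esub> r) = a \<odot>\<^bsub>S\<^esub> f r"
  using f by (auto simp: algebra_hom_def module_hom_def)

abbreviation "cr \<equiv> change_of_ring F M R S f"

lemma balanced_change_of_ring: "balanced_map F M R VS.\<T> (\<lambda>v r. VS.pure v (f r))"
  by (rule balanced_mapI)
     (simp_all add: f_add f_smult VS.pure_add_left VS.pure_add_right VS.pure_smult)

lemma change_of_ring_additive: "additive_map VR.\<T> VS.\<T> cr"
  unfolding change_of_ring_def
  using VR.tensor_lift_additive[OF VS.abelian_group_scalar_ext VS.additive_group_scalar_ext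
      balanced_change_of_ring] .

lemma change_of_ring_pure:
  "v \<in> carrier M \<Longrightarrow> r \<in> carrier R \<Longrightarrow> cr (VR.pure v r) = VS.pure v (f r)"
  unfolding change_of_ring_def
  using VR.tensor_lift_pure[OF VS.abelian_group_scalar_ext VS.additive_group_scalar_ext
      balanced_change_of_ring] .

lemma change_of_ring_closed: "\<xi> \<in> carrier VR.\<T> \<Longrightarrow> cr \<xi> \<in> carrier VS.\<T>"
  using additive_map_closed[OF change_of_ring_additive] .

lemma change_of_ring_add:
  "\<xi> \<in> carrier VR.\<T> \<Longrightarrow> \<eta> \<in> carrier VR.\<T> \<Longrightarrow> cr (\<xi> \<oplus>\<^bsub>VR.\<T>\<^esub> \<eta>) = cr \<xi> \<oplus>\<^bsub>VS.\<T>\<^esub> cr \<eta>"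
  using additive_map_add[OF change_of_ring_additive] .

lemma change_of_ring_smult:
  assumes "r \<in> carrier R" "\<xi> \<in> carrier VR.\<T>"
  shows "cr (r \<odot>\<^bsub>VR.\<T>\<^esub> \<xi>) = f r \<odot>\<^bsub>VS.\<T>\<^esub> cr \<xi>"
  using assms(2)
  by (induction rule: VR.tensor_induct)
     (simp_all add: assms(1) VR.smult_pure VS.smult_pure change_of_ring_pure f_mult change_of_ring_add
       change_of_ring_closed VR.smult_scalar_ext_add VS.smult_scalar_ext_add VR.smult_scalar_ext_closed)

lemma change_of_ring_pure_one: "v \<in> carrier M \<Longrightarrow> cr (VR.pure v \<one>\<^bsub>R\<^esub>) = VS.pure v \<one>\<^bsub>S\<^esub>"
  by (simp add: change_of_ring_pure)

text \<open>The image of V_R spans V_S over S, because v \<otimes> s is s times the image of v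
  \<otimes> 1. Hence S-linear maps on V_S are determined on that image, which makes base changes
  unique.\<close>

lemma change_of_ring_induct [consumes 1, case_names smult add]:
  assumes "\<eta> \<in> carrier VS.\<T>"
    and "\<And>s \<xi>. s \<in> carrier S \<Longrightarrow> \<xi> \<in> carrier VR.\<T> \<Longrightarrow> P (s \<odot>\<^bsub>VS.\<T>\<^esub> cr \<xi>)"
    and "\<And>\<xi> \<eta>. \<xi> \<in> carrier VS.\<T> \<Longrightarrow> \<eta> \<in> carrier VS.\<T> \<Longrightarrow> P \<xi> \<Longrightarrow> P \<eta> \<Longrightarrow> P (\<xi> \<oplus>\<^bsub>VS.\<T>\<^esub> \<eta>)"
  shows "P \<eta>"
  using assms(1)
proof (induction rule: VS.tensor_induct)
  case (pure v s)
  have "VS.pure v s = s \<odot>\<^bsub>VS.\<T>\<^esub> cr (VR.pure v \<one>\<^bsub>R\<^esub>)"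
    unfolding change_of_ring_pure_one[OF pure(1)] by (rule VS.pure_eq_smult_one[OF pure])
  then show ?case using assms(2)[of s "VR.pure v \<one>\<^bsub>R\<^esub>"] pure by simp
qed (rule assms(3))

lemma base_change_exists:
  assumes \<phi>: "\<phi> \<in> carrier (End_alg R VR.\<T>)"
  obtains \<psi> where "\<psi> \<in> carrier (End_alg S VS.\<T>)" "\<And>\<xi>. \<xi> \<in> carrier VR.\<T> \<Longrightarrow> \<psi> (cr \<xi>) = cr (\<phi> \<xi>)"
proof -
  \<comment> \<open>Compatibility with \<phi> prescribes the value at v \<otimes> 1, and S-linearity
    then prescribes it at v \<otimes> s. The formula is therefore forced.\<close>
  let ?t = "\<lambda>v s. s \<odot>\<^bsub>VS.\<T>\<^esub> cr (\<phi> (VR.pure v \<one>\<^bsub>R\<^esub>))"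
  have \<phi>h: "\<phi> \<in> module_hom R VR.\<T> VR.\<T>" using \<phi> by simp
  note \<phi>m = module_hom_mem[OF \<phi>h] module_hom_add[OF \<phi>h] module_hom_smult[OF \<phi>h]
  have bal: "balanced_map F M S VS.\<T> ?t"
  proof (rule balanced_mapI)
    fix a v s assume a: "a \<in> carrier F" "v \<in> carrier M" "s \<in> carrier S"
    \<comment> \<open>To be balanced, a scalar a of F must travel through \<phi> and
      \<open>cr\<close>: it passes \<phi> as a 1 in R, \<open>cr\<close> turns this into a 1 in S,
      and the product with s is a s.\<close>
    have "s \<otimes>\<^bsub>S\<^esub> (a \<odot>\<^bsub>S\<^esub> \<one>\<^bsub>S\<^esub>) = a \<odot>\<^bsub>S\<^esub> s"
      using a by (simp add: VS.smult_r_assoc)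
    then show "?t (a \<odot>\<^bsub>M\<^esub> v) s = ?t v (a \<odot>\<^bsub>S\<^esub> s)"
      using a by (simp add: VR.pure_smult_left \<phi>m change_of_ring_smult change_of_ring_closed f_smult
          VS.T.smult_assoc1[symmetric])
  qed (simp_all add: \<phi>m change_of_ring_closed change_of_ring_add VR.pure_add_left
      VS.T.smult_l_distr VS.T.smult_r_distr)
  obtain \<psi> where \<psi>: "additive_map VS.\<T> VS.\<T> \<psi>"
    "\<And>v s. v \<in> carrier M \<Longrightarrow> s \<in> carrier S \<Longrightarrow> \<psi> (VS.pure v s) = ?t v s"
    using VS.tensor_lift_exists[OF VS.abelian_group_scalar_ext bal] by blast
  have \<psi>s: "\<psi> (r \<odot>\<^bsub>VS.\<T>\<^esub> \<eta>) = r \<odot>\<^bsub>VS.\<T>\<^esub> \<psi> \<eta>" if r: "r \<in> carrier S" and "\<eta> \<in> carrier VS.\<T>" for r \<eta>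
    using that(2)
    by (induction rule: VS.tensor_induct)
       (simp_all add: r VS.smult_pure \<psi>(2) VS.T.smult_assoc1 \<phi>m change_of_ring_closed
         additive_map_add[OF \<psi>(1)] additive_map_closed[OF \<psi>(1)] VS.T.smult_r_distr)
  have \<psi>c: "\<psi> (cr \<xi>) = cr (\<phi> \<xi>)" if "\<xi> \<in> carrier VR.\<T>" for \<xi>
    using that
  proof (induction rule: VR.tensor_induct)
    case (pure v r)
    then have "cr (\<phi> (VR.pure v r)) = cr (\<phi> (r \<odot>\<^bsub>VR.\<T>\<^esub> VR.pure v \<one>\<^bsub>R\<^esub>))"
      by (simp add: VR.smult_pure)
    then show ?case using pure by (simp add: change_of_ring_pure \<psi>(2) \<phi>m change_of_ring_smult)
  next
    case (add \<xi> \<eta>)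
    then show ?case by (simp add: change_of_ring_add \<phi>m additive_map_add[OF \<psi>(1)] change_of_ring_closed)
  qed
  show thesis
  proof
    show "restrict \<psi> (carrier VS.\<T>) \<in> carrier (End_alg S VS.\<T>)"
      by (rule End_algI) (simp_all add: additive_map_closed[OF \<psi>(1)] additive_map_add[OF \<psi>(1)] \<psi>s)
    show "restrict \<psi> (carrier VS.\<T>) (cr \<xi>) = cr (\<phi> \<xi>)" if "\<xi> \<in> carrier VR.\<T>" for \<xi>
      using that \<psi>c by (simp add: change_of_ring_closed)
  qed
qed

lemma End_alg_eqI:
  assumes "\<psi> \<in> module_hom S VS.\<T> VS.\<T>" "\<psi>' \<in> module_hom S VS.\<T> VS.\<T>"
    and "\<And>\<xi>. \<xi> \<in> carrier VR.\<T> \<Longrightarrow> \<psi> (cr \<xi>) = \<psi>' (cr \<xi>)" and "\<eta> \<in> carrier VS.\<T>"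
  shows "\<psi> \<eta> = \<psi>' \<eta>"
  using assms(4)
  by (induction rule: change_of_ring_induct)
     (simp_all add: module_hom_add[OF assms(1)] module_hom_add[OF assms(2)] module_hom_smult[OF assms(1)]
       module_hom_smult[OF assms(2)] assms(3) change_of_ring_closed)

lemma base_change:
  assumes \<phi>: "\<phi> \<in> carrier (End_alg R VR.\<T>)"
  shows base_change_closed: "base_change F M R S f \<phi> \<in> carrier (End_alg S VS.\<T>)"
    and base_change_apply: "\<And>\<xi>. \<xi> \<in> carrier VR.\<T> \<Longrightarrow> base_change F M R S f \<phi> (cr \<xi>) = cr (\<phi> \<xi>)"
    and base_change_eqI: "\<And>\<psi>. \<psi> \<in> carrier (End_alg S VS.\<T>) \<Longrightarrow>
      (\<And>\<xi>. \<xi> \<in> carrier VR.\<T> \<Longrightarrow> \<psi> (cr \<xi>) = cr (\<phi> \<xi>)) \<Longrightarrow> base_change F M R S f \<phi> = \<psi>"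
proof -
  let ?P = "\<lambda>\<psi>. \<psi> \<in> carrier (End_alg S VS.\<T>) \<and> (\<forall>\<xi>\<in>carrier VR.\<T>. \<psi> (cr \<xi>) = cr (\<phi> \<xi>))"
  have uniq: "\<psi> = \<psi>'" if P: "?P \<psi>" "?P \<psi>'" for \<psi> \<psi>'
  proof (rule extensionalityI)
    show "\<psi> \<in> extensional (carrier VS.\<T>)" "\<psi>' \<in> extensional (carrier VS.\<T>)" using P by simp_all
    show "\<psi> \<eta> = \<psi>' \<eta>" if "\<eta> \<in> carrier VS.\<T>" for \<eta>
      by (rule End_alg_eqI[OF _ _ _ that]) (use P in simp_all)
  qed
  obtain \<psi>0 where \<psi>0: "?P \<psi>0" using base_change_exists[OF \<phi>] by metis
  have "\<exists>!\<psi>. ?P \<psi>" by (rule ex1I[of ?P, OF \<psi>0]) (rule uniq[OF _ \<psi>0])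
  then have "?P (base_change F M R S f \<phi>)"
    unfolding base_change_def by (rule theI'[of ?P])
  note bc = this
  from bc show "base_change F M R S f \<phi> \<in> carrier (End_alg S VS.\<T>)" by (rule conjunct1)
  from bc show    "\<And>\<xi>. \<xi> \<in> carrier VR.\<T> \<Longrightarrow> base_change F M R S f \<phi> (cr \<xi>) = cr (\<phi> \<xi>)"
    by (rule conjunct2[THEN bspec])
  show "base_change F M R S f \<phi> = \<psi>"
    if "\<psi> \<in> carrier (End_alg S VS.\<T>)" "\<And>\<xi>. \<xi> \<in> carrier VR.\<T> \<Longrightarrow> \<psi> (cr \<xi>) = cr (\<phi> \<xi>)" for \<psi>
    by (rule uniq[OF bc]) (use that in blast)
qed

text \<open>By uniqueness it suffices that the composite of the base changes is S-linear and
  compatible with the composite over R.\<close>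

lemma base_change_compose:
  assumes "\<phi> \<in> carrier (End_alg R VR.\<T>)" "\<phi>' \<in> carrier (End_alg R VR.\<T>)"
  shows "base_change F M R S f (compose (carrier VR.\<T>) \<phi> \<phi>') =
    compose (carrier VS.\<T>) (base_change F M R S f \<phi>) (base_change F M R S f \<phi>')"
proof (rule base_change_eqI)
  show "compose (carrier VR.\<T>) \<phi> \<phi>' \<in> carrier (End_alg R VR.\<T>)"
    using compose_End_alg[OF VR.module_scalar_ext assms] .
  show "compose (carrier VS.\<T>) (base_change F M R S f \<phi>) (base_change F M R S f \<phi>')
      \<in> carrier (End_alg S VS.\<T>)"
    using compose_End_alg[OF VS.module_scalar_ext] base_change_closed assms by blast
  show "compose (carrier VS.\<T>) (base_change F M R S f \<phi>) (base_change F M R S f \<phi>') (cr \<xi>) =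
      cr (compose (carrier VR.\<T>) \<phi> \<phi>' \<xi>)" if "\<xi> \<in> carrier VR.\<T>" for \<xi>
    using that End_alg_apply_closed[OF assms(2) that] assms
    by (simp add: compose_eq change_of_ring_closed base_change_apply del: carrier_End_alg)
qed

lemma base_change_one:
  "base_change F M R S f (\<lambda>\<xi>\<in>carrier VR.\<T>. \<xi>) = (\<lambda>\<xi>\<in>carrier VS.\<T>. \<xi>)"
  by (rule base_change_eqI)
     (simp_all add: change_of_ring_closed one_End_alg_closed[OF VR.module_scalar_ext]
       one_End_alg_closed[OF VS.module_scalar_ext] del: carrier_End_alg)

lemma base_change_Units:
  assumes "\<phi> \<in> Units (End_alg R VR.\<T>)"
  shows "base_change F M R S f \<phi> \<in> Units (End_alg S VS.\<T>)"
proof -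
  obtain \<psi> where \<psi>: "\<phi> \<in> carrier (End_alg R VR.\<T>)" "\<psi> \<in> carrier (End_alg R VR.\<T>)"
    "compose (carrier VR.\<T>) \<psi> \<phi> = (\<lambda>\<xi>\<in>carrier VR.\<T>. \<xi>)" "compose (carrier VR.\<T>) \<phi> \<psi> = (\<lambda>\<xi>\<in>carrier VR.\<T>. \<xi>)"
    using assms by (auto simp: Units_def)
  then have "compose (carrier VS.\<T>) (base_change F M R S f \<psi>) (base_change F M R S f \<phi>) = (\<lambda>\<xi>\<in>carrier VS.\<T>. \<xi>)"
    "compose (carrier VS.\<T>) (base_change F M R S f \<phi>) (base_change F M R S f \<psi>) = (\<lambda>\<xi>\<in>carrier VS.\<T>. \<xi>)"
    by (metis base_change_compose base_change_one)+
  then show ?thesis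
    unfolding Units_def using base_change_closed[OF \<psi>(1)] base_change_closed[OF \<psi>(2)]
    by (simp del: carrier_End_alg) blast
qed

lemma linear_ext_change_of_ring:
  assumes X: "X \<in> module_hom F M M" and "\<xi> \<in> carrier VR.\<T>"
  shows "linear_ext F M S X (cr \<xi>) = cr (linear_ext F M R X \<xi>)"
  using assms(2)
  by (induction rule: VR.tensor_induct)
     (simp_all add: change_of_ring_pure VS.linear_ext_pure[OF X] VR.linear_ext_pure[OF X]
       module_hom_mem[OF X] change_of_ring_add change_of_ring_closed VS.linear_ext_add[OF X]
       VR.linear_ext_add[OF X] VR.linear_ext_closed[OF X])

text \<open>Both sides are S-linear in \<eta>, so the comparison may be made on the image of V_R,
  where the commutation over R applies.\<close>

lemma base_change_commute:
  assumes X: "X \<in> module_hom F M M" and \<phi>: "\<phi> \<in> carrier (End_alg R VR.\<T>)"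
    and comm: "\<And>\<xi>. \<xi> \<in> carrier VR.\<T> \<Longrightarrow> \<phi> (linear_ext F M R X \<xi>) = linear_ext F M R X (\<phi> \<xi>)"
    and \<eta>: "\<eta> \<in> carrier VS.\<T>"
  shows "base_change F M R S f \<phi> (linear_ext F M S X \<eta>) = linear_ext F M S X (base_change F M R S f \<phi> \<eta>)"
proof -
  let ?\<psi> = "base_change F M R S f \<phi>"
  have \<psi>: "?\<psi> \<in> module_hom S VS.\<T> VS.\<T>" using base_change_closed[OF \<phi>] by simp
  note \<psi>m = module_hom_mem[OF \<psi>] module_hom_add[OF \<psi>] module_hom_smult[OF \<psi>]
  note Xm = VS.linear_ext_closed[OF X] VS.linear_ext_add[OF X] VS.linear_ext_smult[OF X]
  show ?thesis
  proof (rule End_alg_eqI[OF _ _ _ \<eta>])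
    show "(\<lambda>\<eta>. ?\<psi> (linear_ext F M S X \<eta>)) \<in> module_hom S VS.\<T> VS.\<T>"
      "(\<lambda>\<eta>. linear_ext F M S X (?\<psi> \<eta>)) \<in> module_hom S VS.\<T> VS.\<T>"
      by (rule module_homI; simp add: \<psi>m Xm)+
    show "?\<psi> (linear_ext F M S X (cr \<xi>)) = linear_ext F M S X (?\<psi> (cr \<xi>))" if "\<xi> \<in> carrier VR.\<T>" for \<xi>
      using that by (simp add: linear_ext_change_of_ring[OF X] base_change_apply[OF \<phi>]
          VR.linear_ext_closed[OF X] comm End_alg_apply_closed[OF \<phi>])
  qed
qed

lemma form_ext_change_of_ring:
  assumes b: "bilinear_map F M (regular_module F) b"
    and \<xi>: "\<xi> \<in> carrier VR.\<T>" and \<eta>: "\<eta> \<in> carrier VR.\<T>"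
  shows "form_ext F M S b (cr \<xi>) (cr \<eta>) = f (form_ext F M R b \<xi> \<eta>)"
proof -
  have bc: "b u v \<in> carrier F" if "u \<in> carrier M" "v \<in> carrier M" for u v
    using b that module_hom_mem[of "b u" F M "regular_module F" v]
    by (simp add: bilinear_map_def regular_module_def)
  note simps = change_of_ring_closed change_of_ring_add VS.form_ext_add_left[OF b] VS.form_ext_add_right[OF b]
    VR.form_ext_add_left[OF b] VR.form_ext_add_right[OF b] VR.form_ext_closed[OF b] f_add
  from \<xi> show ?thesis
  proof (induction rule: VR.tensor_induct)
    case (pure u r)
    from \<eta> show ?case
      by (induction rule: VR.tensor_induct)
         (use pure in \<open>simp_all add: simps change_of_ring_pure VS.form_ext_pure[OF b]
           VR.form_ext_pure[OF b] f_smult f_mult bc\<close>)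
  qed (use \<eta> in \<open>simp_all add: simps\<close>)
qed

text \<open>Since the extended form is S-bilinear, only arguments s \<open>cr\<close> \<xi> and s'
  \<open>cr\<close> \<eta> need checking. There both sides reduce to the image under f of a value of
  the form over R.\<close>

lemma base_change_form_ext:
  assumes b: "bilinear_map F M (regular_module F) b" and \<phi>: "\<phi> \<in> carrier (End_alg R VR.\<T>)"
    and pres: "\<And>\<xi> \<eta>. \<xi> \<in> carrier VR.\<T> \<Longrightarrow> \<eta> \<in> carrier VR.\<T> \<Longrightarrow>
      form_ext F M R b (\<phi> \<xi>) (\<phi> \<eta>) = form_ext F M R b \<xi> \<eta>"
    and \<xi>: "\<xi> \<in> carrier VS.\<T>" and \<eta>: "\<eta> \<in> carrier VS.\<T>"
  shows "form_ext F M S b (base_change F M R S f \<phi> \<xi>) (base_change F M R S f \<phi> \<eta>) = form_ext F M S b \<xi> \<eta>"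
proof -
  let ?\<psi> = "base_change F M R S f \<phi>"
  have \<psi>: "?\<psi> \<in> module_hom S VS.\<T> VS.\<T>" using base_change_closed[OF \<phi>] by simp
  note simps = module_hom_mem[OF \<psi>] module_hom_add[OF \<psi>] module_hom_smult[OF \<psi>]
    change_of_ring_closed VS.form_ext_add_left[OF b] VS.form_ext_add_right[OF b]
    VS.form_ext_smult_left[OF b] VS.form_ext_smult_right[OF b] VS.smult_scalar_ext_closed
  from \<xi> show ?thesis
  proof (induction rule: change_of_ring_induct)
    case (smult s \<xi>)
    from \<eta> show ?case
    proof (induction rule: change_of_ring_induct)
      case (smult s' \<eta>)
      then show ?case
        using \<open>s \<in> carrier S\<close> \<open>\<xi> \<in> carrier VR.\<T>\<close>
        by (simp add: simps base_change_apply[OF \<phi>] End_alg_apply_closed[OF \<phi>] form_ext_change_of_ring[OF b] pres)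
    qed (use smult in \<open>simp_all add: simps\<close>)
  qed (use \<eta> in \<open>simp_all add: simps\<close>)
qed

end

section \<open>The group functors\<close>

lemma Units_End_algD:
  assumes "\<phi> \<in> Units (End_alg A N)"
  shows "\<phi> \<in> carrier (End_alg A N)"
  using assms by (simp add: Units_def del: carrier_End_alg)

lemma Units_End_algI:
  assumes N: "module A N" and \<phi>: "\<phi> \<in> carrier (End_alg A N)" and \<psi>: "\<psi> \<in> carrier (End_alg A N)"
    and "\<And>x. x \<in> carrier N \<Longrightarrow> \<psi> (\<phi> x) = x" "\<And>x. x \<in> carrier N \<Longrightarrow> \<phi> (\<psi> x) = x"
  shows "\<phi> \<in> Units (End_alg A N)"
proof -
  have "compose (carrier N) \<psi> \<phi> = (\<lambda>x\<in>carrier N. x)" "compose (carrier N) \<phi> \<psi> = (\<lambda>x\<in>carrier N. x)"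
    using assms(4,5) by (auto simp: compose_def)
  then show ?thesis
    unfolding Units_def using \<phi> \<psi> by (auto simp del: carrier_End_alg)
qed


section \<open>The groups over a fixed R\<close>

context scalar_extension
begin

lemma group_GL_fun: "group (GL_fun F M R)"
  unfolding GL_fun_def using monoid.units_group[OF monoid_End_alg[OF module_scalar_ext]] .

lemma carrier_GL_fun: "carrier (GL_fun F M R) = Units (End_alg R \<T>)"
  by (simp add: GL_fun_def units_of_def)

lemma mult_GL_fun: "mult (GL_fun F M R) = compose (carrier \<T>)"
  by (simp add: GL_fun_def units_of_def)

lemma one_GL_fun: "\<one>\<^bsub>GL_fun F M R\<^esub> = (\<lambda>\<xi>\<in>carrier \<T>. \<xi>)"
  by (simp add: GL_fun_def units_of_def)

lemma GL_fun_apply_closed: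
  "\<phi> \<in> carrier (GL_fun F M R) \<Longrightarrow> \<xi> \<in> carrier \<T> \<Longrightarrow> \<phi> \<xi> \<in> carrier \<T>"
  unfolding carrier_GL_fun by (rule End_alg_apply_closed[OF Units_End_algD])

lemma GL_fun_inv_left:
  assumes "\<phi> \<in> carrier (GL_fun F M R)" "\<xi> \<in> carrier \<T>"
  shows "(inv\<^bsub>GL_fun F M R\<^esub> \<phi>) (\<phi> \<xi>) = \<xi>"
proof -
  have "compose (carrier \<T>) (inv\<^bsub>GL_fun F M R\<^esub> \<phi>) \<phi> = (\<lambda>\<xi>\<in>carrier \<T>. \<xi>)"
    using group.l_inv[OF group_GL_fun assms(1)] by (simp add: mult_GL_fun one_GL_fun)
  from fun_cong[OF this, of \<xi>] show ?thesis using assms(2) by (simp add: compose_eq)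
qed

lemma GL_fun_inv_right:
  assumes "\<phi> \<in> carrier (GL_fun F M R)" "\<xi> \<in> carrier \<T>"
  shows "\<phi> ((inv\<^bsub>GL_fun F M R\<^esub> \<phi>) \<xi>) = \<xi>"
proof -
  have "compose (carrier \<T>) \<phi> (inv\<^bsub>GL_fun F M R\<^esub> \<phi>) = (\<lambda>\<xi>\<in>carrier \<T>. \<xi>)"
    using group.r_inv[OF group_GL_fun assms(1)] by (simp add: mult_GL_fun one_GL_fun)
  from fun_cong[OF this, of \<xi>] show ?thesis using assms(2) by (simp add: compose_eq)
qed

lemma Aut_X_fun_mem:
  "\<phi> \<in> carrier (Aut_X_fun F M X R) \<longleftrightarrow> \<phi> \<in> carrier (GL_fun F M R) \<and>
    (\<forall>\<xi>\<in>carrier \<T>. \<phi> (linear_ext F M R X \<xi>) = linear_ext F M R X (\<phi> \<xi>))"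
  by (simp add: Aut_X_fun_def)

lemma O_fun_mem:
  "\<phi> \<in> carrier (O_fun F M b R) \<longleftrightarrow> \<phi> \<in> carrier (GL_fun F M R) \<and>
    (\<forall>\<xi>\<in>carrier \<T>. \<forall>\<eta>\<in>carrier \<T>. form_ext F M R b (\<phi> \<xi>) (\<phi> \<eta>) = form_ext F M R b \<xi> \<eta>)"
  by (simp add: O_fun_def)

lemma subgroup_Aut_X:
  assumes X: "X \<in> module_hom F M M"
  shows "subgroup (carrier (Aut_X_fun F M X R)) (GL_fun F M R)"
proof (rule group.subgroupI[OF group_GL_fun])
  interpret GL: group "GL_fun F M R" by (rule group_GL_fun)
  note Xc = linear_ext_closed[OF X]
  show "carrier (Aut_X_fun F M X R) \<subseteq> carrier (GL_fun F M R)" by (auto simp: Aut_X_fun_mem)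
  have "\<one>\<^bsub>GL_fun F M R\<^esub> \<in> carrier (Aut_X_fun F M X R)"
    unfolding Aut_X_fun_mem using GL.one_closed by (simp add: one_GL_fun Xc)
  then show "carrier (Aut_X_fun F M X R) \<noteq> {}" by blast
  fix \<phi> assume \<phi>: "\<phi> \<in> carrier (Aut_X_fun F M X R)"
  then have \<phi>G: "\<phi> \<in> carrier (GL_fun F M R)" by (simp add: Aut_X_fun_mem)
  let ?i = "inv\<^bsub>GL_fun F M R\<^esub> \<phi>"
  have iG: "?i \<in> carrier (GL_fun F M R)" using \<phi>G by simp
  have "?i (linear_ext F M R X \<xi>) = linear_ext F M R X (?i \<xi>)" if \<xi>: "\<xi> \<in> carrier \<T>" for \<xi>
  proof -
    have i: "?i \<xi> \<in> carrier \<T>" using GL_fun_apply_closed[OF iG \<xi>] .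
    have "linear_ext F M R X \<xi> = linear_ext F M R X (\<phi> (?i \<xi>))" using GL_fun_inv_right[OF \<phi>G \<xi>] by simp
    also have "\<dots> = \<phi> (linear_ext F M R X (?i \<xi>))" using \<phi> i by (simp add: Aut_X_fun_mem)
    finally show ?thesis using GL_fun_inv_left[OF \<phi>G Xc[OF i]] by simp
  qed
  then show "?i \<in> carrier (Aut_X_fun F M X R)" using iG by (simp add: Aut_X_fun_mem)
  fix \<phi>' assume \<phi>': "\<phi>' \<in> carrier (Aut_X_fun F M X R)"
  then have \<phi>'G: "\<phi>' \<in> carrier (GL_fun F M R)" by (simp add: Aut_X_fun_mem)
  have "compose (carrier \<T>) \<phi> \<phi>' \<in> carrier (GL_fun F M R)"
    using GL.m_closed[OF \<phi>G \<phi>'G] by (simp add: mult_GL_fun)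
  then show "\<phi> \<otimes>\<^bsub>GL_fun F M R\<^esub> \<phi>' \<in> carrier (Aut_X_fun F M X R)"
    using \<phi> \<phi>' by (simp add: Aut_X_fun_mem mult_GL_fun compose_eq Xc GL_fun_apply_closed[OF \<phi>'G])
qed

lemma subgroup_O: "subgroup (carrier (O_fun F M b R)) (GL_fun F M R)"
proof (rule group.subgroupI[OF group_GL_fun])
  interpret GL: group "GL_fun F M R" by (rule group_GL_fun)
  show "carrier (O_fun F M b R) \<subseteq> carrier (GL_fun F M R)" by (auto simp: O_fun_mem)
  have "\<one>\<^bsub>GL_fun F M R\<^esub> \<in> carrier (O_fun F M b R)"
    unfolding O_fun_mem using GL.one_closed by (simp add: one_GL_fun)
  then show "carrier (O_fun F M b R) \<noteq> {}" by blast
  fix \<phi> assume \<phi>: "\<phi> \<in> carrier (O_fun F M b R)"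
  then have \<phi>G: "\<phi> \<in> carrier (GL_fun F M R)" by (simp add: O_fun_mem)
  let ?i = "inv\<^bsub>GL_fun F M R\<^esub> \<phi>"
  have iG: "?i \<in> carrier (GL_fun F M R)" using \<phi>G by simp
  have "form_ext F M R b (?i \<xi>) (?i \<eta>) = form_ext F M R b \<xi> \<eta>"
    if "\<xi> \<in> carrier \<T>" "\<eta> \<in> carrier \<T>" for \<xi> \<eta>
  proof -
    have "form_ext F M R b (?i \<xi>) (?i \<eta>) = form_ext F M R b (\<phi> (?i \<xi>)) (\<phi> (?i \<eta>))"
      using \<phi> GL_fun_apply_closed[OF iG] that by (simp add: O_fun_mem)
    then show ?thesis using GL_fun_inv_right[OF \<phi>G] that by simp
  qed
  then show "?i \<in> carrier (O_fun F M b R)" using iG by (simp add: O_fun_mem)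
  fix \<phi>' assume \<phi>': "\<phi>' \<in> carrier (O_fun F M b R)"
  then have \<phi>'G: "\<phi>' \<in> carrier (GL_fun F M R)" by (simp add: O_fun_mem)
  have "compose (carrier \<T>) \<phi> \<phi>' \<in> carrier (GL_fun F M R)"
    using GL.m_closed[OF \<phi>G \<phi>'G] by (simp add: mult_GL_fun)
  then show "\<phi> \<otimes>\<^bsub>GL_fun F M R\<^esub> \<phi>' \<in> carrier (O_fun F M b R)"
    using \<phi> \<phi>' by (simp add: O_fun_mem mult_GL_fun compose_eq GL_fun_apply_closed[OF \<phi>'G])
qed

lemma group_Aut_X_fun:
  assumes "X \<in> module_hom F M M"
  shows "group (Aut_X_fun F M X R)"
  using subgroup.subgroup_is_group[OF subgroup_Aut_X[OF assms] group_GL_fun]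
  by (simp add: Aut_X_fun_def)

lemma group_Aut_Xb_fun:
  assumes "X \<in> module_hom F M M"
  shows "group (Aut_Xb_fun F M X b R)"
  using subgroup.subgroup_is_group[OF
      group.subgroups_Inter_pair[OF group_GL_fun subgroup_Aut_X[OF assms] subgroup_O] group_GL_fun]
  by (simp add: Aut_Xb_fun_def)

lemma mult_Aut_X_fun: "mult (Aut_X_fun F M X R) = compose (carrier \<T>)"
  by (simp add: Aut_X_fun_def mult_GL_fun)

lemma mult_Aut_Xb_fun: "mult (Aut_Xb_fun F M X b R) = compose (carrier \<T>)"
  by (simp add: Aut_Xb_fun_def mult_GL_fun)

text \<open>\<open>compose\<close> is cut off outside the carrier, so equality of the two products
  as HOL functions is precisely commutation at every vector of V_R.\<close>

lemma Aut_X_fun_eq_Cent_GL_fun: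
  assumes X: "X \<in> module_hom F M M"
  shows "Aut_X_fun F M X R = Cent_GL_fun F M X R"
proof -
  have "(\<forall>\<xi>\<in>carrier \<T>. \<phi> (linear_ext F M R X \<xi>) = linear_ext F M R X (\<phi> \<xi>)) \<longleftrightarrow>
    compose (carrier \<T>) \<phi> (linear_ext F M R X) = compose (carrier \<T>) (linear_ext F M R X) \<phi>" for \<phi>
    by (auto simp: compose_def fun_eq_iff)
  then show ?thesis by (simp add: Aut_X_fun_def Cent_GL_fun_def)
qed

text \<open>This reconciles \<open>U_fun\<close>, which asks for no inverse, with
  \<open>Aut_Xb_fun\<close>, whose members lie in GL.\<close>

lemma isometry_in_Units:
  assumes F: "vectorspace F M" and fd: "vectorspace.fin_dim F M"
    and b: "bilinear_map F M (regular_module F) b" and nd: "nondegenerate M (regular_module F) b"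
    and \<phi>: "\<phi> \<in> carrier (End_alg R \<T>)"
    and isom: "\<And>\<xi> \<eta>. \<xi> \<in> carrier \<T> \<Longrightarrow> \<eta> \<in> carrier \<T> \<Longrightarrow>
      form_ext F M R b (\<phi> \<xi>) (\<phi> \<eta>) = form_ext F M R b \<xi> \<eta>"
  shows "\<phi> \<in> Units (End_alg R \<T>)"
proof -
  interpret vectorspace F M by fact
  obtain B g where B: "finite B" "B \<subseteq> carrier M" "g \<in> B \<rightarrow> carrier M"
    and dual: "\<And>v. v \<in> carrier M \<Longrightarrow> v = (\<Oplus>\<^bsub>M\<^esub>e\<in>B. b v e \<odot>\<^bsub>M\<^esub> g e)"
    using vectorspace.dual_family_exists[OF F fd b nd] by blast
  have BM: "e \<in> carrier M" and gM: "g e \<in> carrier M" if "e \<in> B" for e using B that by auto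
  have bc: "b u v \<in> carrier F" if "u \<in> carrier M" "v \<in> carrier M" for u v
    using b that module_hom_mem[of "b u" F M "regular_module F" v]
    by (simp add: bilinear_map_def regular_module_def)
  have \<phi>h: "\<phi> \<in> module_hom R \<T> \<T>" using \<phi> by simp
  note \<phi>m = module_hom_mem[OF \<phi>h] module_hom_add[OF \<phi>h] module_hom_smult[OF \<phi>h]
  let ?e = "\<lambda>e. pure e \<one>\<^bsub>R\<^esub>"
  let ?b = "form_ext F M R b"
  note bb = form_ext_closed[OF b] form_ext_add_left[OF b] form_ext_smult_left[OF b]
  \<comment> \<open>Stated for a general family h because it is used twice: with e \<otimes> 1 for
    the expansion of a vector, and with its image under \<phi> for the adjoint.\<close>
  have sum_add: "(\<Oplus>\<^bsub>\<T>\<^esub>e\<in>B. ?b (\<xi> \<oplus>\<^bsub>\<T>\<^esub> \<eta>) (h e) \<odot>\<^bsub>\<T>\<^esub> ?e (g e)) =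
      (\<Oplus>\<^bsub>\<T>\<^esub>e\<in>B. ?b \<xi> (h e) \<odot>\<^bsub>\<T>\<^esub> ?e (g e)) \<oplus>\<^bsub>\<T>\<^esub> (\<Oplus>\<^bsub>\<T>\<^esub>e\<in>B. ?b \<eta> (h e) \<odot>\<^bsub>\<T>\<^esub> ?e (g e))"
    if "\<xi> \<in> carrier \<T>" "\<eta> \<in> carrier \<T>" "\<And>e. e \<in> B \<Longrightarrow> h e \<in> carrier \<T>" for \<xi> \<eta> h
  proof -
    have "(\<Oplus>\<^bsub>\<T>\<^esub>e\<in>B. ?b \<xi> (h e) \<odot>\<^bsub>\<T>\<^esub> ?e (g e)) \<oplus>\<^bsub>\<T>\<^esub> (\<Oplus>\<^bsub>\<T>\<^esub>e\<in>B. ?b \<eta> (h e) \<odot>\<^bsub>\<T>\<^esub> ?e (g e))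
      = (\<Oplus>\<^bsub>\<T>\<^esub>e\<in>B. ?b \<xi> (h e) \<odot>\<^bsub>\<T>\<^esub> ?e (g e) \<oplus>\<^bsub>\<T>\<^esub> ?b \<eta> (h e) \<odot>\<^bsub>\<T>\<^esub> ?e (g e))"
      using that by (subst T.finsum_addf) (auto simp: bb gM)
    also have "\<dots> = (\<Oplus>\<^bsub>\<T>\<^esub>e\<in>B. ?b (\<xi> \<oplus>\<^bsub>\<T>\<^esub> \<eta>) (h e) \<odot>\<^bsub>\<T>\<^esub> ?e (g e))"
      using that by (intro T.finsum_cong') (auto simp: bb gM T.smult_l_distr)
    finally show ?thesis by simp
  qed
  \<comment> \<open>The dual expansion survives extension of scalars, because b_R(v \<otimes> s, e
    \<otimes> 1) = b(v, e) s.\<close>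
  have expand: "(\<Oplus>\<^bsub>\<T>\<^esub>e\<in>B. ?b \<eta> (?e e) \<odot>\<^bsub>\<T>\<^esub> ?e (g e)) = \<eta>" if "\<eta> \<in> carrier \<T>" for \<eta>
    using that
  proof (induction rule: tensor_induct)
    case (pure v s)
    have a: "additive_map M \<T> (\<lambda>v. pure v s)"
      using pure by (intro additive_mapI) (auto simp: pure_add_left)
    have "pure v s = pure (\<Oplus>\<^bsub>M\<^esub>e\<in>B. b v e \<odot>\<^bsub>M\<^esub> g e) s" using dual[OF pure(1)] by simp
    also have "\<dots> = (\<Oplus>\<^bsub>\<T>\<^esub>e\<in>B. pure (b v e \<odot>\<^bsub>M\<^esub> g e) s)"
      by (rule additive_map_finsum[OF M.abelian_group_axioms abelian_group_scalar_ext a B(1)])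
         (use pure in \<open>auto simp: bc BM gM\<close>)
    also have "\<dots> = (\<Oplus>\<^bsub>\<T>\<^esub>e\<in>B. ?b (pure v s) (?e e) \<odot>\<^bsub>\<T>\<^esub> ?e (g e))"
    proof (rule T.finsum_cong')
      show "(\<lambda>e. ?b (pure v s) (?e e) \<odot>\<^bsub>\<T>\<^esub> ?e (g e)) \<in> B \<rightarrow> carrier \<T>"
        using pure by (auto simp: bb BM gM)
      show "pure (b v e \<odot>\<^bsub>M\<^esub> g e) s = ?b (pure v s) (?e e) \<odot>\<^bsub>\<T>\<^esub> ?e (g e)" if "e \<in> B" for e
        using that pure by (simp add: form_ext_pure[OF b] smult_pure pure_smult BM gM bc)
    qed simp
    finally show ?case by simp
  next
    case (add \<xi> \<eta>)
    then show ?case by (simp add: sum_add BM)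
  qed
  \<comment> \<open>The expansion with each e \<otimes> 1 replaced by its image under \<phi>. For an
    isometry the coefficients of \<psi> (\<phi> \<eta>) are those of the expansion of \<eta>, so
    \<psi> \<phi> is the identity.\<close>
  define \<psi> where "\<psi> \<eta> = (\<Oplus>\<^bsub>\<T>\<^esub>e\<in>B. ?b \<eta> (\<phi> (?e e)) \<odot>\<^bsub>\<T>\<^esub> ?e (g e))" for \<eta>
  have \<psi>: "\<psi> \<in> module_hom R \<T> \<T>"
  proof (rule module_homI)
    show "\<psi> \<xi> \<in> carrier \<T>" if "\<xi> \<in> carrier \<T>" for \<xi>
      unfolding \<psi>_def using that by (auto intro!: T.finsum_closed simp: bb \<phi>m BM gM)
    show "\<psi> (\<xi> \<oplus>\<^bsub>\<T>\<^esub> \<eta>) = \<psi> \<xi> \<oplus>\<^bsub>\<T>\<^esub> \<psi> \<eta>" if "\<xi> \<in> carrier \<T>" "\<eta> \<in> carrier \<T>" for \<xi> \<eta>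
      unfolding \<psi>_def using that by (intro sum_add) (auto simp: \<phi>m BM)
    show "\<psi> (r \<odot>\<^bsub>\<T>\<^esub> \<xi>) = r \<odot>\<^bsub>\<T>\<^esub> \<psi> \<xi>" if "r \<in> carrier R" "\<xi> \<in> carrier \<T>" for r \<xi>
    proof -
      have "r \<odot>\<^bsub>\<T>\<^esub> \<psi> \<xi> = (\<Oplus>\<^bsub>\<T>\<^esub>e\<in>B. r \<odot>\<^bsub>\<T>\<^esub> (?b \<xi> (\<phi> (?e e)) \<odot>\<^bsub>\<T>\<^esub> ?e (g e)))"
        unfolding \<psi>_def using that B(1)
        by (intro additive_map_finsum[OF abelian_group_scalar_ext abelian_group_scalar_ext smult_additive])
           (auto simp: bb \<phi>m BM gM)
      also have "\<dots> = \<psi> (r \<odot>\<^bsub>\<T>\<^esub> \<xi>)"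
        unfolding \<psi>_def using that
        by (intro T.finsum_cong') (auto simp: bb \<phi>m BM gM T.smult_assoc1)
      finally show ?thesis by simp
    qed
  qed
  have \<psi>\<phi>: "\<psi> (\<phi> \<eta>) = \<eta>" if "\<eta> \<in> carrier \<T>" for \<eta>
  proof -
    have "\<psi> (\<phi> \<eta>) = (\<Oplus>\<^bsub>\<T>\<^esub>e\<in>B. ?b \<eta> (?e e) \<odot>\<^bsub>\<T>\<^esub> ?e (g e))"
      unfolding \<psi>_def using that by (intro T.finsum_cong') (auto simp: isom bb BM gM)
    then show ?thesis using expand[OF that] by simp
  qed
  have inj: "inj_on \<psi> (carrier \<T>)"
  proof (rule surjective_endomorphism_injective[OF module_scalar_ext \<psi>])
    show "\<psi> ` carrier \<T> = carrier \<T>"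
      using \<psi>\<phi> \<phi>m(1) module_hom_mem[OF \<psi>] by (auto simp: image_iff)
    show "finite ((\<lambda>e. ?e (g e)) ` B)" using B(1) by simp
    show "(\<lambda>e. ?e (g e)) ` B \<subseteq> carrier \<T>" using gM by auto
    fix N assume N: "LinearCombinations.submodule R N \<T>" "(\<lambda>e. ?e (g e)) ` B \<subseteq> N"
    note NS = LinearCombinations.submodule.subset[OF N(1)] LinearCombinations.submodule.m_closed[OF N(1)]
      LinearCombinations.submodule.zero_closed[OF N(1)] LinearCombinations.submodule.smult_closed[OF N(1)]
    have "(\<Oplus>\<^bsub>\<T>\<^esub>e\<in>A. c e \<odot>\<^bsub>\<T>\<^esub> ?e (g e)) \<in> N" if "finite A" "A \<subseteq> B" "c \<in> A \<rightarrow> carrier R" for c A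
      using that
    proof (induction A)
      case empty
      then show ?case using NS(3) by simp
    next
      case (insert a A)
      have "(\<Oplus>\<^bsub>\<T>\<^esub>e\<in>insert a A. c e \<odot>\<^bsub>\<T>\<^esub> ?e (g e)) =
          c a \<odot>\<^bsub>\<T>\<^esub> ?e (g a) \<oplus>\<^bsub>\<T>\<^esub> (\<Oplus>\<^bsub>\<T>\<^esub>e\<in>A. c e \<odot>\<^bsub>\<T>\<^esub> ?e (g e))"
        using insert by (intro T.finsum_insert) (auto simp: gM Pi_def subset_iff)
      moreover have "?e (g a) \<in> N" using N(2) insert.prems(1) by auto
      ultimately show ?case using insert NS(2,4) by (auto simp: Pi_def)
    qed
    note sum_in_N = this
    \<comment> \<open>\<open>expand\<close> writes each \<eta> as an R-combination of the vectors
      g(e) \<otimes> 1, so these generate V_R.\<close>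
    have "\<eta> \<in> N" if "\<eta> \<in> carrier \<T>" for \<eta>
    proof -
      have "(\<lambda>e. ?b \<eta> (?e e)) \<in> B \<rightarrow> carrier R" using that by (auto simp: bb BM)
      from sum_in_N[OF B(1) subset_refl this] show ?thesis unfolding expand[OF that] .
    qed
    then show "N = carrier \<T>" using NS(1) by blast
  qed
  \<comment> \<open>Applying \<psi> to both sides gives \<psi> \<eta>, since \<psi> \<phi> is the
    identity. Injectivity of \<psi> cancels it.\<close>
  have \<phi>\<psi>: "\<phi> (\<psi> \<eta>) = \<eta>" if "\<eta> \<in> carrier \<T>" for \<eta>
    by (rule inj_onD[OF inj])
       (use that in \<open>simp_all add: \<psi>\<phi> \<phi>m(1) module_hom_mem[OF \<psi>]\<close>)
  show ?thesis
  proof (rule Units_End_algI[OF module_scalar_ext \<phi>])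
    show "restrict \<psi> (carrier \<T>) \<in> carrier (End_alg R \<T>)"
      by (rule End_algI)
         (simp_all add: module_hom_mem[OF \<psi>] module_hom_add[OF \<psi>] module_hom_smult[OF \<psi>])
  qed (simp_all add: \<phi>m \<psi>\<phi> \<phi>\<psi>)
qed

end

context algebra_morphism
begin

lemma base_change_hom_Aut_X:
  assumes X: "X \<in> module_hom F M M"
  shows "base_change F M R S f \<in> hom (Aut_X_fun F M X R) (Aut_X_fun F M X S)"
proof (rule homI)
  fix \<phi> assume "\<phi> \<in> carrier (Aut_X_fun F M X R)"
  then have \<phi>: "\<phi> \<in> Units (End_alg R VR.\<T>)"
    "\<And>\<xi>. \<xi> \<in> carrier VR.\<T> \<Longrightarrow> \<phi> (linear_ext F M R X \<xi>) = linear_ext F M R X (\<phi> \<xi>)"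
    by (auto simp: VR.Aut_X_fun_mem VR.carrier_GL_fun)
  show "base_change F M R S f \<phi> \<in> carrier (Aut_X_fun F M X S)"
    using base_change_Units[OF \<phi>(1)] base_change_commute[OF X Units_End_algD[OF \<phi>(1)] \<phi>(2)]
    by (simp add: VS.Aut_X_fun_mem VS.carrier_GL_fun)
  fix \<phi>' assume "\<phi>' \<in> carrier (Aut_X_fun F M X R)"
  then have "\<phi>' \<in> Units (End_alg R VR.\<T>)" by (auto simp: VR.Aut_X_fun_mem VR.carrier_GL_fun)
  then show "base_change F M R S f (\<phi> \<otimes>\<^bsub>Aut_X_fun F M X R\<^esub> \<phi>') =
      base_change F M R S f \<phi> \<otimes>\<^bsub>Aut_X_fun F M X S\<^esub> base_change F M R S f \<phi>'"
    using base_change_compose[OF Units_End_algD[OF \<phi>(1)] Units_End_algD]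
    by (simp add: VR.mult_Aut_X_fun VS.mult_Aut_X_fun)
qed

lemma base_change_hom_Aut_Xb:
  assumes X: "X \<in> module_hom F M M" and b: "bilinear_map F M (regular_module F) b"
  shows "base_change F M R S f \<in> hom (Aut_Xb_fun F M X b R) (Aut_Xb_fun F M X b S)"
proof (rule homI)
  fix \<phi> assume \<phi>: "\<phi> \<in> carrier (Aut_Xb_fun F M X b R)"
  then have \<phi>X: "\<phi> \<in> carrier (Aut_X_fun F M X R)" and \<phi>O: "\<phi> \<in> carrier (O_fun F M b R)"
    by (auto simp: Aut_Xb_fun_def)
  have \<phi>E: "\<phi> \<in> carrier (End_alg R VR.\<T>)" and
    pres: "\<And>\<xi> \<eta>. \<xi> \<in> carrier VR.\<T> \<Longrightarrow> \<eta> \<in> carrier VR.\<T> \<Longrightarrow>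
      form_ext F M R b (\<phi> \<xi>) (\<phi> \<eta>) = form_ext F M R b \<xi> \<eta>"
    using \<phi>O Units_End_algD[of \<phi>] by (auto simp: VR.O_fun_mem VR.carrier_GL_fun simp del: carrier_End_alg)
  have bX: "base_change F M R S f \<phi> \<in> carrier (Aut_X_fun F M X S)"
    using hom_in_carrier[OF base_change_hom_Aut_X[OF X] \<phi>X] .
  moreover have "base_change F M R S f \<phi> \<in> carrier (O_fun F M b S)"
    using bX base_change_form_ext[OF b \<phi>E pres] by (simp add: VS.O_fun_mem VS.Aut_X_fun_mem)
  ultimately show "base_change F M R S f \<phi> \<in> carrier (Aut_Xb_fun F M X b S)"
    by (simp add: Aut_Xb_fun_def)
  fix \<phi>' assume "\<phi>' \<in> carrier (Aut_Xb_fun F M X b R)"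
  then have "\<phi>' \<in> carrier (Aut_X_fun F M X R)" by (simp add: Aut_Xb_fun_def)
  then show "base_change F M R S f (\<phi> \<otimes>\<^bsub>Aut_Xb_fun F M X b R\<^esub> \<phi>') =
      base_change F M R S f \<phi> \<otimes>\<^bsub>Aut_Xb_fun F M X b S\<^esub> base_change F M R S f \<phi>'"
    using hom_mult[OF base_change_hom_Aut_X[OF X] \<phi>X]
    by (simp add: VR.mult_Aut_X_fun VS.mult_Aut_X_fun VR.mult_Aut_Xb_fun VS.mult_Aut_Xb_fun)
qed

end

section \<open>Cross products\<close>

locale cross_product = V: vectorspace F V for F (structure) and V +
  fixes b X
  assumes char_not_2: "\<one> \<oplus> \<one> \<noteq> \<zero>"
    and symmetric: "symmetric_bilinear_form F V b"
    and nondeg: "nondegenerate V (regular_module F) b"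
    and cross: "one_fold_cross_product F V b X"
begin

lemma bilinear: "bilinear_map F V (regular_module F) b"
  using symmetric by (simp add: symmetric_bilinear_form_def)

lemma b_sym: "u \<in> carrier V \<Longrightarrow> v \<in> carrier V \<Longrightarrow> b u v = b v u"
  using symmetric by (simp add: symmetric_bilinear_form_def)

lemma b_left: "v \<in> carrier V \<Longrightarrow> (\<lambda>u. b u v) \<in> module_hom F V (regular_module F)"
  using bilinear by (simp add: bilinear_map_def)

lemma b_closed [simp]: "u \<in> carrier V \<Longrightarrow> v \<in> carrier V \<Longrightarrow> b u v \<in> carrier F"
  using module_hom_mem[OF b_left] by (simp add: regular_module_def)

lemma b_add_left:
  "u \<in> carrier V \<Longrightarrow> v \<in> carrier V \<Longrightarrow> w \<in> carrier V \<Longrightarrow> b (u \<oplus>\<^bsub>V\<^esub> v) w = b u w \<oplus> b v w"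
  using module_hom_add[OF b_left] by (simp add: regular_module_def)

lemma b_smult_left:
  "a \<in> carrier F \<Longrightarrow> u \<in> carrier V \<Longrightarrow> w \<in> carrier V \<Longrightarrow> b (a \<odot>\<^bsub>V\<^esub> u) w = a \<otimes> b u w"
  using module_hom_smult[OF b_left] by (simp add: regular_module_def)

lemma b_add_right:
  "u \<in> carrier V \<Longrightarrow> v \<in> carrier V \<Longrightarrow> w \<in> carrier V \<Longrightarrow> b w (u \<oplus>\<^bsub>V\<^esub> v) = b w u \<oplus> b w v"
  using b_add_left by (simp add: b_sym[of w])

lemma b_smult_right:
  "a \<in> carrier F \<Longrightarrow> u \<in> carrier V \<Longrightarrow> w \<in> carrier V \<Longrightarrow> b w (a \<odot>\<^bsub>V\<^esub> u) = a \<otimes> b w u"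
  using b_smult_left by (simp add: b_sym[of w])

lemma nondegD: "u \<in> carrier V \<Longrightarrow> (\<And>v. v \<in> carrier V \<Longrightarrow> b u v = \<zero>) \<Longrightarrow> u = \<zero>\<^bsub>V\<^esub>"
  using nondeg by (simp add: nondegenerate_def regular_module_def)

lemma X_End: "X \<in> carrier (End_alg F V)"
  using cross by (simp add: one_fold_cross_product_def)

lemma X_hom: "X \<in> module_hom F V V"
  using X_End by simp

lemma X_closed [simp]: "v \<in> carrier V \<Longrightarrow> X v \<in> carrier V"
  using module_hom_mem[OF X_hom] .

lemmas X_add = module_hom_add[OF X_hom]
lemmas X_smult = module_hom_smult[OF X_hom]

lemma b_X_self: "v \<in> carrier V \<Longrightarrow> b (X v) v = \<zero>" "v \<in> carrier V \<Longrightarrow> b (X v) (X v) = b v v"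
  using cross by (simp_all add: one_fold_cross_product_def)

text \<open>Polarizing a quadratic identity of a symmetric form yields twice the desired bilinear
  one. The factor is removed here, which is where the characteristic enters.\<close>

lemma double_eq_zero:
  assumes "x \<in> carrier F" "x \<oplus> x = \<zero>"
  shows "x = \<zero>"
proof -
  have "(\<one> \<oplus> \<one>) \<otimes> x = \<zero>" using assms by (simp add: V.R.l_distr)
  then show ?thesis using V.integral[of "\<one> \<oplus> \<one>" x] assms(1) char_not_2 by auto
qed

text \<open>Polarization of b(X v, v) = 0 at u + v. The two mixed terms are distinct, so no division
  by two occurs.\<close>

lemma b_X_skew:
  assumes u: "u \<in> carrier V" and v: "v \<in> carrier V"
  shows "b (X u) v = \<ominus> b u (X v)"
proof -
  have "b (X (u \<oplus>\<^bsub>V\<^esub> v)) (u \<oplus>\<^bsub>V\<^esub> v) = \<zero>" using u v by (simp add: b_X_self)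
  then have "b (X u) v \<oplus> b (X v) u = \<zero>"
    using u v by (simp add: X_add b_add_left b_add_right b_X_self V.R.a_comm)
  then show ?thesis using u v by (simp add: V.R.minus_equality b_sym[of u "X v"])
qed

lemma b_X_X:
  assumes u: "u \<in> carrier V" and v: "v \<in> carrier V"
  shows "b (X u) (X v) = b u v"
proof -
  have "b (X (u \<oplus>\<^bsub>V\<^esub> v)) (X (u \<oplus>\<^bsub>V\<^esub> v)) = b (u \<oplus>\<^bsub>V\<^esub> v) (u \<oplus>\<^bsub>V\<^esub> v)" using u v by (simp add: b_X_self)
  \<comment> \<open>The polarization of b(X v, X v) = b(v, v) at u + v, bracketed so that the
    diagonal terms b(u, u) and b(v, v) cancel in turn. Twice the claim is left.\<close>
  then have "b u u \<oplus> (b (X u) (X v) \<oplus> (b (X u) (X v) \<oplus> b v v)) = b u u \<oplus> (b u v \<oplus> (b u v \<oplus> b v v))"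
    using u v by (simp add: X_add b_add_left b_add_right b_X_self b_sym[of "X v" "X u"] b_sym[of v u] V.R.a_assoc)
  then have "b (X u) (X v) \<oplus> (b (X u) (X v) \<oplus> b v v) = b u v \<oplus> (b u v \<oplus> b v v)"
    using u v by simp
  then have "(b (X u) (X v) \<oplus> b (X u) (X v)) \<oplus> b v v = (b u v \<oplus> b u v) \<oplus> b v v"
    using u v by (simp add: V.R.a_assoc)
  then have d: "b (X u) (X v) \<oplus> b (X u) (X v) = b u v \<oplus> b u v"
    using u v by simp
  have "(b (X u) (X v) \<ominus> b u v) \<oplus> (b (X u) (X v) \<ominus> b u v)
      = (b (X u) (X v) \<oplus> b (X u) (X v)) \<ominus> (b u v \<oplus> b u v)"
    using u v by (simp add: V.R.minus_eq V.R.minus_add V.R.a_ac)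
  also have "\<dots> = \<zero>" unfolding d using u v by (simp add: V.R.minus_eq V.R.r_neg)
  finally have dd: "(b (X u) (X v) \<ominus> b u v) \<oplus> (b (X u) (X v) \<ominus> b u v) = \<zero>" .
  have "b (X u) (X v) \<ominus> b u v = \<zero>" by (rule double_eq_zero[OF _ dd]) (use u v in simp)
  then show ?thesis using u v by simp
qed

text \<open>For every w, skewness and the isometry property give b(X (X v), w) = -b(X v, X w) =
  -b(v, w). Nondegeneracy removes w.\<close>

lemma X_X:
  assumes v: "v \<in> carrier V"
  shows "X (X v) = \<ominus>\<^bsub>V\<^esub> v"
proof -
  have "X (X v) \<oplus>\<^bsub>V\<^esub> v = \<zero>\<^bsub>V\<^esub>"
  proof (rule nondegD)
    show "b (X (X v) \<oplus>\<^bsub>V\<^esub> v) w = \<zero>" if "w \<in> carrier V" for w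
      using v that by (simp add: b_add_left b_X_skew[of "X v" w] b_X_X V.R.l_neg)
  qed (use v in simp)
  then show ?thesis using v by (metis V.M.minus_equality X_closed)
qed

text \<open>If b(u, u) vanished for all u, polarization would make b zero, against nondegeneracy on
  a nonzero space. Such a vector serves to read off the coordinates of elements of K.\<close>

lemma anisotropic_vector_exists:
  assumes "carrier V \<noteq> {\<zero>\<^bsub>V\<^esub>}"
  obtains u where "u \<in> carrier V" "b u u \<noteq> \<zero>"
proof (rule ccontr)
  assume "\<not> thesis"
  then have z: "b u u = \<zero>" if "u \<in> carrier V" for u using that \<open>\<And>u. u \<in> carrier V \<Longrightarrow> b u u \<noteq> \<zero> \<Longrightarrow> thesis\<close> by blast
  have "u = \<zero>\<^bsub>V\<^esub>" if u: "u \<in> carrier V" for u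
  proof (rule nondegD[OF u])
    fix v assume v: "v \<in> carrier V"
    have "b (u \<oplus>\<^bsub>V\<^esub> v) (u \<oplus>\<^bsub>V\<^esub> v) = \<zero>" using z u v by simp
    then have "b u v \<oplus> b u v = \<zero>"
      using u v z[OF u] z[OF v] by (simp add: b_add_left b_add_right b_sym[of v u])
    then show "b u v = \<zero>" by (rule double_eq_zero[OF b_closed[OF u v]])
  qed
  then show False using assms V.M.zero_closed by blast
qed

section \<open>Coordinates on the algebra K\<close>

definition kel where
  "kel a c = (\<lambda>v\<in>carrier V. a \<odot>\<^bsub>V\<^esub> v \<oplus>\<^bsub>V\<^esub> c \<odot>\<^bsub>V\<^esub> X v)"

abbreviation "K \<equiv> cross_algebra F V X"

lemma kel_End: "a \<in> carrier F \<Longrightarrow> c \<in> carrier F \<Longrightarrow> kel a c \<in> carrier (End_alg F V)"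
  unfolding kel_def
  by (rule End_algI)
     (simp_all add: X_add X_smult V.smult_r_distr V.M.a_ac V.smult_left_commute[of a] V.smult_left_commute[of c])

lemma kel_apply: "v \<in> carrier V \<Longrightarrow> kel a c v = a \<odot>\<^bsub>V\<^esub> v \<oplus>\<^bsub>V\<^esub> c \<odot>\<^bsub>V\<^esub> X v"
  by (simp add: kel_def)

lemma kel_End_alg:
  "a \<odot>\<^bsub>End_alg F V\<^esub> \<one>\<^bsub>End_alg F V\<^esub> \<oplus>\<^bsub>End_alg F V\<^esub> c \<odot>\<^bsub>End_alg F V\<^esub> X = kel a c"
  by (simp add: kel_def fun_eq_iff)

lemma kel_End_alg_minus:
  assumes "a \<in> carrier F" "c \<in> carrier F"
  shows "a \<odot>\<^bsub>End_alg F V\<^esub> \<one>\<^bsub>End_alg F V\<^esub> \<ominus>\<^bsub>End_alg F V\<^esub> c \<odot>\<^bsub>End_alg F V\<^esub> X = kel a (\<ominus> c)"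
proof -
  interpret E: module F "End_alg F V" by (rule module_End_alg[OF V.module_axioms])
  have "\<ominus>\<^bsub>End_alg F V\<^esub> (c \<odot>\<^bsub>End_alg F V\<^esub> X) = (\<ominus> c) \<odot>\<^bsub>End_alg F V\<^esub> X"
    using E.smult_l_minus[OF assms(2) X_End] by simp
  then show ?thesis
    unfolding a_minus_def[of "End_alg F V"] using kel_End_alg[of a "\<ominus> c"] by simp
qed

lemma carrier_K: "carrier K = {kel a c | a c. a \<in> carrier F \<and> c \<in> carrier F}"
  unfolding cross_algebra_def kel_End_alg by simp

lemma kel_in_K [simp]: "a \<in> carrier F \<Longrightarrow> c \<in> carrier F \<Longrightarrow> kel a c \<in> carrier K"
  unfolding carrier_K by blast

lemma K_cases:
  assumes "k \<in> carrier K"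
  obtains a c where "a \<in> carrier F" "c \<in> carrier F" "k = kel a c"
  using assms unfolding carrier_K by blast

lemma K_ops:
  "mult K = compose (carrier V)" "\<one>\<^bsub>K\<^esub> = (\<lambda>v\<in>carrier V. v)" "\<zero>\<^bsub>K\<^esub> = (\<lambda>v\<in>carrier V. \<zero>\<^bsub>V\<^esub>)"
  "f \<oplus>\<^bsub>K\<^esub> g = (\<lambda>v\<in>carrier V. f v \<oplus>\<^bsub>V\<^esub> g v)" "a \<odot>\<^bsub>K\<^esub> f = (\<lambda>v\<in>carrier V. a \<odot>\<^bsub>V\<^esub> f v)"
  by (simp_all add: cross_algebra_def End_alg_def)

lemma kel_add:
  assumes "a \<in> carrier F" "c \<in> carrier F" "a' \<in> carrier F" "c' \<in> carrier F"
  shows "kel a c \<oplus>\<^bsub>K\<^esub> kel a' c' = kel (a \<oplus> a') (c \<oplus> c')"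
  using assms by (auto simp: K_ops kel_def fun_eq_iff V.smult_l_distr V.M.a_ac)

lemma kel_smult:
  assumes "r \<in> carrier F" "a \<in> carrier F" "c \<in> carrier F"
  shows "r \<odot>\<^bsub>K\<^esub> kel a c = kel (r \<otimes> a) (r \<otimes> c)"
  using assms by (auto simp: K_ops kel_def fun_eq_iff V.smult_r_distr V.smult_assoc1)

lemma K_zero: "\<zero>\<^bsub>K\<^esub> = kel \<zero> \<zero>"
  by (auto simp: K_ops kel_def fun_eq_iff)

lemma K_one: "\<one>\<^bsub>K\<^esub> = kel \<one> \<zero>"
  by (auto simp: K_ops kel_def fun_eq_iff)

lemma X_eq_kel: "X = kel \<zero> \<one>"
  by (rule extensionalityI[of _ "carrier V"]) (use X_End in \<open>simp_all add: kel_def\<close>)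

text \<open>The sign comes from X^2 = -id, which makes X act on the pair of coordinates as a quarter
  turn.\<close>

lemma X_mult_kel:
  assumes "a \<in> carrier F" "c \<in> carrier F"
  shows "X \<otimes>\<^bsub>K\<^esub> kel a c = kel (\<ominus> c) a"
  using assms
  by (auto simp: K_ops kel_def fun_eq_iff compose_def X_add X_smult X_X V.smult_r_minus V.smult_l_minus V.M.a_comm)

lemma module_K: "module F K"
proof (rule moduleI[OF V.R.is_cring])
  show "abelian_group K"
  proof (rule abelian_groupI)
    fix x assume "x \<in> carrier K"
    then obtain a c where x: "a \<in> carrier F" "c \<in> carrier F" "x = kel a c" by (rule K_cases)
    then show "\<zero>\<^bsub>K\<^esub> \<oplus>\<^bsub>K\<^esub> x = x" by (simp add: K_zero kel_add)
    have "kel (\<ominus> a) (\<ominus> c) \<oplus>\<^bsub>K\<^esub> x = \<zero>\<^bsub>K\<^esub>" using x by (simp add: K_zero kel_add V.R.l_neg)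
    then show "\<exists>y\<in>carrier K. y \<oplus>\<^bsub>K\<^esub> x = \<zero>\<^bsub>K\<^esub>" using x by (metis kel_in_K V.R.a_inv_closed)
    fix y assume "y \<in> carrier K"
    then obtain a' c' where y: "a' \<in> carrier F" "c' \<in> carrier F" "y = kel a' c'" by (rule K_cases)
    show "x \<oplus>\<^bsub>K\<^esub> y \<in> carrier K" using x y by (simp add: kel_add)
    show "x \<oplus>\<^bsub>K\<^esub> y = y \<oplus>\<^bsub>K\<^esub> x" using x y by (simp add: kel_add V.R.a_comm)
    fix z assume "z \<in> carrier K"
    then obtain a'' c'' where z: "a'' \<in> carrier F" "c'' \<in> carrier F" "z = kel a'' c''" by (rule K_cases)
    show "x \<oplus>\<^bsub>K\<^esub> y \<oplus>\<^bsub>K\<^esub> z = x \<oplus>\<^bsub>K\<^esub> (y \<oplus>\<^bsub>K\<^esub> z)" using x y z by (simp add: kel_add V.R.a_assoc)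
  qed (simp add: K_zero)
  fix r x assume r: "r \<in> carrier F" and "x \<in> carrier K"
  then obtain a c where x: "a \<in> carrier F" "c \<in> carrier F" "x = kel a c" by (auto elim: K_cases)
  show "r \<odot>\<^bsub>K\<^esub> x \<in> carrier K" using r x by (simp add: kel_smult)
  fix s assume s: "s \<in> carrier F"
  show "(r \<oplus> s) \<odot>\<^bsub>K\<^esub> x = r \<odot>\<^bsub>K\<^esub> x \<oplus>\<^bsub>K\<^esub> s \<odot>\<^bsub>K\<^esub> x"
    "(r \<otimes> s) \<odot>\<^bsub>K\<^esub> x = r \<odot>\<^bsub>K\<^esub> (s \<odot>\<^bsub>K\<^esub> x)"
    using r s x by (simp_all add: kel_smult kel_add V.R.l_distr V.R.m_assoc)
next
  fix r x y assume r: "r \<in> carrier F" and "x \<in> carrier K" "y \<in> carrier K"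
  then obtain a c a' c' where "a \<in> carrier F" "c \<in> carrier F" "x = kel a c"
    "a' \<in> carrier F" "c' \<in> carrier F" "y = kel a' c'" by (metis K_cases)
  then show "r \<odot>\<^bsub>K\<^esub> (x \<oplus>\<^bsub>K\<^esub> y) = r \<odot>\<^bsub>K\<^esub> x \<oplus>\<^bsub>K\<^esub> r \<odot>\<^bsub>K\<^esub> y"
    using r by (simp add: kel_smult kel_add V.R.r_distr)
next
  fix x assume "x \<in> carrier K"
  then obtain a c where "a \<in> carrier F" "c \<in> carrier F" "x = kel a c" by (rule K_cases)
  then show "\<one> \<odot>\<^bsub>K\<^esub> x = x" by (simp add: kel_smult)
qed

abbreviation "h \<equiv> cross_hermitian F V b X"

lemma h_eq_kel:
  "u \<in> carrier V \<Longrightarrow> v \<in> carrier V \<Longrightarrow> h u v = kel (b u v) (\<ominus> b (X u) v)"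
  unfolding cross_hermitian_def by (rule kel_End_alg_minus) simp_all

text \<open>X u is orthogonal to u and has the same norm, so pairing with u and with X u isolates
  the two coordinates up to the factor b(u, u). For anisotropic u they are therefore determined by
  the element.\<close>

lemma b_kel_self:
  assumes "u \<in> carrier V" "a \<in> carrier F" "c \<in> carrier F"
  shows "b (kel a c u) u = a \<otimes> b u u" "b (kel a c u) (X u) = c \<otimes> b u u"
  using assms by (simp_all add: kel_apply b_add_left b_smult_left b_X_self b_sym[of u "X u"])

lemma kel_eqD:
  assumes "carrier V \<noteq> {\<zero>\<^bsub>V\<^esub>}" "kel a c = kel a' c'"
    "a \<in> carrier F" "c \<in> carrier F" "a' \<in> carrier F" "c' \<in> carrier F"
  shows "a = a'" "c = c'"
proof -
  obtain u where u: "u \<in> carrier V" "b u u \<noteq> \<zero>" using anisotropic_vector_exists[OF assms(1)] .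
  have "a \<otimes> b u u = a' \<otimes> b u u" "c \<otimes> b u u = c' \<otimes> b u u"
    using b_kel_self[of u] u(1) assms by metis+
  then show "a = a'" "c = c'" using u assms(3-6) V.m_rcancel by auto
qed

lemma cross_conj_kel:
  assumes "a \<in> carrier F" "c \<in> carrier F"
  shows "cross_conj F V X (kel a c) = kel a (\<ominus> c)"
proof -
  let ?P = "\<lambda>k'. \<exists>a'\<in>carrier F. \<exists>c'\<in>carrier F. kel a c = kel a' c' \<and> k' = kel a' (\<ominus> c')"
  have "cross_conj F V X (kel a c) = (THE k'. ?P k')"
    unfolding cross_conj_def kel_End_alg
    by (intro arg_cong[of _ _ The] ext) (metis kel_End_alg_minus)
  also have "\<dots> = kel a (\<ominus> c)"
  proof (rule the_equality)
    show "?P (kel a (\<ominus> c))" using assms by blast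
    fix k' assume "?P k'"
    then obtain a' c' where k': "a' \<in> carrier F" "c' \<in> carrier F" "kel a c = kel a' c'" "k' = kel a' (\<ominus> c')"
      by blast
    show "k' = kel a (\<ominus> c)"
    proof (cases "carrier V = {\<zero>\<^bsub>V\<^esub>}")
      \<comment> \<open>On the zero space the coordinates are not unique, but every choice gives the
        same map.\<close>
      case True
      have z: "X \<zero>\<^bsub>V\<^esub> = \<zero>\<^bsub>V\<^esub>" using X_closed[of "\<zero>\<^bsub>V\<^esub>"] True by simp
      show ?thesis using True z k' assms by (auto simp: kel_def fun_eq_iff)
    next
      case False
      show ?thesis using kel_eqD[OF False k'(3)] k' assms by simp
    qed
  qed
  finally show ?thesis .
qed

text \<open>The coefficient of id as a linear functional on K: k is sent to b(k u, u) / b(u, u) for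
  an anisotropic u. If V = 0 there is no such u; then b is zero and so is p.\<close>

lemma K_projection:
  obtains p where "p \<in> module_hom F K (regular_module F)"
    "\<And>u v. u \<in> carrier V \<Longrightarrow> v \<in> carrier V \<Longrightarrow> p (h u v) = b u v"
proof (cases "carrier V = {\<zero>\<^bsub>V\<^esub>}")
  case True
  have b0: "b \<zero>\<^bsub>V\<^esub> \<zero>\<^bsub>V\<^esub> = \<zero>" using b_smult_left[of \<zero> "\<zero>\<^bsub>V\<^esub>" "\<zero>\<^bsub>V\<^esub>"] by simp
  show thesis
  proof (rule that[of "\<lambda>_. \<zero>"])
    show "(\<lambda>_. \<zero>) \<in> module_hom F K (regular_module F)"
      by (rule module_homI) (simp_all add: regular_module_def)
    show "\<zero> = b u v" if "u \<in> carrier V" "v \<in> carrier V" for u v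
      using that b0 unfolding True by simp
  qed
next
  case False
  obtain u where u: "u \<in> carrier V" "b u u \<noteq> \<zero>" using anisotropic_vector_exists[OF False] .
  have inv: "inv b u u \<in> carrier F" "b u u \<otimes> inv b u u = \<one>"
    using u V.field_Units by (auto intro: V.R.Units_inv_closed V.R.Units_r_inv)
  define p where "p k = b (k u) u \<otimes> inv b u u" for k
  have pk: "p (kel a c) = a" if "a \<in> carrier F" "c \<in> carrier F" for a c
    using that u inv by (simp add: p_def b_kel_self V.R.m_assoc)
  show thesis
  proof
    show "p \<in> module_hom F K (regular_module F)"
    proof (rule module_homI)
      fix x assume "x \<in> carrier K"
      then obtain a c where x: "a \<in> carrier F" "c \<in> carrier F" "x = kel a c" by (rule K_cases)
      then show "p x \<in> carrier (regular_module F)" by (simp add: pk regular_module_def)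
      show "p (r \<odot>\<^bsub>K\<^esub> x) = r \<odot>\<^bsub>regular_module F\<^esub> p x" if "r \<in> carrier F" for r
        using that x by (simp add: pk kel_smult regular_module_def)
      fix y assume "y \<in> carrier K"
      then obtain a' c' where y: "a' \<in> carrier F" "c' \<in> carrier F" "y = kel a' c'" by (rule K_cases)
      show "p (x \<oplus>\<^bsub>K\<^esub> y) = p x \<oplus>\<^bsub>regular_module F\<^esub> p y"
        using x y by (simp add: pk kel_add regular_module_def)
    qed
    show "p (h u v) = b u v" if "u \<in> carrier V" "v \<in> carrier V" for u v
      using that by (simp add: h_eq_kel pk)
  qed
qed

lemma hermitian_cross_hermitian: "hermitian_form F V X h"
proof -
  have bil: "bilinear_map F V K h"
    unfolding bilinear_map_def
    by (intro conjI ballI module_homI)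
       (simp_all add: h_eq_kel kel_add kel_smult b_add_left b_add_right b_smult_left b_smult_right
         X_add X_smult V.R.minus_add V.R.r_minus)
  moreover have "h (X u) v = X \<otimes>\<^bsub>K\<^esub> h u v" "h u v = cross_conj F V X (h v u)"
    if uv: "u \<in> carrier V" "v \<in> carrier V" for u v
  proof -
    \<comment> \<open>This identifies the X-coordinate of h(X u, v) as b(u, v). Left multiplication
      of h(u, v) by X produces the same pair of coordinates.\<close>
    have "\<ominus> b (X (X u)) v = b u v"
      unfolding b_X_skew[OF X_closed[OF uv(1)] uv(2)] b_X_X[OF uv] using uv by simp
    then show "h (X u) v = X \<otimes>\<^bsub>K\<^esub> h u v" using uv by (simp add: h_eq_kel X_mult_kel)
    \<comment> \<open>Exchanging u and v keeps the id-coordinate of h and reverses the sign of the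
      X-coordinate, which is the effect of the involution.\<close>
    have "b (X v) u = \<ominus> b (X u) v"
      unfolding b_X_skew[OF uv] b_sym[OF X_closed[OF uv(2)] uv(1)] using uv by simp
    then show "h u v = cross_conj F V X (h v u)"
      using uv b_sym[OF uv] by (simp add: h_eq_kel cross_conj_kel)
  qed
  ultimately show ?thesis unfolding hermitian_form_def by (intro conjI ballI)
qed

text \<open>Applying the projection p to h(u, v) = 0 gives b(u, v) = 0, so the radical of h lies in
  that of b.\<close>

lemma nondegenerate_cross_hermitian: "nondegenerate V K h"
  unfolding nondegenerate_def
proof (intro ballI impI)
  obtain p where p: "p \<in> module_hom F K (regular_module F)"
    "\<And>u v. u \<in> carrier V \<Longrightarrow> v \<in> carrier V \<Longrightarrow> p (h u v) = b u v" by (rule K_projection) blast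
  interpret K: module F K by (rule module_K)
  have p0: "p \<zero>\<^bsub>K\<^esub> = \<zero>"
    using module_hom_smult[OF p(1), of \<zero> "\<zero>\<^bsub>K\<^esub>"] module_hom_mem[OF p(1), of "\<zero>\<^bsub>K\<^esub>"]
    by (simp add: regular_module_def)
  fix u assume u: "u \<in> carrier V" and hu: "\<forall>v\<in>carrier V. h u v = \<zero>\<^bsub>K\<^esub>"
  show "u = \<zero>\<^bsub>V\<^esub>"
  proof (rule nondegD[OF u])
    show "b u v = \<zero>" if v: "v \<in> carrier V" for v
      unfolding p(2)[OF u v, symmetric] bspec[OF hu v] by (rule p0)
  qed
qed

end

section \<open>The action of K_R on V_R\<close>

locale cross_product_extension = cross_product F V b X + R: algebra F R
  for F (structure) and V and b and X and R
begin

sublocale VR: scalar_extension F V R ..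

sublocale KR: scalar_extension F K R
  by (intro scalar_extension.intro module_K R.algebra_axioms)

abbreviation "X\<^sub>R \<equiv> linear_ext F V R X"
abbreviation "b\<^sub>R \<equiv> form_ext F V R b"
abbreviation "h\<^sub>R \<equiv> bilinear_ext F V K R h"
abbreviation "KV \<equiv> cross_scalar_ext F V X R"

lemma cross_scalar_ext_simps [simp]:
  "carrier KV = carrier VR.\<T>" "add KV = add VR.\<T>" "\<zero>\<^bsub>KV\<^esub> = \<zero>\<^bsub>VR.\<T>\<^esub>"
  by (simp_all add: cross_scalar_ext_def)

lemma carrier_algebra_ext [simp]: "carrier (algebra_ext F K R) = carrier KR.\<T>"
  by (simp add: algebra_ext_def)

lemma
  shows act_additive_left: "\<xi> \<in> carrier VR.\<T> \<Longrightarrow> additive_map KR.\<T> VR.\<T> (\<lambda>\<kappa>. \<kappa> \<odot>\<^bsub>KV\<^esub> \<xi>)"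
    and act_additive_right: "\<kappa> \<in> carrier KR.\<T> \<Longrightarrow> additive_map VR.\<T> VR.\<T> (\<lambda>\<xi>. \<kappa> \<odot>\<^bsub>KV\<^esub> \<xi>)"
    and act_pure: "k \<in> carrier K \<Longrightarrow> r \<in> carrier R \<Longrightarrow> v \<in> carrier V \<Longrightarrow> s \<in> carrier R \<Longrightarrow>
      KR.pure k r \<odot>\<^bsub>KV\<^esub> VR.pure v s = VR.pure (k v) (r \<otimes>\<^bsub>R\<^esub> s)"
proof -
  have khom: "k \<in> module_hom F V V" if "k \<in> carrier K" for k
    using that K_cases kel_End by (metis IntD1 carrier_End_alg)
  note km = module_hom_mem[OF khom] module_hom_add[OF khom] module_hom_smult[OF khom]
  have t1: "balanced_map F V R VR.\<T> (\<lambda>v s. VR.pure (k v) (r \<otimes>\<^bsub>R\<^esub> s))"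
    if "k \<in> carrier K" "r \<in> carrier R" for k r
    by (rule balanced_mapI)
       (use that in \<open>simp_all add: km VR.pure_add_left VR.pure_add_right R.r_distr VR.pure_smult VR.smult_r_assoc\<close>)
  have t2: "balanced_map F K R VR.\<T> (\<lambda>k r. VR.pure (k v) (r \<otimes>\<^bsub>R\<^esub> s))"
    if "v \<in> carrier V" "s \<in> carrier R" for v s
    by (rule balanced_mapI)
       (use that in \<open>simp_all add: km K_ops VR.pure_add_left VR.pure_add_right R.l_distr VR.pure_smult R.smult_assoc2\<close>)
  note lift2 = KR.tensor_product_axioms VR.tensor_product_axioms VR.abelian_group_scalar_ext
    VR.additive_group_scalar_ext t1 t2
  have act: "\<kappa> \<odot>\<^bsub>KV\<^esub> \<xi> = tensor_lift2 F K R V R (tensor_group F V R)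
      (\<lambda>k r v s. VR.pure (k v) (r \<otimes>\<^bsub>R\<^esub> s)) \<kappa> \<xi>" for \<kappa> \<xi>
    by (simp add: cross_scalar_ext_def)
  show "\<xi> \<in> carrier VR.\<T> \<Longrightarrow> additive_map KR.\<T> VR.\<T> (\<lambda>\<kappa>. \<kappa> \<odot>\<^bsub>KV\<^esub> \<xi>)"
    unfolding act using tensor_lift2_additive_left[OF lift2] by simp
  show "\<kappa> \<in> carrier KR.\<T> \<Longrightarrow> additive_map VR.\<T> VR.\<T> (\<lambda>\<xi>. \<kappa> \<odot>\<^bsub>KV\<^esub> \<xi>)"
    unfolding act using tensor_lift2_additive_right[OF lift2] by simp
  show "k \<in> carrier K \<Longrightarrow> r \<in> carrier R \<Longrightarrow> v \<in> carrier V \<Longrightarrow> s \<in> carrier R \<Longrightarrow>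
      KR.pure k r \<odot>\<^bsub>KV\<^esub> VR.pure v s = VR.pure (k v) (r \<otimes>\<^bsub>R\<^esub> s)"
    unfolding act using tensor_lift2_pure[OF lift2] by simp
qed

text \<open>Expresses the action of pure tensors of K_R through scalars of R and X_R alone. Its
  special cases at 1 \<otimes> r and X \<otimes> 1 recover these two kinds of operator.\<close>

lemma act_kel:
  assumes ac: "a \<in> carrier F" "c \<in> carrier F" and r: "r \<in> carrier R" and \<xi>: "\<xi> \<in> carrier VR.\<T>"
  shows "KR.pure (kel a c) r \<odot>\<^bsub>KV\<^esub> \<xi> =
    (a \<odot>\<^bsub>R\<^esub> r) \<odot>\<^bsub>VR.\<T>\<^esub> \<xi> \<oplus>\<^bsub>VR.\<T>\<^esub> (c \<odot>\<^bsub>R\<^esub> r) \<odot>\<^bsub>VR.\<T>\<^esub> X\<^sub>R \<xi>"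
proof -
  have k: "KR.pure (kel a c) r \<in> carrier KR.\<T>" using ac r by simp
  from \<xi> show ?thesis
  proof (induction rule: VR.tensor_induct)
    case (pure v s)
    then show ?case
      using ac r by (simp add: act_pure kel_apply VR.linear_ext_pure[OF X_hom] VR.smult_pure
          VR.pure_add_left VR.pure_smult R.smult_assoc2)
  next
    case (add \<xi> \<eta>)
    then show ?case
      using ac r by (simp add: additive_map_add[OF act_additive_right[OF k]] VR.linear_ext_add[OF X_hom]
          VR.linear_ext_closed[OF X_hom] VR.T.smult_r_distr VR.T.a_ac)
  qed
qed

lemma act_one: "r \<in> carrier R \<Longrightarrow> \<xi> \<in> carrier VR.\<T> \<Longrightarrow> KR.pure \<one>\<^bsub>K\<^esub> r \<odot>\<^bsub>KV\<^esub> \<xi> = r \<odot>\<^bsub>VR.\<T>\<^esub> \<xi>"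
  by (simp add: K_one act_kel VR.linear_ext_closed[OF X_hom])

lemma act_X: "\<xi> \<in> carrier VR.\<T> \<Longrightarrow> KR.pure X \<one>\<^bsub>R\<^esub> \<odot>\<^bsub>KV\<^esub> \<xi> = X\<^sub>R \<xi>"
  using act_kel[of \<zero> \<one> "\<one>\<^bsub>R\<^esub>" \<xi>] by (simp add: X_eq_kel[symmetric] VR.linear_ext_closed[OF X_hom])

lemma X_in_K: "X \<in> carrier K"
  using kel_in_K[of \<zero> \<one>] by (simp add: X_eq_kel[symmetric])

lemma K_one_closed: "\<one>\<^bsub>K\<^esub> \<in> carrier K"
  by (simp add: K_one)

text \<open>One direction specializes the scalar to 1 \<otimes> r and X \<otimes> 1. In the other,
  \<open>act_kel\<close> settles pure tensors, and additivity of the action in the scalar settles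
  sums.\<close>

lemma End_alg_cross_scalar_ext:
  "\<phi> \<in> carrier (End_alg (algebra_ext F K R) KV) \<longleftrightarrow>
    \<phi> \<in> carrier (End_alg R VR.\<T>) \<and> (\<forall>\<xi>\<in>carrier VR.\<T>. \<phi> (X\<^sub>R \<xi>) = X\<^sub>R (\<phi> \<xi>))"
proof
  assume \<phi>: "\<phi> \<in> carrier (End_alg (algebra_ext F K R) KV)"
  then have \<phi>h: "\<phi> \<in> module_hom (algebra_ext F K R) KV KV" and ext: "\<phi> \<in> extensional (carrier VR.\<T>)"
    by simp_all
  have m: "\<phi> \<xi> \<in> carrier VR.\<T>" if "\<xi> \<in> carrier VR.\<T>" for \<xi> using module_hom_mem[OF \<phi>h] that by simp
  have act: "\<phi> (\<kappa> \<odot>\<^bsub>KV\<^esub> \<xi>) = \<kappa> \<odot>\<^bsub>KV\<^esub> \<phi> \<xi>" if "\<kappa> \<in> carrier KR.\<T>" "\<xi> \<in> carrier VR.\<T>" for \<kappa> \<xi>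
    using module_hom_smult[OF \<phi>h] that by simp
  have "\<phi> (r \<odot>\<^bsub>VR.\<T>\<^esub> \<xi>) = r \<odot>\<^bsub>VR.\<T>\<^esub> \<phi> \<xi>" if "r \<in> carrier R" "\<xi> \<in> carrier VR.\<T>" for r \<xi>
    using act[of "KR.pure \<one>\<^bsub>K\<^esub> r" \<xi>] that by (simp add: act_one m K_one_closed)
  then have "\<phi> \<in> carrier (End_alg R VR.\<T>)"
    using m module_hom_add[OF \<phi>h] ext by (intro End_algI) simp_all
  moreover have "\<phi> (X\<^sub>R \<xi>) = X\<^sub>R (\<phi> \<xi>)" if "\<xi> \<in> carrier VR.\<T>" for \<xi>
    using act[of "KR.pure X \<one>\<^bsub>R\<^esub>" \<xi>] that by (simp add: act_X m X_in_K)
  ultimately show "\<phi> \<in> carrier (End_alg R VR.\<T>) \<and> (\<forall>\<xi>\<in>carrier VR.\<T>. \<phi> (X\<^sub>R \<xi>) = X\<^sub>R (\<phi> \<xi>))" by blast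
next
  assume \<phi>: "\<phi> \<in> carrier (End_alg R VR.\<T>) \<and> (\<forall>\<xi>\<in>carrier VR.\<T>. \<phi> (X\<^sub>R \<xi>) = X\<^sub>R (\<phi> \<xi>))"
  then have \<phi>h: "\<phi> \<in> module_hom R VR.\<T> VR.\<T>" and ext: "\<phi> \<in> extensional (carrier VR.\<T>)"
    and X: "\<And>\<xi>. \<xi> \<in> carrier VR.\<T> \<Longrightarrow> \<phi> (X\<^sub>R \<xi>) = X\<^sub>R (\<phi> \<xi>)" by simp_all
  note \<phi>m = module_hom_mem[OF \<phi>h] module_hom_add[OF \<phi>h] module_hom_smult[OF \<phi>h]
  show "\<phi> \<in> carrier (End_alg (algebra_ext F K R) KV)"
  proof (rule End_algI)
    fix \<kappa> \<xi> assume "\<kappa> \<in> carrier (algebra_ext F K R)" and "\<xi> \<in> carrier KV"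
    then have \<kappa>: "\<kappa> \<in> carrier KR.\<T>" and \<xi>: "\<xi> \<in> carrier VR.\<T>" by simp_all
    note left = act_additive_left[OF \<xi>] act_additive_left[OF \<phi>m(1)[OF \<xi>]]
    from \<kappa> show "\<phi> (\<kappa> \<odot>\<^bsub>KV\<^esub> \<xi>) = \<kappa> \<odot>\<^bsub>KV\<^esub> \<phi> \<xi>"
    proof (induction rule: KR.tensor_induct)
      case (pure k r)
      from pure(1) obtain a c where "a \<in> carrier F" "c \<in> carrier F" "k = kel a c" by (rule K_cases)
      then show ?case
        using pure(2) \<xi> by (simp add: act_kel \<phi>m X VR.linear_ext_closed[OF X_hom])
    next
      case (add \<kappa> \<kappa>')
      then show ?case
        using \<xi> by (simp add: additive_map_add[OF left(1)] additive_map_add[OF left(2)]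
            additive_map_closed[OF left(1)] \<phi>m)
    qed
  qed (use ext in \<open>simp_all add: \<phi>m\<close>)
qed

section \<open>The extended hermitian form and the unitary group\<close>

lemma
  shows h_ext_additive_left: "\<eta> \<in> carrier VR.\<T> \<Longrightarrow> additive_map VR.\<T> KR.\<T> (\<lambda>\<xi>. h\<^sub>R \<xi> \<eta>)"
    and h_ext_additive_right: "\<xi> \<in> carrier VR.\<T> \<Longrightarrow> additive_map VR.\<T> KR.\<T> (h\<^sub>R \<xi>)"
    and h_ext_pure: "u \<in> carrier V \<Longrightarrow> r \<in> carrier R \<Longrightarrow> v \<in> carrier V \<Longrightarrow> s \<in> carrier R \<Longrightarrow>
      h\<^sub>R (VR.pure u r) (VR.pure v s) = KR.pure (h u v) (r \<otimes>\<^bsub>R\<^esub> s)"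
proof -
  have bil: "bilinear_map F V K h" using hermitian_cross_hermitian by (simp add: hermitian_form_def)
  have hl: "(\<lambda>u. h u v) \<in> module_hom F V K" and hr: "h v \<in> module_hom F V K" if "v \<in> carrier V" for v
    using bil that by (simp_all add: bilinear_map_def)
  note hm = module_hom_mem[OF hr] module_hom_add[OF hr] module_hom_smult[OF hr]
    module_hom_add[OF hl] module_hom_smult[OF hl]
  have t1: "balanced_map F V R KR.\<T> (\<lambda>v s. KR.pure (h u v) (r \<otimes>\<^bsub>R\<^esub> s))"
    if "u \<in> carrier V" "r \<in> carrier R" for u r
    by (rule balanced_mapI)
       (use that in \<open>simp_all add: hm KR.pure_add_left KR.pure_add_right R.r_distr KR.pure_smult KR.smult_r_assoc\<close>)
  have t2: "balanced_map F V R KR.\<T> (\<lambda>u r. KR.pure (h u v) (r \<otimes>\<^bsub>R\<^esub> s))"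
    if "v \<in> carrier V" "s \<in> carrier R" for v s
    by (rule balanced_mapI)
       (use that in \<open>simp_all add: hm KR.pure_add_left KR.pure_add_right R.l_distr KR.pure_smult R.smult_assoc2\<close>)
  note lift2 = VR.tensor_product_axioms VR.tensor_product_axioms KR.abelian_group_scalar_ext
    KR.additive_group_scalar_ext t1 t2
  show "\<eta> \<in> carrier VR.\<T> \<Longrightarrow> additive_map VR.\<T> KR.\<T> (\<lambda>\<xi>. h\<^sub>R \<xi> \<eta>)"
    unfolding bilinear_ext_def using tensor_lift2_additive_left[OF lift2] by simp
  show "\<xi> \<in> carrier VR.\<T> \<Longrightarrow> additive_map VR.\<T> KR.\<T> (h\<^sub>R \<xi>)"
    unfolding bilinear_ext_def using tensor_lift2_additive_right[OF lift2] by simp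
  show "u \<in> carrier V \<Longrightarrow> r \<in> carrier R \<Longrightarrow> v \<in> carrier V \<Longrightarrow> s \<in> carrier R \<Longrightarrow>
      h\<^sub>R (VR.pure u r) (VR.pure v s) = KR.pure (h u v) (r \<otimes>\<^bsub>R\<^esub> s)"
    unfolding bilinear_ext_def using tensor_lift2_pure[OF lift2] by simp
qed

lemma kel_pure:
  assumes "a \<in> carrier F" "c \<in> carrier F" "r \<in> carrier R"
  shows "KR.pure (kel a c) r = KR.pure \<one>\<^bsub>K\<^esub> (a \<odot>\<^bsub>R\<^esub> r) \<oplus>\<^bsub>KR.\<T>\<^esub> KR.pure X (c \<odot>\<^bsub>R\<^esub> r)"
proof -
  have "kel a c = a \<odot>\<^bsub>K\<^esub> \<one>\<^bsub>K\<^esub> \<oplus>\<^bsub>K\<^esub> c \<odot>\<^bsub>K\<^esub> kel \<zero> \<one>"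
    using assms by (simp add: K_one kel_smult kel_add)
  then show ?thesis
    using assms by (simp add: KR.pure_add_left KR.pure_smult K_one_closed X_in_K X_eq_kel[symmetric])
qed

text \<open>Both sides are biadditive. On pure tensors, the coordinates of h(u, v) move across the
  tensor sign by \<open>kel_pure\<close> and become values of b_R.\<close>

lemma h_ext_eq:
  assumes \<xi>: "\<xi> \<in> carrier VR.\<T>" and \<eta>: "\<eta> \<in> carrier VR.\<T>"
  shows "h\<^sub>R \<xi> \<eta> = KR.pure \<one>\<^bsub>K\<^esub> (b\<^sub>R \<xi> \<eta>) \<oplus>\<^bsub>KR.\<T>\<^esub> KR.pure X (\<ominus>\<^bsub>R\<^esub> b\<^sub>R (X\<^sub>R \<xi>) \<eta>)"
proof -
  note bR = VR.form_ext_closed[OF bilinear] VR.form_ext_add_left[OF bilinear]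
    VR.form_ext_add_right[OF bilinear] VR.form_ext_pure[OF bilinear]
  note XR = VR.linear_ext_closed[OF X_hom] VR.linear_ext_add[OF X_hom] VR.linear_ext_pure[OF X_hom]
  note K = K_one_closed X_in_K KR.pure_add_right R.minus_add KR.T.a_ac
  from \<xi> show ?thesis
  proof (induction rule: VR.tensor_induct)
    case (pure u r)
    from \<eta> show ?case
    proof (induction rule: VR.tensor_induct)
      case (pure v s)
      then show ?case
        using \<open>u \<in> carrier V\<close> \<open>r \<in> carrier R\<close>
        by (simp add: h_ext_pure h_eq_kel kel_pure bR XR R.smult_l_minus)
    next
      case (add \<eta> \<eta>')
      then show ?case
        using pure by (simp add: additive_map_add[OF h_ext_additive_right] bR XR K)
    qed
  next
    case (add \<xi> \<xi>')
    then show ?case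
      using \<eta> by (simp add: additive_map_add[OF h_ext_additive_left] bR XR K)
  qed
qed

text \<open>Comparing coefficients in K_R would require 1 and X to stay independent over R. Instead
  the projection p of K is extended to P with P(k \<otimes> r) = p(k) r, and P applied to h_R gives
  b_R.\<close>

lemma form_ext_of_h_ext:
  assumes "\<xi> \<in> carrier VR.\<T>" "\<eta> \<in> carrier VR.\<T>" "\<xi>' \<in> carrier VR.\<T>" "\<eta>' \<in> carrier VR.\<T>"
    and "h\<^sub>R \<xi> \<eta> = h\<^sub>R \<xi>' \<eta>'"
  shows "b\<^sub>R \<xi> \<eta> = b\<^sub>R \<xi>' \<eta>'"
proof -
  obtain p where p: "p \<in> module_hom F K (regular_module F)"
    and ph: "\<And>u v. u \<in> carrier V \<Longrightarrow> v \<in> carrier V \<Longrightarrow> p (h u v) = b u v" by (rule K_projection) blast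
  have pm: "k \<in> carrier K \<Longrightarrow> p k \<in> carrier F"
    "k \<in> carrier K \<Longrightarrow> k' \<in> carrier K \<Longrightarrow> p (k \<oplus>\<^bsub>K\<^esub> k') = p k \<oplus> p k'"
    "a \<in> carrier F \<Longrightarrow> k \<in> carrier K \<Longrightarrow> p (a \<odot>\<^bsub>K\<^esub> k) = a \<otimes> p k" for a k k'
    using module_hom_mem[OF p] module_hom_add[OF p] module_hom_smult[OF p]
    by (simp_all add: regular_module_def)
  have bal: "balanced_map F K R R (\<lambda>k r. p k \<odot>\<^bsub>R\<^esub> r)"
    by (rule balanced_mapI)
       (simp_all add: pm R.smult_l_distr R.smult_r_distr R.smult_assoc1 R.smult_left_commute)
  obtain P where P: "additive_map KR.\<T> R P"
    "\<And>k r. k \<in> carrier K \<Longrightarrow> r \<in> carrier R \<Longrightarrow> P (KR.pure k r) = p k \<odot>\<^bsub>R\<^esub> r"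
    by (rule KR.tensor_lift_exists[OF R.is_abelian_group bal]) blast
  have hK: "h u v \<in> carrier K" if "u \<in> carrier V" "v \<in> carrier V" for u v
    using that by (simp add: h_eq_kel)
  note bR = VR.form_ext_add_left[OF bilinear] VR.form_ext_add_right[OF bilinear]
    VR.form_ext_pure[OF bilinear]
  have Ph: "P (h\<^sub>R \<xi> \<eta>) = b\<^sub>R \<xi> \<eta>" if \<xi>: "\<xi> \<in> carrier VR.\<T>" and \<eta>: "\<eta> \<in> carrier VR.\<T>" for \<xi> \<eta>
    using \<xi>
  proof (induction rule: VR.tensor_induct)
    case (pure u r)
    from \<eta> show ?case
    proof (induction rule: VR.tensor_induct)
      case (pure v s)
      then show ?case
        using \<open>u \<in> carrier V\<close> \<open>r \<in> carrier R\<close> by (simp add: h_ext_pure bR P(2) hK ph)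
    next
      case (add \<eta> \<eta>')
      then show ?case
        using pure by (simp add: additive_map_add[OF h_ext_additive_right] bR
            additive_map_add[OF P(1)] additive_map_closed[OF h_ext_additive_right])
    qed
  next
    case (add \<xi> \<xi>')
    then show ?case
      using \<eta> by (simp add: additive_map_add[OF h_ext_additive_left] bR
            additive_map_add[OF P(1)] additive_map_closed[OF h_ext_additive_left])
  qed
  show ?thesis using Ph assms by metis
qed

lemma Aut_Xb_fun_eq_U_fun:
  assumes fd: "V.fin_dim"
  shows "Aut_Xb_fun F V X b R = U_fun F V X h R"
proof -
  have car: "carrier (Aut_Xb_fun F V X b R) = {\<phi> \<in> carrier (End_alg (algebra_ext F K R) KV).
      \<forall>\<xi>\<in>carrier VR.\<T>. \<forall>\<eta>\<in>carrier VR.\<T>. h\<^sub>R (\<phi> \<xi>) (\<phi> \<eta>) = h\<^sub>R \<xi> \<eta>}"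
  proof (intro equalityI subsetI)
    fix \<phi> assume "\<phi> \<in> carrier (Aut_Xb_fun F V X b R)"
    then have \<phi>U: "\<phi> \<in> Units (End_alg R VR.\<T>)"
      and X: "\<And>\<xi>. \<xi> \<in> carrier VR.\<T> \<Longrightarrow> \<phi> (X\<^sub>R \<xi>) = X\<^sub>R (\<phi> \<xi>)"
      and pres: "\<And>\<xi> \<eta>. \<xi> \<in> carrier VR.\<T> \<Longrightarrow> \<eta> \<in> carrier VR.\<T> \<Longrightarrow> b\<^sub>R (\<phi> \<xi>) (\<phi> \<eta>) = b\<^sub>R \<xi> \<eta>"
      by (auto simp: Aut_Xb_fun_def VR.Aut_X_fun_mem VR.O_fun_mem VR.carrier_GL_fun)
    note \<phi>E = Units_End_algD[OF \<phi>U]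
    \<comment> \<open>By \<open>h_ext_eq\<close> two values of b_R must be preserved. The second has
      X_R (\<phi> \<xi>) in its first slot; commutation rewrites it as \<phi> (X_R \<xi>), and
      preservation of b_R applies again.\<close>
    have "h\<^sub>R (\<phi> \<xi>) (\<phi> \<eta>) = h\<^sub>R \<xi> \<eta>" if "\<xi> \<in> carrier VR.\<T>" "\<eta> \<in> carrier VR.\<T>" for \<xi> \<eta>
      using that by (simp add: h_ext_eq End_alg_apply_closed[OF \<phi>E] pres X[symmetric]
          VR.linear_ext_closed[OF X_hom])
    moreover have "\<phi> \<in> carrier (End_alg (algebra_ext F K R) KV)"
      unfolding End_alg_cross_scalar_ext by (intro conjI ballI \<phi>E X)
    ultimately show "\<phi> \<in> {\<phi> \<in> carrier (End_alg (algebra_ext F K R) KV).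
      \<forall>\<xi>\<in>carrier VR.\<T>. \<forall>\<eta>\<in>carrier VR.\<T>. h\<^sub>R (\<phi> \<xi>) (\<phi> \<eta>) = h\<^sub>R \<xi> \<eta>}"
      by (intro CollectI conjI ballI)
  next
    fix \<phi> assume "\<phi> \<in> {\<phi> \<in> carrier (End_alg (algebra_ext F K R) KV).
      \<forall>\<xi>\<in>carrier VR.\<T>. \<forall>\<eta>\<in>carrier VR.\<T>. h\<^sub>R (\<phi> \<xi>) (\<phi> \<eta>) = h\<^sub>R \<xi> \<eta>}"
    then have \<phi>E: "\<phi> \<in> carrier (End_alg R VR.\<T>)"
      and X: "\<And>\<xi>. \<xi> \<in> carrier VR.\<T> \<Longrightarrow> \<phi> (X\<^sub>R \<xi>) = X\<^sub>R (\<phi> \<xi>)"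
      and presh: "\<And>\<xi> \<eta>. \<xi> \<in> carrier VR.\<T> \<Longrightarrow> \<eta> \<in> carrier VR.\<T> \<Longrightarrow> h\<^sub>R (\<phi> \<xi>) (\<phi> \<eta>) = h\<^sub>R \<xi> \<eta>"
      using End_alg_cross_scalar_ext[of \<phi>] by blast+
    have pres: "b\<^sub>R (\<phi> \<xi>) (\<phi> \<eta>) = b\<^sub>R \<xi> \<eta>" if "\<xi> \<in> carrier VR.\<T>" "\<eta> \<in> carrier VR.\<T>" for \<xi> \<eta>
      using that by (intro form_ext_of_h_ext End_alg_apply_closed[OF \<phi>E] presh)
    have "\<phi> \<in> Units (End_alg R VR.\<T>)"
      by (rule VR.isometry_in_Units[OF V.vectorspace_axioms fd bilinear nondeg \<phi>E pres])
    then show "\<phi> \<in> carrier (Aut_Xb_fun F V X b R)"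
      using X pres by (simp add: Aut_Xb_fun_def VR.Aut_X_fun_mem VR.O_fun_mem VR.carrier_GL_fun)
  qed
  \<comment> \<open>Equality of the monoid records, not only of the carriers: over R and over K_R
    the product is composition on the same carrier and the unit is its identity map.\<close>
  have "Aut_Xb_fun F V X b R = \<lparr>carrier = carrier (Aut_Xb_fun F V X b R),
      mult = compose (carrier VR.\<T>), one = (\<lambda>\<xi>\<in>carrier VR.\<T>. \<xi>)\<rparr>"
    by (simp add: Aut_Xb_fun_def GL_fun_def units_of_def)
  also have "\<dots> = U_fun F V X h R"
    unfolding car U_fun_def by (simp add: Let_def)
  finally show ?thesis .
qed

end

text \<open>R, S and f are arbitrary, so the equalities hold over every algebra. The statements
  about groups and \<open>base_change\<close> therefore carry over to the centralizer and to the
  unitary group by substitution at R and at S.\<close>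

theorem theorem3p1:
  fixes F :: "'f ring" and V :: "('f, 'v) module"
    and R :: "('f, 'r) module" and S :: "('f, 's) module"
    and b :: "'v \<Rightarrow> 'v \<Rightarrow> 'f" and X :: "'v \<Rightarrow> 'v" and f :: "'r \<Rightarrow> 's"
  assumes "vectorspace F V" and "vectorspace.fin_dim F V" and "even (vectorspace.dim F V)"
    and "\<one>\<^bsub>F\<^esub> \<oplus>\<^bsub>F\<^esub> \<one>\<^bsub>F\<^esub> \<noteq> \<zero>\<^bsub>F\<^esub>"
    and "symmetric_bilinear_form F V b" and "nondegenerate V (regular_module F) b"
    and "one_fold_cross_product F V b X"
    and "algebra F R" and "algebra F S" and "f \<in> algebra_hom F R S"
  shows "(Aut_X_fun F V X R = Cent_GL_fun F V X R \<and>
      group (Aut_X_fun F V X R) \<and>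
      base_change F V R S f \<in> hom (Aut_X_fun F V X R) (Aut_X_fun F V X S)) \<and>
    (let h = cross_hermitian F V b X in
      hermitian_form F V X h \<and> nondegenerate V (cross_algebra F V X) h \<and>
      Aut_Xb_fun F V X b R = U_fun F V X h R \<and>
      group (Aut_Xb_fun F V X b R) \<and>
      base_change F V R S f \<in> hom (Aut_Xb_fun F V X b R) (Aut_Xb_fun F V X b S))"
proof -
  interpret cross_product F V b X
    using assms by (simp add: cross_product_def cross_product_axioms_def)
  interpret R: cross_product_extension F V b X R
    using assms by (simp add: cross_product_extension_def cross_product_axioms)
  have mV: "module F V" using V.module_axioms .
  interpret f: algebra_morphism F V R S f
    using assms mV
    by (simp add: algebra_morphism_def algebra_morphism_axioms_def scalar_extension_def)
  show ?thesis
    unfolding Let_def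
    using R.VR.Aut_X_fun_eq_Cent_GL_fun[OF X_hom] R.VR.group_Aut_X_fun[OF X_hom]
      f.base_change_hom_Aut_X[OF X_hom] hermitian_cross_hermitian nondegenerate_cross_hermitian
      R.Aut_Xb_fun_eq_U_fun[OF assms(2)] R.VR.group_Aut_Xb_fun[OF X_hom]
      f.base_change_hom_Aut_Xb[OF X_hom bilinear]
    by blast
qed

end
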